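(* Let $c>0$. If $1<p<\infty$ and $f\in L^p(\mathbb{R})$, then $\Psi_N f\to P_c f$ almost everywhere on $\mathbb{R}$ as $N\to\infty$. Moreover, for $p=1$, $\Psi_N f\to f$ almost everywhere for every $f\in PW_c^1$.
   Context: The Fourier transform is $\widehat f(\xi)=\int_{\mathbb{R}} f(t)e^{-2\pi i\xi t}\,dt$ for $f\in L^1(\mathbb{R})$, extended to $L^2(\mathbb{R})$ and to tempered distributions as usual. For $1\le p<\infty$, $PW_c^p=\{f\in L^p(\mathbb{R}):\ \operatorname{supp}\widehat f\subseteq[-c,c]\}$ (Fourier transform in the distributional sense when $p>2$). The projection is $P_cf=\mathcal F^{-1}(\chi_{[-c,c]}\mathcal F f)$, i.e. $P_cf(x)=\int_{\mathbb{R}} f(t)\frac{\sin(2\pi c(x-t))}{\pi(x-t)}\,dt$ (principal value sense), which extends to a bounded operator on $L^p(\mathbb{R})$ for $1<p<\infty$. The prolate spheroidal wave functions $(\psi_{n,c})_{n\ge0}$ are defined recursively by $\psi_{n,c}=\operatorname{argmax}\{\|f\|_{L^2(-1,1)}/\|f\|_{L^2(\mathbb{R})}:\ f\in PW_c^2,\ f\perp\psi_{k,c}\ \text{for all } k<n\}$ (normalized in $L^2(\mathbb{R})$); they form an orthonormal basis of $PW_c^2$ and belong to $L^q(\mathbb{R})$ for every $1<q\le\infty$. For $f\in L^p(\mathbb{R})$, $\Psi_Nf:=\sum_{n=0}^N\langle f,\psi_{n,c}\rangle\psi_{n,c}$, where $\langle f,g\rangle=\int_{\mathbb{R}} f\overline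 g$. *)

theory Defs
  imports "HOL-Analysis.Analysis"
begin

definition memLp :: "real \<Rightarrow> (real \<Rightarrow> complex) \<Rightarrow> bool" where
  "memLp p f \<longleftrightarrow> f \<in> borel_measurable lebesgue \<and>
     integrable lebesgue (\<lambda>x. norm (f x) powr p)"

definition fourier :: "(real \<Rightarrow> complex) \<Rightarrow> real \<Rightarrow> complex" where
  "fourier f \<xi> = (\<integral>t. f t * cis (- 2 * pi * \<xi> * t) \<partial>lebesgue)"

definition smooth_real :: "(real \<Rightarrow> real) \<Rightarrow> bool" where
  "smooth_real g \<longleftrightarrow> (\<forall>n x. ((deriv ^^ n) g) differentiable (at x))"

definition test_fun :: "(real \<Rightarrow> complex) \<Rightarrow> bool" where
  "test_fun \<phi> \<longleftrightarrow> smooth_real (\<lambda>x. Re (\<phi> x)) \<and> smooth_real (\<lambda>x. Im (\<phi> x)) \<and>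
     compact (closure {x. \<phi> x \<noteq> 0})"

text \<open>Paley--Wiener space: f in L^p whose (distributional) Fourier transform is supported
  in [-c,c], i.e. the distribution phi |-> int f * fourier phi vanishes on every test function
  whose support is disjoint from [-c,c].\<close>
definition PW :: "real \<Rightarrow> real \<Rightarrow> (real \<Rightarrow> complex) \<Rightarrow> bool" where
  "PW c p f \<longleftrightarrow> memLp p f \<and>
     (\<forall>\<phi>. test_fun \<phi> \<and> closure {x. \<phi> x \<noteq> 0} \<inter> {-c..c} = {} \<longrightarrow>
        (\<integral>x. f x * fourier \<phi> x \<partial>lebesgue) = 0)"

definition inner_L :: "(real \<Rightarrow> complex) \<Rightarrow> (real \<Rightarrow> complex) \<Rightarrow> complex" where
  "inner_L f g = (\<integral>x. f x * cnj (g x) \<partial>lebesgue)"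

definition L2norm :: "(real \<Rightarrow> complex) \<Rightarrow> real" where
  "L2norm f = sqrt (\<integral>x. (cmod (f x))\<^sup>2 \<partial>lebesgue)"

definition L2norm_on :: "real set \<Rightarrow> (real \<Rightarrow> complex) \<Rightarrow> real" where
  "L2norm_on A f = sqrt (LINT x:A|lebesgue. (cmod (f x))\<^sup>2)"

definition conc_ratio :: "(real \<Rightarrow> complex) \<Rightarrow> real" where
  "conc_ratio f = L2norm_on {-1<..<1} f / L2norm f"

definition is_PSWF :: "real \<Rightarrow> (nat \<Rightarrow> real \<Rightarrow> complex) \<Rightarrow> bool" where
  "is_PSWF c \<psi> \<longleftrightarrow> (\<forall>n.
     PW c 2 (\<psi> n) \<and> L2norm (\<psi> n) = 1 \<and> (\<forall>k<n. inner_L (\<psi> n) (\<psi> k) = 0) \<and>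
     (\<forall>f. PW c 2 f \<and> L2norm f \<noteq> 0 \<and> (\<forall>k<n. inner_L f (\<psi> k) = 0) \<longrightarrow>
        conc_ratio f \<le> conc_ratio (\<psi> n)))"

text \<open>Projection P_c f(x) = int f(t) sin(2 pi c (x-t)) / (pi (x-t)) dt (absolutely convergent
  for f in L^p, 1 < p < infinity).\<close>
definition Pc :: "real \<Rightarrow> (real \<Rightarrow> complex) \<Rightarrow> real \<Rightarrow> complex" where
  "Pc c f x = (\<integral>t. f t * complex_of_real (sin (2 * pi * c * (x - t)) / (pi * (x - t))) \<partial>lebesgue)"

definition PsiN :: "(nat \<Rightarrow> real \<Rightarrow> complex) \<Rightarrow> nat \<Rightarrow> (real \<Rightarrow> complex) \<Rightarrow> real \<Rightarrow> complex" where
  "PsiN \<psi> N f x = (\<Sum>n\<le>N. inner_L f (\<psi> n) * \<psi> n x)"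

end

theory Submission
  imports Defs "HOL-Probability.Sinc_Integral" "HOL-Probability.Characteristic_Functions"
begin

text \<open>
  The sinc kernel reproduces the Paley--Wiener space, and the extremal property makes
  \<open>\<psi> n\<close> an eigenfunction of the concentration operator, with eigenvalue \<open>sig n ^ 2\<close>:
  \<open>sig n ^ 2 * \<psi> n = Pc c (1\<^bsub>(-1,1)\<^esub> * \<psi> n)\<close>.
  This gives \<open>\<bar>\<psi> n t\<bar> \<le> C / (sig n * (1 + \<bar>t\<bar>))\<close>, which interpolates with the uniform bound
  \<open>\<bar>\<psi> n t\<bar> \<le> C\<close> to \<open>\<bar>\<psi> n t\<bar> \<le> C * (sig n * (1 + \<bar>t\<bar>)) powr (- a)\<close> for every \<open>a < 1\<close>.
  Conversely, band-limited functions are so close to polynomials that Lagrange extrapolation from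
  \<open>(-1,1)\<close> bounds \<open>\<bar>\<psi> n x\<bar>\<close> by \<open>C x * sig n powr (1 - e)\<close> for fixed \<open>x\<close>, and \<open>sig n\<close> decays
  geometrically. Hence \<open>\<Sum>n. \<bar>\<psi> n x\<bar> * \<bar>\<psi> n t\<bar>\<close> is at most a multiple of \<open>(1 + \<bar>t\<bar>) powr (- a)\<close>, which is
  integrable against every \<open>L\<^sup>p\<close> function if \<open>a\<close> is close to \<open>1\<close>. The same extrapolation, applied to the
  remainder, identifies the sum of \<open>\<psi> n x * cnj (\<psi> n t)\<close> with the sinc kernel, and dominated convergence
  finishes the proof. Plancherel's theorem is not needed: all \<open>L\<^sup>2\<close> bounds on Fourier transforms
  come from the decay \<open>1 / (1 + \<bar>t\<bar>)\<close> obtained by one integration by parts.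
\<close>

section \<open>The sinc kernel\<close>

text \<open>The obstacle is that the decay bound in t carries the factor 1 / \<open>sig n\<close>,
  which grows at least geometrically. Raised only to the power a it costs
  \<open>sig n powr (- a)\<close>, and the smallness of \<open>psi n x\<close> at a fixed x returns
  \<open>sig n powr (1 - e)\<close> with e > 0 arbitrary, so the sum over n converges as soon as a +
  e < 1. On the other side, integrability against L^p asks for a above 1 - 1/p; there is room below
  1 because p is finite. The exponent 1 - e comes from a competition in the degree m of the
  approximating polynomial: extrapolation from (-1,1) loses D^m, the Taylor remainder gains q^m /
  m!, and the factorial beats every geometric factor once m is about e * ln (1/d) / ln D for a
  function of concentration d. Completeness enters through the extremal property itself: the
  remainder of the sinc kernel stays orthogonal to the first functions and is therefore small on
  (-1,1).\<close>

definition wgt :: "real \<Rightarrow> real" where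
  "wgt t = 1 / (1 + \<bar>t\<bar>)"

lemma wgt_pos [simp]: "0 < wgt t"
  by (simp add: wgt_def add_pos_nonneg)

lemma wgt_nonneg [simp]: "0 \<le> wgt t"
  using wgt_pos[of t] by linarith

lemma wgt_le_1 [simp]: "wgt t \<le> 1"
  by (simp add: wgt_def)

lemma wgt_measurable [measurable]: "wgt \<in> borel_measurable borel"
  unfolding wgt_def [abs_def] by measurable

lemma le_wgtI: "x \<le> a \<Longrightarrow> \<bar>t\<bar> * x \<le> b \<Longrightarrow> x \<le> (a + b) * wgt t"
  by (simp add: wgt_def field_simps add_pos_nonneg)

text \<open>A shift by at most A changes 1 + |t| by at most the factor 1 + A. In this way every
  bound for a kernel centred at y is brought back to the fixed weight \<open>wgt t\<close>.\<close>

lemma wgt_diff_le: "\<bar>s\<bar> \<le> A \<Longrightarrow> wgt (t - s) \<le> (1 + A) * wgt t"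
proof -
  assume s: "\<bar>s\<bar> \<le> A"
  have "0 \<le> A * \<bar>t - s\<bar>" using s by (intro mult_nonneg_nonneg) auto
  moreover have "\<bar>t\<bar> \<le> \<bar>t - s\<bar> + A" using s by arith
  ultimately have "1 + \<bar>t\<bar> \<le> (1 + A) * (1 + \<bar>t - s\<bar>)"
    by (simp add: algebra_simps)
  then show ?thesis
    by (simp add: wgt_def divide_simps add_pos_nonneg mult.commute)
qed

lemma integrable_wgt_powr:
  assumes "q > 1" shows "integrable lebesgue (\<lambda>t. wgt t powr q)"
proof -
  have 1: "((\<lambda>x. x powr (-q)) has_integral (-(1 powr (-q + 1)) / (-q + 1))) {1..}"
    by (rule has_integral_powr_to_inf) (use assms in auto)
  then have "set_integrable lebesgue {1..} (\<lambda>x. x powr (-q))"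
    by (intro nonnegative_absolutely_integrable_1) auto
  then have 2: "integrable lebesgue (\<lambda>x. indicator {1..} x * x powr (-q))"
    by (simp add: set_integrable_def)
  have h2: "integrable lborel (\<lambda>x. indicator {1..} x * x powr (-q))"
    using 2 by (subst (asm) integrable_completion) auto
  have 3: "integrable lborel (\<lambda>x. indicator {1..} (1 + x) * (1 + x) powr (-q))"
    using lborel_integrable_real_affine[OF h2, of 1 1] by simp
  have 4: "integrable lborel (\<lambda>x. indicator {1..} (1 - x) * (1 - x) powr (-q))"
    using lborel_integrable_real_affine[OF h2, of "-1" 1] by simp
  have "integrable lborel (\<lambda>t. wgt t powr q)"
  proof (rule Bochner_Integration.integrable_bound[OF Bochner_Integration.integrable_add[OF 3 4]])
    show "AE x in lborel. norm (wgt x powr q) \<le> norm (indicator {1..} (1 + x) * (1 + x) powr (-q) +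
        indicator {1..} (1 - x) * (1 - x) powr (-q))"
      by (auto simp: indicator_def wgt_def powr_divide powr_minus_divide)
  qed auto
  then show ?thesis
    by (subst integrable_completion) auto
qed

lemma integrable_wgt_square: "integrable lebesgue (\<lambda>t. (wgt t)^2)"
  using integrable_wgt_powr[of 2] by (simp add: powr_numeral)

text \<open>The Fourier transform of the indicator of [-c,c]. The quotient in \<open>Pc\<close>
  evaluates to 0 where the denominator vanishes; here the value at 0 is the continuous one, 2 *
  c.\<close>

definition ker :: "real \<Rightarrow> real \<Rightarrow> real" where
  "ker c u = 2 * c * sinc (2 * pi * c * u)"

lemma ker_eq: "u \<noteq> 0 \<Longrightarrow> ker c u = sin (2 * pi * c * u) / (pi * u)"
  by (cases "c = 0") (auto simp: ker_def)

lemma ker_minus [simp]: "ker c (- u) = ker c u"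
  by (simp add: ker_def)

lemma ker_commute: "ker c (x - y) = ker c (y - x)"
  using ker_minus[of c "y - x"] by simp

lemma continuous_on_ker [continuous_intros]:
  "continuous_on S f \<Longrightarrow> continuous_on S (\<lambda>x. ker c (f x))"
  unfolding ker_def by (intro continuous_intros)

lemma ker_measurable [measurable]: "ker c \<in> borel_measurable borel"
  by (intro borel_measurable_continuous_onI continuous_intros)

lemma tendsto_ker: "((\<lambda>s. ker s u) \<longlongrightarrow> ker c u) (at c within S)"
proof -
  have "continuous_on UNIV (\<lambda>s. ker s u)"
    unfolding ker_def by (intro continuous_intros)
  then have "isCont (\<lambda>s. ker s u) c"
    by (simp add: continuous_on_eq_continuous_at)
  then show ?thesis
    by (meson isCont_def tendsto_within_subset subset_UNIV)
qed

lemma ker_le: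
  assumes "c \<ge> 0" shows "\<bar>ker c u\<bar> \<le> (2 * c + 1) * wgt u"
proof (rule le_wgtI)
  have "\<bar>sinc x\<bar> \<le> 1" for x
    by (cases "x = 0") (use abs_sin_x_le_abs_x[of x] in \<open>auto simp: divide_simps\<close>)
  then show "\<bar>ker c u\<bar> \<le> 2 * c"
    using assms mult_left_mono[of "\<bar>sinc (2 * pi * c * u)\<bar>" 1 "2 * c"]
    by (simp only: ker_def abs_mult) simp
  show "\<bar>u\<bar> * \<bar>ker c u\<bar> \<le> 1"
  proof (cases "u = 0")
    case False
    then have "\<bar>u\<bar> * \<bar>ker c u\<bar> = \<bar>sin (2 * pi * c * u)\<bar> / pi"
      by (simp add: ker_eq abs_mult)
    also have "\<dots> \<le> 1 / 1" using pi_gt3 by (intro frac_le) auto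
    finally show ?thesis by simp
  qed auto
qed

lemma DERIV_Si_ker:
  "((\<lambda>u. Si (2 * pi * c * u) / pi) has_real_derivative ker c u) (at u)"
  by (auto intro!: derivative_eq_intros DERIV_chain2[OF DERIV_Si] simp: ker_def)

lemma cis_deriv: "((\<lambda>w. cis (- 2 * pi * w * v)) has_vector_derivative
     (- 2 * pi * \<i> * v) * cis (- 2 * pi * w * v)) (at w within S)"
  unfolding has_vector_derivative_def
  by (auto intro!: derivative_eq_intros simp: algebra_simps scaleR_conv_of_real)

lemma has_integral_cis_ker:
  assumes "c \<ge> 0"
  shows "((\<lambda>w. cis (- 2 * pi * w * u)) has_integral of_real (ker c u)) {-c..c}"
proof (cases "u = 0")
  case True
  then show ?thesis using has_integral_const_real[of "1::complex" "-c" c] assms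
    by (simp add: ker_def scaleR_conv_of_real)
next
  case False
  let ?F = "\<lambda>w. cis (- 2 * pi * w * u) / (- 2 * pi * \<i> * u)"
  have "(?F has_vector_derivative cis (- 2 * pi * w * u)) (at w within {-c..c})" for w
    using has_vector_derivative_divide[OF cis_deriv[of u w "{-c..c}"], of "- 2 * pi * \<i> * u"] False by simp
  then have "((\<lambda>w. cis (- 2 * pi * w * u)) has_integral (?F c - ?F (-c))) {-c..c}"
    using assms by (intro fundamental_theorem_of_calculus) auto
  moreover have "?F c - ?F (-c) = of_real (ker c u)"
    using False by (simp add: ker_eq complex_eq_iff Re_divide Im_divide power2_eq_square field_simps)
  ultimately show ?thesis by simp
qed

text \<open>\<open>G b - G a\<close> stands for the total variation of \<open>F\<close>; no continuity of \<open>F'\<close> is required.\<close>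

lemma by_parts_bound:
  fixes F :: "real \<Rightarrow> complex"
  assumes "a \<le> b"
    and F: "\<And>x. x \<in> {a..b} \<Longrightarrow> (F has_vector_derivative F' x) (at x within {a..b})"
    and G: "\<And>x. x \<in> {a..b} \<Longrightarrow> (G has_vector_derivative g x) (at x within {a..b})"
    and le: "\<And>x. x \<in> {a..b} \<Longrightarrow> norm (F' x) \<le> g x"
  shows "2 * pi * \<bar>v\<bar> * norm (integral {a..b} (\<lambda>w. F w * cis (- 2 * pi * w * v)))
     \<le> norm (F a) + norm (F b) + G b - G a"
proof -
  let ?e = "\<lambda>w. cis (- 2 * pi * w * v)"
  let ?I = "integral {a..b} (\<lambda>w. F w * ?e w)"
  have "continuous_on {a..b} F"
    using F by (meson continuous_on_eq_continuous_within has_vector_derivative_continuous)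
  moreover have "continuous_on {a..b} ?e" by (intro continuous_intros)
  ultimately have "(\<lambda>w. F w * ?e w) integrable_on {a..b}"
    by (intro integrable_continuous_real continuous_intros)
  then have 1: "((\<lambda>w. F w * ?e w) has_integral ?I) {a..b}" by blast
  have 2: "((\<lambda>w. F w * ((- 2 * pi * \<i> * v) * ?e w) + F' w * ?e w) has_integral (F b * ?e b - F a * ?e a)) {a..b}"
    by (intro fundamental_theorem_of_calculus assms has_vector_derivative_mult cis_deriv) auto
  \<comment> \<open>Integrability of \<open>F' w * ?e w\<close> comes by subtraction: the derivative
    of the product is integrable by the fundamental theorem, and \<open>F w * ?e w\<close> by
    continuity.\<close>
  have "((\<lambda>w. F' w * ?e w) has_integral (F b * ?e b - F a * ?e a) - (- 2 * pi * \<i> * v) * ?I) {a..b}"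
    using has_integral_diff[OF 2 has_integral_mult_right[OF 1, of "- 2 * pi * \<i> * v"]]
    by (simp add: algebra_simps)
  moreover have "(g has_integral (G b - G a)) {a..b}"
    by (intro fundamental_theorem_of_calculus assms)
  ultimately have "norm ((F b * ?e b - F a * ?e a) - (- 2 * pi * \<i> * v) * ?I) \<le> G b - G a"
    using le integral_norm_bound_integral[of "\<lambda>w. F' w * ?e w" "{a..b}" g]
    by (auto simp: has_integral_iff norm_mult)
  moreover have "norm ((- 2 * pi * \<i> * v) * ?I) \<le> norm ((F b * ?e b - F a * ?e a) - (- 2 * pi * \<i> * v) * ?I)
     + norm (F b * ?e b) + norm (F a * ?e a)"
    using norm_triangle_ineq4[of "F b * ?e b - F a * ?e a" "(F b * ?e b - F a * ?e a) - (- 2 * pi * \<i> * v) * ?I"]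
      norm_triangle_ineq4[of "F b * ?e b" "F a * ?e a"] by simp
  ultimately show ?thesis
    by (simp add: norm_mult)
qed

text \<open>F may jump to 0 at the endpoints, and these boundary terms limit the decay to 1 / |v|,
  so a single integration by parts is made. It is used with a linear \<open>G\<close> of slope M'
  and complements the trivial bound 2 * c * M.\<close>

lemma fourier_interval_bound:
  fixes F :: "real \<Rightarrow> complex"
  assumes "c \<ge> 0"
    and F: "\<And>x. x \<in> {-c..c} \<Longrightarrow> (F has_vector_derivative F' x) (at x within {-c..c})"
    and M: "\<And>x. x \<in> {-c..c} \<Longrightarrow> norm (F x) \<le> M" and M': "\<And>x. x \<in> {-c..c} \<Longrightarrow> norm (F' x) \<le> M'"
  shows "norm (integral {-c..c} (\<lambda>w. F w * cis (- 2 * pi * w * v))) \<le> (2 * c + 1) * (M + M') * wgt v"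
proof -
  let ?I = "integral {-c..c} (\<lambda>w. F w * cis (- 2 * pi * w * v))"
  have M0: "0 \<le> M" "0 \<le> M'" using order_trans[OF norm_ge_zero M[of 0]] order_trans[OF norm_ge_zero M'[of 0]] assms(1) by auto
  have cF: "continuous_on {-c..c} F"
    using F by (meson continuous_on_eq_continuous_within has_vector_derivative_continuous)
  have "norm ?I \<le> integral {-c..c} (\<lambda>w. M)"
    using M by (intro integral_norm_bound_integral integrable_continuous_real continuous_intros cF)
      (auto simp: norm_mult)
  then have 1: "norm ?I \<le> 2 * c * M"
    using assms(1) by simp
  have "2 * pi * \<bar>v\<bar> * norm ?I \<le> norm (F (-c)) + norm (F c) + M' * c - M' * (-c)"
    by (rule by_parts_bound[where F' = F' and g = "\<lambda>_. M'"])
       (use assms in \<open>auto intro!: derivative_eq_intros simp: has_real_derivative_iff_has_vector_derivative[symmetric]\<close>)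
  also have "\<dots> \<le> 2 * (M + c * M')"
    using M[of c] M[of "-c"] assms(1) by simp
  finally have "pi * (\<bar>v\<bar> * norm ?I) \<le> M + c * M'" by simp
  moreover have "1 * (\<bar>v\<bar> * norm ?I) \<le> pi * (\<bar>v\<bar> * norm ?I)"
    using pi_gt3 by (intro mult_right_mono) auto
  ultimately have 2: "\<bar>v\<bar> * norm ?I \<le> M + c * M'" by simp
  have "norm ?I \<le> (2 * c * M + (M + c * M')) * wgt v"
    by (rule le_wgtI[OF 1 2])
  also have "\<dots> \<le> (2 * c + 1) * (M + M') * wgt v"
    using M0 assms(1) by (intro mult_right_mono) (auto simp: algebra_simps)
  finally show ?thesis .
qed

section \<open>Smooth functions\<close>

text \<open>A class closed under differentiation contains all iterated derivatives of its members,
  so smoothness reduces to exhibiting such a class.\<close>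

lemma smooth_real_coinduct:
  assumes "f \<in> A" and A: "\<And>g. g \<in> A \<Longrightarrow> \<exists>g'\<in>A. \<forall>x. (g has_real_derivative g' x) (at x)"
  shows "smooth_real f"
proof -
  have "(deriv ^^ n) f \<in> A" for n
  proof (induction n)
    case (Suc n)
    then obtain g' where "g' \<in> A" "\<And>x. ((deriv ^^ n) f has_real_derivative g' x) (at x)"
      using A by blast
    moreover from this have "(deriv ^^ Suc n) f = g'"
      by (auto simp: DERIV_imp_deriv)
    ultimately show ?case by simp
  qed (use assms in auto)
  then show ?thesis
    unfolding smooth_real_def using A real_differentiable_def by blast
qed

lemma smooth_real_DERIV: "smooth_real f \<Longrightarrow> (f has_real_derivative deriv f x) (at x)"
  unfolding smooth_real_def DERIV_deriv_iff_real_differentiable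
  by (drule spec[of _ 0]) simp

lemma smooth_real_deriv: "smooth_real f \<Longrightarrow> smooth_real (deriv f)"
  unfolding smooth_real_def using funpow_Suc_right[of _ deriv] by (metis comp_apply)

text \<open>Iterated derivatives of a product are sums of products, hence the closure under both
  operations. The sum and product rules then keep derivatives inside the class, as
  \<open>smooth_real_coinduct\<close> requires.\<close>

inductive_set smooth_alg :: "(real \<Rightarrow> real) set" where
  base: "smooth_real f \<Longrightarrow> f \<in> smooth_alg"
| add: "f \<in> smooth_alg \<Longrightarrow> g \<in> smooth_alg \<Longrightarrow> (\<lambda>x. f x + g x) \<in> smooth_alg"
| mult: "f \<in> smooth_alg \<Longrightarrow> g \<in> smooth_alg \<Longrightarrow> (\<lambda>x. f x * g x) \<in> smooth_alg"

lemma smooth_alg_deriv: "f \<in> smooth_alg \<Longrightarrow> \<exists>f'\<in>smooth_alg. \<forall>x. (f has_real_derivative f' x) (at x)"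
proof (induction rule: smooth_alg.induct)
  case (base f)
  then show ?case
    using smooth_real_DERIV smooth_real_deriv smooth_alg.base by blast
next
  case (add f g)
  then obtain f' g' where "f' \<in> smooth_alg" "g' \<in> smooth_alg" "\<And>x. (f has_real_derivative f' x) (at x)"
    "\<And>x. (g has_real_derivative g' x) (at x)" by blast
  then show ?case
    by (intro bexI[of _ "\<lambda>x. f' x + g' x"]) (auto intro!: derivative_eq_intros smooth_alg.add)
next
  case (mult f g)
  then obtain f' g' where "f' \<in> smooth_alg" "g' \<in> smooth_alg" "\<And>x. (f has_real_derivative f' x) (at x)"
    "\<And>x. (g has_real_derivative g' x) (at x)" by blast
  with mult.hyps show ?case
    by (intro bexI[of _ "\<lambda>x. f' x * g x + f x * g' x"])
       (auto intro!: derivative_eq_intros smooth_alg.add smooth_alg.mult)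
qed

lemma smooth_alg_smooth: "f \<in> smooth_alg \<Longrightarrow> smooth_real f"
  by (rule smooth_real_coinduct[OF _ smooth_alg_deriv])

lemma smooth_real_add: "smooth_real f \<Longrightarrow> smooth_real g \<Longrightarrow> smooth_real (\<lambda>x. f x + g x)"
  by (rule smooth_alg_smooth[OF smooth_alg.add[OF smooth_alg.base smooth_alg.base]])

lemma smooth_real_mult: "smooth_real f \<Longrightarrow> smooth_real g \<Longrightarrow> smooth_real (\<lambda>x. f x * g x)"
  by (rule smooth_alg_smooth[OF smooth_alg.mult[OF smooth_alg.base smooth_alg.base]])

lemma smooth_real_integral:
  assumes "\<And>x. (f has_real_derivative g x) (at x)" "smooth_real g" shows "smooth_real f"
proof (rule smooth_real_coinduct)
  show "f \<in> insert f {h. smooth_real h}" by simp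
  show "\<And>h. h \<in> insert f {h. smooth_real h} \<Longrightarrow>
      \<exists>h'\<in>insert f {h. smooth_real h}. \<forall>x. (h has_real_derivative h' x) (at x)"
    using assms smooth_real_DERIV smooth_real_deriv by blast
qed

lemma smooth_real_const: "smooth_real (\<lambda>_. a)"
  by (rule smooth_real_coinduct[where A = "range (\<lambda>a _. a)"]) (auto intro: DERIV_const)

lemma smooth_real_affine:
  assumes "smooth_real f" shows "smooth_real (\<lambda>x. f (a * x + b))"
proof (rule smooth_real_coinduct)
  let ?A = "{\<lambda>x. r * g (a * x + b) | r g. smooth_real g}"
  show "(\<lambda>x. f (a * x + b)) \<in> ?A"
    using assms by (auto intro!: exI[of _ 1] exI[of _ f])
  fix h assume "h \<in> ?A"
  then obtain r g where h: "h = (\<lambda>x. r * g (a * x + b))" "smooth_real g" by blast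
  have "(h has_real_derivative (r * a) * deriv g (a * x + b)) (at x)" for x
    unfolding h by (auto intro!: derivative_eq_intros DERIV_chain2[OF smooth_real_DERIV] h)
  then show "\<exists>h'\<in>?A. \<forall>x. (h has_real_derivative h' x) (at x)"
    using h(2) smooth_real_deriv by (intro bexI[of _ "\<lambda>x. (r * a) * deriv g (a * x + b)"]) blast+
qed

lemma smooth_real_sin_cos: "smooth_real (\<lambda>x. a * sin x + b * cos x)"
proof (rule smooth_real_coinduct)
  let ?A = "range (\<lambda>(a, b) x. a * sin x + b * cos x :: real)"
  show "(\<lambda>x. a * sin x + b * cos x) \<in> ?A"
    by (rule image_eqI[of _ _ "(a, b)"]) auto
  fix h assume "h \<in> ?A"
  then obtain a b where h: "h = (\<lambda>x. a * sin x + b * cos x)" by auto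
  have "(\<lambda>x. (- b) * sin x + a * cos x) \<in> ?A"
    by (rule image_eqI[of _ _ "(- b, a)"]) auto
  moreover have "(h has_real_derivative (- b) * sin x + a * cos x) (at x)" for x
    unfolding h by (auto intro!: derivative_eq_intros)
  ultimately show "\<exists>h'\<in>?A. \<forall>x. (h has_real_derivative h' x) (at x)"
    by (intro bexI[of _ "\<lambda>x. (- b) * sin x + a * cos x"] allI)
qed

section \<open>A flat function and a smooth step\<close>

text \<open>The classical function exp (-1/x), flat at 0. The polynomial in 1/x is carried along as
  a parameter because differentiation stays inside this family.\<close>

definition flat_exp :: "real poly \<Rightarrow> real \<Rightarrow> real" where
  "flat_exp p x = (if x > 0 then poly p (1 / x) * exp (- 1 / x) else 0)"

lemma poly_div_exp_tendsto_0: "((\<lambda>y. poly p y / exp y) \<longlongrightarrow> 0) at_top" for p :: "real poly"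
proof -
  have "((\<lambda>y. \<Sum>i\<le>degree p. coeff p i * (y ^ i / exp y)) \<longlongrightarrow> (\<Sum>i\<le>degree p. coeff p i * 0)) at_top"
    by (intro tendsto_intros tendsto_power_div_exp_0)
  then show ?thesis
    by (simp add: poly_altdef sum_divide_distrib)
qed

text \<open>With y = 1/x, differentiating p(y) * exp (-y) in x gives y^2 * (p - p')(y) * exp (-y),
  and \<open>[:0, 0, 1:]\<close> is y^2. At 0 the exponential beats every polynomial.\<close>

lemma flat_exp_DERIV:
  "(flat_exp p has_real_derivative flat_exp ([:0, 0, 1:] * (p - pderiv p)) x) (at x)"
proof -
  consider "x > 0" | "x < 0" | "x = 0" by linarith
  then show ?thesis
  proof cases
    case 1
    have "((\<lambda>x. poly p (1 / x) * exp (- 1 / x)) has_real_derivative flat_exp ([:0, 0, 1:] * (p - pderiv p)) x) (at x)"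
    proof (rule DERIV_cong[OF DERIV_mult])
      have "((\<lambda>x. 1 / x) has_real_derivative - 1 / x^2) (at x)"
        using 1 by (auto intro!: derivative_eq_intros simp: power2_eq_square)
      then show "((\<lambda>x. poly p (1 / x)) has_real_derivative poly (pderiv p) (1 / x) * (- 1 / x^2)) (at x)"
        by (rule DERIV_chain2[OF poly_DERIV])
      have "((\<lambda>x. - 1 / x) has_real_derivative 1 / x^2) (at x)"
        using 1 by (auto intro!: derivative_eq_intros simp: power2_eq_square)
      then show "((\<lambda>x. exp (- 1 / x)) has_real_derivative exp (- 1 / x) * (1 / x^2)) (at x)"
        by (rule DERIV_chain2[OF DERIV_exp])
    qed (use 1 in \<open>simp add: flat_exp_def power2_eq_square algebra_simps diff_divide_distrib\<close>)
    then show ?thesis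
      by (rule has_field_derivative_transform_within_open[where S = "{0<..}"]) (use 1 in \<open>auto simp: flat_exp_def\<close>)
  next
    case 2
    have "((\<lambda>_. 0) has_real_derivative flat_exp ([:0, 0, 1:] * (p - pderiv p)) x) (at x)"
      using 2 by (auto simp: flat_exp_def)
    then show ?thesis
      by (rule has_field_derivative_transform_within_open[where S = "{..<0}"]) (use 2 in \<open>auto simp: flat_exp_def\<close>)
  next
    case 3
    \<comment> \<open>The extra factor y = \<open>[:0, 1:]\<close> is the division by h = 1/y in the
      difference quotient.\<close>
    have "((\<lambda>y. poly ([:0, 1:] * p) y / exp y) \<longlongrightarrow> 0) at_top"
      by (rule poly_div_exp_tendsto_0)
    then have "((\<lambda>h. poly ([:0, 1:] * p) (inverse h) / exp (inverse h)) \<longlongrightarrow> 0) (at_right 0)"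
      by (rule filterlim_compose[OF _ filterlim_inverse_at_top_right])
    then have "((\<lambda>h. (flat_exp p h - flat_exp p 0) / (h - 0)) \<longlongrightarrow> 0) (at_right 0)"
      by (rule Lim_transform_eventually)
         (auto simp: eventually_at_filter flat_exp_def field_simps exp_minus)
    moreover have "((\<lambda>h. (flat_exp p h - flat_exp p 0) / (h - 0)) \<longlongrightarrow> 0) (at_left 0)"
      by (rule Lim_transform_eventually[OF tendsto_const])
         (auto simp: eventually_at_filter flat_exp_def)
    ultimately have "((\<lambda>h. (flat_exp p h - flat_exp p 0) / (h - 0)) \<longlongrightarrow> 0) (at 0)"
      by (simp add: filterlim_at_split)
    then show ?thesis
      using 3 by (simp add: has_field_derivative_iff flat_exp_def)
  qed
qed

lemma smooth_flat_exp: "smooth_real (flat_exp p)"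
proof (rule smooth_real_coinduct)
  show "flat_exp p \<in> range flat_exp" by simp
  fix g assume "g \<in> range flat_exp"
  then obtain q where "g = flat_exp q" by blast
  then show "\<exists>g'\<in>range flat_exp. \<forall>x. (g has_real_derivative g' x) (at x)"
    using flat_exp_DERIV[of q] by (intro bexI[of _ "flat_exp ([:0, 0, 1:] * (q - pderiv q))"]) auto
qed

text \<open>The normalized antiderivative of a bump supported in [-1,1]. The density b is returned
  with B because its sign controls the total variation of the rescaled steps.\<close>

lemma smooth_step_exists:
  obtains B b :: "real \<Rightarrow> real" where "smooth_real B" "\<And>x. (B has_real_derivative b x) (at x)" "\<And>x. 0 \<le> b x"
    "\<And>x. x \<le> -1 \<Longrightarrow> B x = 0" "\<And>x. 1 \<le> x \<Longrightarrow> B x = 1"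
proof -
  define e where "e = flat_exp 1"
  define b where "b x = e (1 + x) * e (1 - x)" for x
  have sb: "smooth_real b"
    unfolding b_def e_def using smooth_real_affine[OF smooth_flat_exp, of 1 1 1] smooth_real_affine[OF smooth_flat_exp, of 1 "-1" 1]
    by (intro smooth_real_mult) (simp_all add: add.commute)
  then have cb: "isCont b x" for x
    using smooth_real_DERIV DERIV_isCont by blast
  have b0: "b x \<ge> 0" for x by (simp add: b_def e_def flat_exp_def)
  have bpos: "b 0 > 0" by (simp add: b_def e_def flat_exp_def)
  have bz: "b x = 0" if "1 \<le> \<bar>x\<bar>" for x using that by (auto simp: b_def e_def flat_exp_def)
  obtain B0 where "\<forall>x. -\<infinity> < ereal x \<longrightarrow> ereal x < \<infinity> \<longrightarrow> DERIV B0 x :> b x"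
    using einterval_antiderivative[of "-\<infinity>" "\<infinity>" b] cb
    by (auto simp: has_real_derivative_iff_has_vector_derivative)
  then have B0: "DERIV B0 x :> b x" for x by simp
  have mono: "B0 x \<le> B0 y" if "x \<le> y" for x y
    using DERIV_nonneg_imp_nondecreasing[OF that] B0 b0 by blast
  have lt: "B0 (-1) < B0 1"
  proof -
    obtain d where "d > 0" "\<And>h. h > 0 \<Longrightarrow> h < d \<Longrightarrow> B0 0 < B0 (0 + h)"
      using DERIV_pos_inc_right[OF B0 bpos] by blast
    then have "B0 0 < B0 (0 + min (d/2) 1)" by (auto simp: min_def)
    also have "\<dots> \<le> B0 1" by (rule mono) auto
    finally show ?thesis using mono[of "-1" 0] by simp
  qed
  have c1: "B0 x = B0 (-1)" if "x \<le> -1" for x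
  proof (rule antisym)
    have "\<exists>d. DERIV B0 z :> d \<and> d \<le> 0" if "x \<le> z" "z \<le> -1" for z
      using B0[of z] bz[of z] that \<open>x \<le> -1\<close> by (intro exI[of _ 0]) auto
    from DERIV_nonpos_imp_nonincreasing[OF that this]
    show "B0 (-1) \<le> B0 x" by simp
  qed (rule mono[OF that])
  have c2: "B0 x = B0 (1)" if "1 \<le> x" for x
  proof (rule antisym)
    have "\<exists>d. DERIV B0 z :> d \<and> d \<le> 0" if "1 \<le> z" "z \<le> x" for z
      using B0[of z] bz[of z] that \<open>1 \<le> x\<close> by (intro exI[of _ 0]) auto
    from DERIV_nonpos_imp_nonincreasing[OF that this]
    show "B0 x \<le> B0 1" by simp
  qed (rule mono[OF that])
  define Z where "Z = B0 1 - B0 (-1)"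
  show thesis
  proof (rule that[of "\<lambda>x. (B0 x - B0 (-1)) / Z" "\<lambda>x. b x / Z"])
    show D: "((\<lambda>x. (B0 x - B0 (-1)) / Z) has_real_derivative b x / Z) (at x)" for x
      using DERIV_cdivide[OF DERIV_diff[OF B0 DERIV_const[of "B0 (-1)"]], of Z x] by simp
    have "smooth_real (\<lambda>x. b x / Z)"
      using smooth_real_mult[OF sb smooth_real_const, of "1 / Z"] by simp
    then show "smooth_real (\<lambda>x. (B0 x - B0 (-1)) / Z)"
      using smooth_real_integral[of "\<lambda>x. (B0 x - B0 (-1)) / Z" "\<lambda>x. b x / Z"] D by blast
    show "0 \<le> b x / Z" for x using b0[of x] lt by (simp add: Z_def)
    show "(B0 x - B0 (-1)) / Z = 0" if "x \<le> -1" for x using c1[OF that] by simp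
    show "(B0 x - B0 (-1)) / Z = 1" if "1 \<le> x" for x using c2[OF that] lt by (simp add: Z_def)
  qed
qed

lemma smooth_real_bounded_deriv:
  assumes "smooth_real f" obtains M where "\<And>x. \<bar>x\<bar> \<le> R \<Longrightarrow> \<bar>deriv f x\<bar> \<le> M"
proof -
  have "continuous_on {-R..R} (deriv f)"
    using smooth_real_DERIV[OF smooth_real_deriv[OF assms]]
    by (meson DERIV_continuous_on has_field_derivative_at_within)
  then have "bounded (deriv f ` {-R..R})"
    by (intro compact_imp_bounded compact_continuous_image) auto
  then obtain M where "\<And>x. x \<in> {-R..R} \<Longrightarrow> norm (deriv f x) \<le> M"
    unfolding bounded_iff by blast
  then show thesis by (intro that[of M]) (simp add: abs_le_iff)
qed

section \<open>The Dirichlet integral\<close>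

text \<open>The positive and negative parts of h are densities of two finite measures that agree on
  all half-lines, hence coincide. Uniqueness of densities makes the two parts equal almost
  everywhere, so both vanish.\<close>

lemma AE_zero_of_integrals_greaterThan:
  fixes h :: "real \<Rightarrow> real"
  assumes h: "integrable lborel h" and z: "\<And>x. (\<integral>t. indicator {x<..} t * h t \<partial>lborel) = 0"
  shows "AE t in lborel. h t = 0"
proof -
  have [measurable]: "h \<in> borel_measurable borel" using h by auto
  have i1: "integrable lborel (\<lambda>t. indicator {x<..} t * max 0 (h t))" for x
    by (rule Bochner_Integration.integrable_bound[OF h]) (auto simp: indicator_def)
  have i2: "integrable lborel (\<lambda>t. indicator {x<..} t * max 0 (- h t))" for x
    by (rule Bochner_Integration.integrable_bound[OF h]) (auto simp: indicator_def)
  have e: "emeasure (density lborel (\<lambda>t. ennreal (max 0 (h' t)))) {x<..} = ennreal (\<integral>t. indicator {x<..} t * max 0 (h' t) \<partial>lborel)"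
    if i: "integrable lborel (\<lambda>t. indicator {x<..} t * max 0 (h' t))" and [measurable]: "h' \<in> borel_measurable borel" for x :: real and h'
    by (subst nn_integral_eq_integral[OF i, symmetric], simp, subst emeasure_density)
       (auto intro!: nn_integral_cong simp: indicator_def)
  have eq: "(\<integral>t. indicator {x<..} t * max 0 (h t) \<partial>lborel) = (\<integral>t. indicator {x<..} t * max 0 (- h t) \<partial>lborel)" for x
  proof -
    have "(\<integral>t. indicator {x<..} t * max 0 (h t) \<partial>lborel) - (\<integral>t. indicator {x<..} t * max 0 (- h t) \<partial>lborel)
      = (\<integral>t. indicator {x<..} t * h t \<partial>lborel)"
      by (subst Bochner_Integration.integral_diff[OF i1 i2, symmetric]) (auto intro!: Bochner_Integration.integral_cong simp: max_def)
    then show ?thesis using z by simp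
  qed
  have "density lborel (\<lambda>t. ennreal (max 0 (h t))) = density lborel (\<lambda>t. ennreal (max 0 (- h t)))"
    by (rule measure_eqI_lessThan) (use e[OF i1] e[OF i2] eq in \<open>simp_all del: ennreal_max_0\<close>)
  then have "AE t in lborel. ennreal (max 0 (h t)) = ennreal (max 0 (- h t))"
    by (subst (asm) sigma_finite_measure.density_unique_iff[OF sigma_finite_lborel]) auto
  then show ?thesis
    by eventually_elim (auto simp: max_def split: if_splits)
qed

text \<open>Only local integrability is available, so the real and imaginary parts of g are
  truncated to (-n,n] for every n, and countably many null sets are united.\<close>

lemma AE_zero_of_integrals_Ioc:
  fixes g :: "real \<Rightarrow> complex"
  assumes i: "\<And>a b. integrable lborel (\<lambda>t. indicator {a<..b} t * g t)"
    and z: "\<And>a b. (\<integral>t. indicator {a<..b} t * g t \<partial>lborel) = 0"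
  shows "AE t in lborel. g t = 0"
proof -
  have *: "AE t in lborel. \<forall>n. indicator {-real n<..real n} t * L (g t) = 0"
    if L: "bounded_linear L" for L :: "complex \<Rightarrow> real"
    unfolding AE_all_countable
  proof (intro allI AE_zero_of_integrals_greaterThan)
    interpret bounded_linear L by (fact L)
    have e: "L (indicator A t * g t) = indicator A t * L (g t)" for A t
      by (simp add: indicator_def zero)
    fix n x
    show "integrable lborel (\<lambda>t. indicator {-real n<..real n} t * L (g t))"
      using integrable_bounded_linear[OF L i] by (simp add: e)
    have ee: "indicator {x<..} t * (indicator {-real n<..real n} t * L (g t)) = indicator {max x (-real n)<..real n} t * L (g t)" for t
      by (auto simp: indicator_def)
    show "(\<integral>t. indicator {x<..} t * (indicator {-real n<..real n} t * L (g t)) \<partial>lborel) = 0"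
      unfolding ee using integral_bounded_linear[OF L i, of "max x (-real n)" "real n"] by (simp add: e z zero)
  qed
  show ?thesis
    using *[OF bounded_linear_Re] *[OF bounded_linear_Im]
  proof eventually_elim
    case (elim t)
    obtain n where "\<bar>t\<bar> < real n" using reals_Archimedean2 by blast
    then show ?case using spec[OF elim(1), of n] spec[OF elim(2), of n]
      by (auto simp: complex_eq_iff indicator_def split: if_splits)
  qed
qed

text \<open>The sinc projection with cutoff s of the indicator of [a,b], in closed form through the
  sine integral.\<close>

definition dirichlet :: "real \<Rightarrow> real \<Rightarrow> real \<Rightarrow> real \<Rightarrow> real" where
  "dirichlet a b s t = (Si (2 * pi * s * (t - a)) - Si (2 * pi * s * (t - b))) / pi"

lemma dirichlet_has_integral:
  assumes "a \<le> b" shows "((\<lambda>y. ker s (t - y)) has_integral dirichlet a b s t) {a..b}"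
proof -
  have "((\<lambda>y. - (Si (2 * pi * s * (t - y)) / pi)) has_real_derivative ker s (t - y)) (at y within {a..b})" for y
  proof -
    have "((\<lambda>y. t - y) has_real_derivative - 1) (at y)"
      by (auto intro!: derivative_eq_intros)
    then have "((\<lambda>y. Si (2 * pi * s * (t - y)) / pi) has_real_derivative ker s (t - y) * (- 1)) (at y)"
      by (rule DERIV_chain2[where f = "\<lambda>u. Si (2 * pi * s * u) / pi", OF DERIV_Si_ker])
    then show ?thesis
      using DERIV_minus has_field_derivative_at_within by fastforce
  qed
  from fundamental_theorem_of_calculus[OF assms this[unfolded has_real_derivative_iff_has_vector_derivative]]
  show ?thesis by (simp add: dirichlet_def diff_divide_distrib)
qed

lemma dirichlet_measurable [measurable]: "dirichlet a b s \<in> borel_measurable borel"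
  unfolding dirichlet_def[abs_def] by measurable

lemma Si_minus: "Si (- T) = - Si T"
  using Si_neg[of T] Si_neg[of "- T"] by (cases "T \<ge> 0") auto

lemma Si_sgn_limit:
  "(\<lambda>n. Si (2 * pi * real n * r)) \<longlonglongrightarrow> sgn r * (pi / 2)"
proof -
  have *: "(\<lambda>n. Si (2 * pi * real n * r)) \<longlonglongrightarrow> pi / 2" if "r > 0" for r
  proof (rule filterlim_compose[OF Si_at_top])
    show "filterlim (\<lambda>n. 2 * pi * real n * r) at_top sequentially"
      using that filterlim_tendsto_pos_mult_at_top[OF tendsto_const _ filterlim_real_sequentially, of "2 * pi * r"]
      by (simp add: mult_ac)
  qed
  consider "r > 0" | "r = 0" | "r < 0" by linarith
  then show ?thesis
  proof cases
    case 3
    have "(\<lambda>n. - Si (2 * pi * real n * (- r))) \<longlonglongrightarrow> - (pi / 2)"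
      by (intro tendsto_minus *) (use 3 in auto)
    then show ?thesis using 3 Si_minus[of "2 * pi * real _ * r"] by simp
  qed (use * in \<open>auto simp: Si_minus[of 0, simplified]\<close>)
qed

lemma dirichlet_limit:
  assumes "a \<le> b" "t \<noteq> a" "t \<noteq> b"
  shows "(\<lambda>n. dirichlet a b (real n) t) \<longlonglongrightarrow> indicator {a<..b} t"
proof -
  have "(\<lambda>n. dirichlet a b (real n) t) \<longlonglongrightarrow> (sgn (t - a) * (pi / 2) - sgn (t - b) * (pi / 2)) / pi"
    unfolding dirichlet_def by (intro tendsto_intros Si_sgn_limit) auto
  also have "(sgn (t - a) * (pi / 2) - sgn (t - b) * (pi / 2)) / pi = indicator {a<..b} t"
    using assms by (auto simp: sgn_if indicator_def field_simps)
  finally show ?thesis .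
qed

text \<open>Here t has distance at least |t| / 2 from the interval, and the oscillation in y is
  exploited by one integration by parts of 1 / (t - y) against frequency s. This function is
  increasing in y on the interval, so it serves as its own \<open>G\<close> in
  \<open>by_parts_bound\<close>.\<close>

lemma dirichlet_far:
  assumes ab: "a \<le> b" and s: "s \<ge> 1" and far: "\<And>y. y \<in> {a..b} \<Longrightarrow> \<bar>t\<bar> \<le> 2 * \<bar>t - y\<bar>" and t: "t \<noteq> 0"
  shows "\<bar>t\<bar> * \<bar>dirichlet a b s t\<bar> \<le> 1"
proof -
  let ?F = "\<lambda>y. of_real (1 / (t - y)) :: complex"
  let ?I = "integral {a..b} (\<lambda>y. ?F y * cis (- 2 * pi * y * s))"
  have ne: "t - y \<noteq> 0" if "y \<in> {a..b}" for y using far[OF that] t by auto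
  have D: "((\<lambda>y. 1 / (t - y)) has_vector_derivative 1 / (t - y)^2) (at y within {a..b})" if "y \<in> {a..b}" for y
    unfolding has_real_derivative_iff_has_vector_derivative[symmetric]
    using ne[OF that] by (auto intro!: derivative_eq_intros simp: power2_eq_square)
  have ub: "\<bar>1 / (t - y)\<bar> \<le> 2 / \<bar>t\<bar>" if "y \<in> {a..b}" for y
    using far[OF that] ne[OF that] t by (simp add: divide_simps)
  have "2 * pi * \<bar>s\<bar> * norm ?I \<le> norm (?F a) + norm (?F b) + 1 / (t - b) - 1 / (t - a)"
    by (rule by_parts_bound[where F' = "\<lambda>y. of_real (1 / (t - y)^2)" and g = "\<lambda>y. 1 / (t - y)^2", OF ab])
       (use D in \<open>auto intro!: has_vector_derivative_of_real simp del: of_real_divide simp: norm_of_real has_real_derivative_iff_has_vector_derivative\<close>)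
  also have "\<dots> \<le> 4 * (2 / \<bar>t\<bar>)"
    using ub[of a] ub[of b] ab abs_ge_self[of "1 / (t - b)"] abs_ge_minus_self[of "1 / (t - a)"]
    unfolding norm_of_real by auto
  finally have 1: "2 * pi * \<bar>s\<bar> * norm ?I \<le> 8 / \<bar>t\<bar>" by simp
  \<comment> \<open>The kernel is the imaginary part of an exponential over pi * (t - y). Pulling
    out \<open>cis (2 * pi * s * t)\<close>, which is constant in y, leaves the integral bounded
    above.\<close>
  have "dirichlet a b s t = Im (cis (2 * pi * s * t) * ?I) / pi"
  proof -
    have "continuous_on {a..b} (\<lambda>y. ?F y * cis (- 2 * pi * y * s))"
      using ne by (intro continuous_intros) auto
    then have "((\<lambda>y. ?F y * cis (- 2 * pi * y * s)) has_integral ?I) {a..b}"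
      using integrable_continuous_real integrable_integral by blast
    from has_integral_mult_right[OF this, of "cis (2 * pi * s * t)"]
    have "((\<lambda>y. Im (cis (2 * pi * s * t) * (?F y * cis (- 2 * pi * y * s)))) has_integral Im (cis (2 * pi * s * t) * ?I)) {a..b}"
      by (rule has_integral_linear[OF _ bounded_linear_Im, unfolded o_def])
    from has_integral_divide[OF this, of pi]
    have "((\<lambda>y. Im (cis (2 * pi * s * t) * (?F y * cis (- 2 * pi * y * s))) / pi) has_integral Im (cis (2 * pi * s * t) * ?I) / pi) {a..b}" .
    moreover have "Im (cis (2 * pi * s * t) * (?F y * cis (- 2 * pi * y * s))) / pi = ker s (t - y)" if "y \<in> {a..b}" for y
    proof -
      have "cis (2 * pi * s * t) * (?F y * cis (- 2 * pi * y * s)) = ?F y * cis (2 * pi * s * (t - y))"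
        by (simp add: cis_mult algebra_simps mult.left_commute[of "cis _"])
      moreover have "Im (?F y * cis (2 * pi * s * (t - y))) = sin (2 * pi * s * (t - y)) / (t - y)"
        by simp
      moreover have "ker s (t - y) = sin (2 * pi * s * (t - y)) / (t - y) / pi"
        by (simp only: ker_eq[OF ne[OF that]] divide_divide_eq_left mult.commute[of pi])
      ultimately show ?thesis by (simp only:)
    qed
    ultimately have "((\<lambda>y. ker s (t - y)) has_integral Im (cis (2 * pi * s * t) * ?I) / pi) {a..b}"
      by (rule has_integral_eq[rotated])
    then show ?thesis using dirichlet_has_integral[OF ab] has_integral_unique by blast
  qed
  then have "pi * \<bar>dirichlet a b s t\<bar> \<le> norm ?I"
    using abs_Im_le_cmod[of "cis (2 * pi * s * t) * ?I"] by (simp add: norm_mult)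
  then have "2 * pi * 1 * (pi * \<bar>dirichlet a b s t\<bar>) \<le> 2 * pi * \<bar>s\<bar> * norm ?I"
    using s by (intro mult_mono) auto
  also note 1
  finally have "(2 * (pi * pi)) * (\<bar>t\<bar> * \<bar>dirichlet a b s t\<bar>) \<le> 8"
    using t by (simp add: field_simps)
  moreover have "8 * (\<bar>t\<bar> * \<bar>dirichlet a b s t\<bar>) \<le> (2 * (pi * pi)) * (\<bar>t\<bar> * \<bar>dirichlet a b s t\<bar>)"
    using mult_mono[of 3 pi 3 pi] pi_gt3 by (intro mult_right_mono) auto
  ultimately show ?thesis by simp
qed

text \<open>Uniformity in s makes this a dominating function for the limit of large s. Near the
  interval boundedness of \<open>Si\<close> suffices; far from it \<open>dirichlet_far\<close> takes
  over.\<close>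

lemma dirichlet_bound:
  assumes "a \<le> b" obtains C where "C \<ge> 0" "\<And>s t. s \<ge> 1 \<Longrightarrow> \<bar>dirichlet a b s t\<bar> \<le> C * wgt t"
proof -
  obtain B where B: "\<And>T. \<bar>Si T\<bar> \<le> B" using bounded_Si by blast
  have B0: "B \<ge> 0" using B[of 0] by simp
  define R where "R = 2 * max \<bar>a\<bar> \<bar>b\<bar> + 1"
  have bd: "\<bar>dirichlet a b s t\<bar> \<le> 2 * B" for s t
  proof -
    have "\<bar>dirichlet a b s t\<bar> \<le> 2 * B / pi"
      unfolding dirichlet_def abs_divide using B[of "2 * pi * s * (t - a)"] B[of "2 * pi * s * (t - b)"]
      by (auto intro!: divide_right_mono)
    also have "\<dots> \<le> 2 * B / 1" using pi_gt3 B0 by (intro divide_left_mono) auto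
    finally show ?thesis by simp
  qed
  have "\<bar>t\<bar> * \<bar>dirichlet a b s t\<bar> \<le> R * (2 * B) + 1" if "s \<ge> 1" for s t
  proof (cases "\<bar>t\<bar> \<le> R")
    case True
    then have "\<bar>t\<bar> * \<bar>dirichlet a b s t\<bar> \<le> R * (2 * B)" using bd by (intro mult_mono) auto
    then show ?thesis by simp
  next
    case False
    have "\<bar>t\<bar> * \<bar>dirichlet a b s t\<bar> \<le> 1"
    proof (rule dirichlet_far[OF assms that])
      fix y assume "y \<in> {a..b}"
      then have "\<bar>y\<bar> \<le> max \<bar>a\<bar> \<bar>b\<bar>" by auto
      then show "\<bar>t\<bar> \<le> 2 * \<bar>t - y\<bar>" using False abs_triangle_ineq2[of t y] unfolding R_def by linarith
    qed (use False in \<open>auto simp: R_def\<close>)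
    moreover have "0 \<le> R * (2 * B)" using B0 by (auto simp: R_def)
    ultimately show ?thesis by linarith
  qed
  then have "\<bar>dirichlet a b s t\<bar> \<le> (2 * B + (R * (2 * B) + 1)) * wgt t" if "s \<ge> 1" for s t
    using le_wgtI[OF bd] that by blast
  then show thesis by (rule that[rotated]) (use B0 in \<open>auto simp: R_def\<close>)
qed

section \<open>Fourier transforms of test functions\<close>

abbreviation lmeas :: "(real \<Rightarrow> 'a::topological_space) \<Rightarrow> bool" where
  "lmeas f \<equiv> f \<in> borel_measurable lebesgue"

lemma borel_measurable_lebesgueI: "g \<in> borel_measurable borel \<Longrightarrow> lmeas g"
  by (intro measurable_completion) simp

lemma cis_measurable [measurable]: "cis \<in> borel_measurable borel"
  by (intro borel_measurable_continuous_onI continuous_intros)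

text \<open>The passage from the Lebesgue integral over the line to the gauge integral over an
  interval, where the fundamental theorem and the exchange of integrals over boxes are at
  hand.\<close>

lemma lebesgue_integral_compact_support:
  fixes F :: "real \<Rightarrow> complex"
  assumes "continuous_on {-R..R} F" "\<And>x. R < \<bar>x\<bar> \<Longrightarrow> F x = 0"
  shows "integrable lebesgue F" "(\<integral>x. F x \<partial>lebesgue) = integral {-R..R} F"
proof -
  have e: "(\<lambda>x. indicator {-R..R} x *\<^sub>R F x) = F"
    using assms(2) by (auto simp: indicator_def fun_eq_iff abs_less_iff not_le)
  have "F absolutely_integrable_on {-R..R}"
    by (rule absolutely_integrable_continuous_real[OF assms(1)])
  from this set_lebesgue_integral_eq_integral(2)[OF this]
  show "integrable lebesgue F" "(\<integral>x. F x \<partial>lebesgue) = integral {-R..R} F"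
    by (simp_all add: set_integrable_def set_lebesgue_integral_def e)
qed

lemma fourier_measurable:
  assumes [measurable]: "\<phi> \<in> borel_measurable borel"
  shows "fourier \<phi> \<in> borel_measurable borel"
proof -
  have "(\<lambda>v. \<integral>t. \<phi> t * cis (- 2 * pi * v * t) \<partial>lborel) \<in> borel_measurable lborel"
    by (intro sigma_finite_measure.borel_measurable_lebesgue_integral[OF sigma_finite_lborel]) measurable
  then show ?thesis
    unfolding fourier_def[abs_def] by (simp add: integral_completion)
qed

lemma fourier_compact_support:
  fixes \<phi> :: "real \<Rightarrow> complex"
  assumes "continuous_on UNIV \<phi>" "\<And>x. R < \<bar>x\<bar> \<Longrightarrow> \<phi> x = 0"
  shows "integrable lebesgue (\<lambda>w. \<phi> w * cis (- 2 * pi * v * w))"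
    "fourier \<phi> v = integral {-R..R} (\<lambda>w. \<phi> w * cis (- 2 * pi * w * v))"
proof -
  have c: "continuous_on {-R..R} (\<lambda>w. \<phi> w * cis (- 2 * pi * v * w))"
    by (intro continuous_intros continuous_on_subset[OF assms(1)]) auto
  from lebesgue_integral_compact_support[OF c] assms(2)
  show "integrable lebesgue (\<lambda>w. \<phi> w * cis (- 2 * pi * v * w))"
    "fourier \<phi> v = integral {-R..R} (\<lambda>w. \<phi> w * cis (- 2 * pi * w * v))"
    by (simp_all add: fourier_def mult_ac)
qed

lemma smooth_real_continuous: "smooth_real f \<Longrightarrow> continuous_on S f"
  using smooth_real_DERIV by (meson DERIV_continuous_on has_field_derivative_at_within)

lemma test_fun_continuous: "test_fun \<phi> \<Longrightarrow> continuous_on UNIV \<phi>"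
proof -
  assume "test_fun \<phi>"
  then have "continuous_on UNIV (\<lambda>x. Complex (Re (\<phi> x)) (Im (\<phi> x)))"
    unfolding Complex_eq test_fun_def by (intro continuous_intros smooth_real_continuous) auto
  then show ?thesis by simp
qed

lemma test_fun_support:
  assumes "test_fun \<phi>" obtains R where "R > 0" "\<And>x. R < \<bar>x\<bar> \<Longrightarrow> \<phi> x = 0"
proof -
  have "bounded (closure {x. \<phi> x \<noteq> 0})" using assms by (auto simp: test_fun_def compact_imp_bounded)
  then obtain R where "\<And>x. x \<in> closure {x. \<phi> x \<noteq> 0} \<Longrightarrow> norm x \<le> R" unfolding bounded_iff by blast
  then have R: "\<bar>x\<bar> \<le> R" if "\<phi> x \<noteq> 0" for x
    using subsetD[OF closure_subset, of x "{x. \<phi> x \<noteq> 0}"] that by (metis mem_Collect_eq real_norm_def)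
  have "\<phi> x = 0" if "max R 1 < \<bar>x\<bar>" for x using R[of x] that by linarith
  then show thesis by (intro that[of "max R 1"]) auto
qed

lemma test_fun_fourier_bound:
  assumes "test_fun \<phi>" obtains C where "C \<ge> 0" "\<And>v. norm (fourier \<phi> v) \<le> C * wgt v"
proof -
  obtain R where R: "R > 0" "\<And>x. R < \<bar>x\<bar> \<Longrightarrow> \<phi> x = 0" using test_fun_support[OF assms] by blast
  have s: "smooth_real (\<lambda>x. Re (\<phi> x))" "smooth_real (\<lambda>x. Im (\<phi> x))" using assms by (auto simp: test_fun_def)
  obtain M1 where M1: "\<And>x. \<bar>x\<bar> \<le> R \<Longrightarrow> \<bar>deriv (\<lambda>x. Re (\<phi> x)) x\<bar> \<le> M1" using smooth_real_bounded_deriv[OF s(1)] by blast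
  obtain M2 where M2: "\<And>x. \<bar>x\<bar> \<le> R \<Longrightarrow> \<bar>deriv (\<lambda>x. Im (\<phi> x)) x\<bar> \<le> M2" using smooth_real_bounded_deriv[OF s(2)] by blast
  have "bounded (\<phi> ` {-R..R})"
    by (intro compact_imp_bounded compact_continuous_image continuous_on_subset[OF test_fun_continuous[OF assms]]) auto
  then obtain M where M: "\<And>x. x \<in> {-R..R} \<Longrightarrow> norm (\<phi> x) \<le> M" unfolding bounded_iff by blast
  let ?D = "\<lambda>x. Complex (deriv (\<lambda>x. Re (\<phi> x)) x) (deriv (\<lambda>x. Im (\<phi> x)) x)"
  have b: "norm (fourier \<phi> v) \<le> (2 * R + 1) * (M + (M1 + M2)) * wgt v" for v
  proof (subst fourier_compact_support(2)[OF test_fun_continuous[OF assms] R(2)], assumption, rule fourier_interval_bound[where F' = ?D])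
    fix x assume x: "x \<in> {-R..R}"
    show "(\<phi> has_vector_derivative ?D x) (at x within {-R..R})"
      unfolding has_vector_derivative_complex_iff
      using smooth_real_DERIV[OF s(1), of x] smooth_real_DERIV[OF s(2), of x]
      by (auto simp: has_field_derivative_at_within)
    show "norm (?D x) \<le> M1 + M2"
      using cmod_le[of "?D x"] M1[of x] M2[of x] x abs_le_iff[of x R] by auto
  qed (use R M in auto)
  show thesis
  proof (rule that[OF _ b])
    have "0 \<le> M" "0 \<le> M1" "0 \<le> M2" using order_trans[OF norm_ge_zero M[of 0]] M1[of 0] M2[of 0] R(1) by auto
    then show "0 \<le> (2 * R + 1) * (M + (M1 + M2))" using R(1) by simp
  qed
qed

section \<open>Smoothed indicators of intervals\<close>

text \<open>Smooth approximations of the indicator of [-s,s]. The fourth clause is the point: the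
  slopes grow with n, yet the transforms are bounded uniformly in n, because only total variation
  matters. With the last clause this is what dominated convergence needs.\<close>

definition plateau :: "real \<Rightarrow> (nat \<Rightarrow> real \<Rightarrow> real) \<Rightarrow> bool" where
  "plateau s \<phi> \<longleftrightarrow> (\<forall>n. smooth_real (\<phi> n)) \<and>
    (\<forall>n w. s + 1 / real (Suc n) \<le> \<bar>w\<bar> \<longrightarrow> \<phi> n w = 0) \<and>
    (\<forall>n w. \<bar>w\<bar> \<le> s - 1 / real (Suc n) \<longrightarrow> \<phi> n w = 1) \<and>
    (\<forall>n v. norm (fourier (\<lambda>w. of_real (\<phi> n w)) v) \<le> (2 * (s + 1) + 1) * wgt v) \<and>
    (\<forall>v. (\<lambda>n. fourier (\<lambda>w. of_real (\<phi> n w)) v) \<longlonglongrightarrow> of_real (ker s v))"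

lemma plateauD:
  assumes "plateau s \<phi>"
  shows "smooth_real (\<phi> n)"
    "s + 1 / real (Suc n) \<le> \<bar>w\<bar> \<Longrightarrow> \<phi> n w = 0"
    "\<bar>w\<bar> \<le> s - 1 / real (Suc n) \<Longrightarrow> \<phi> n w = 1"
    "norm (fourier (\<lambda>w. of_real (\<phi> n w)) v) \<le> (2 * (s + 1) + 1) * wgt v"
    "(\<lambda>n. fourier (\<lambda>w. of_real (\<phi> n w)) v) \<longlonglongrightarrow> of_real (ker s v)"
  using assms unfolding plateau_def by blast+

lemma plateau_exists:
  assumes "s > 0"
  obtains \<phi> where "plateau s \<phi>"
proof -
  obtain B b where B: "smooth_real B" "\<And>x. (B has_real_derivative b x) (at x)" "\<And>x. 0 \<le> b x"
    "\<And>x. x \<le> -1 \<Longrightarrow> B x = 0" "\<And>x. 1 \<le> x \<Longrightarrow> B x = 1"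
    using smooth_step_exists by metis
  define d where "d n = 1 / real (Suc n)" for n
  have d: "0 < d n" "d n \<le> 1" for n by (auto simp: d_def)
  \<comment> \<open>A rising step at -s minus a rising step at s; dividing by \<open>d n\<close>
    sharpens both without changing their total variation.\<close>
  define \<phi> where "\<phi> n w = B ((w + s) / d n) - B ((w - s) / d n)" for n w
  have Bmono: "B x \<le> B y" if "x \<le> y" for x y
    using DERIV_nonneg_imp_nondecreasing[OF that] B(2,3) by blast
  have B01: "0 \<le> B x" "B x \<le> 1" for x
    using Bmono[of "min x (-1)" x] B(4)[of "min x (-1)"] Bmono[of x "max x 1"] B(5)[of "max x 1"] by auto
  have sm: "smooth_real (\<phi> n)" for n
  proof -
    have "smooth_real (\<lambda>x. B ((1 / d n) * x + s / d n) + (- 1) * B ((1 / d n) * x + (- s / d n)))"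
      by (intro smooth_real_add smooth_real_mult smooth_real_const smooth_real_affine B)
    moreover have "(\<lambda>x. B ((1 / d n) * x + s / d n) + (- 1) * B ((1 / d n) * x + (- s / d n))) = \<phi> n"
      by (auto simp: \<phi>_def fun_eq_iff add_divide_distrib diff_divide_distrib)
    ultimately show ?thesis by simp
  qed
  have z: "\<phi> n w = 0" if "s + d n \<le> \<bar>w\<bar>" for n w
  proof (cases "w \<ge> 0")
    case True
    then have "1 \<le> (w + s) / d n" "1 \<le> (w - s) / d n" using that d(1)[of n] assms by (auto simp: field_simps)
    then show ?thesis by (simp add: \<phi>_def B)
  next
    case False
    then have "(w + s) / d n \<le> -1" "(w - s) / d n \<le> -1" using that d(1)[of n] assms by (auto simp: field_simps)
    then show ?thesis by (simp add: \<phi>_def B)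
  qed
  have o: "\<phi> n w = 1" if "\<bar>w\<bar> \<le> s - d n" for n w
  proof -
    have "1 \<le> (w + s) / d n" "(w - s) / d n \<le> -1" using that d(1)[of n] by (auto simp: field_simps)
    then show ?thesis by (simp add: \<phi>_def B)
  qed
  have ub: "\<bar>\<phi> n w\<bar> \<le> 1" for n w
    using B01[of "(w + s) / d n"] B01[of "(w - s) / d n"] by (auto simp: \<phi>_def)
  have zR: "complex_of_real (\<phi> n w) = 0" if "s + 1 < \<bar>w\<bar>" for n w using z[of n w] d(2)[of n] that by auto
  have cont: "continuous_on UNIV (\<lambda>w. complex_of_real (\<phi> n w))" for n
    by (intro continuous_intros smooth_real_continuous sm)
  have bound: "norm (fourier (\<lambda>w. of_real (\<phi> n w)) v) \<le> (2 * (s + 1) + 1) * wgt v" for n v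
  proof (subst fourier_compact_support(2)[OF cont zR], assumption, rule le_wgtI)
    let ?I = "integral {-(s+1)..s+1} (\<lambda>w. complex_of_real (\<phi> n w) * cis (- 2 * pi * w * v))"
    have "norm ?I \<le> integral {-(s+1)..s+1} (\<lambda>w. 1)"
      using ub by (intro integral_norm_bound_integral integrable_continuous_real continuous_intros continuous_on_subset[OF cont])
        (auto simp: norm_mult)
    then show "norm ?I \<le> 2 * (s + 1)" using assms by simp
    have D: "((\<lambda>w. B ((w + t) / d n)) has_vector_derivative b ((w + t) / d n) / d n) (at w within S)" for w t S
    proof -
      have "((\<lambda>w. (w + t) / d n) has_real_derivative 1 / d n) (at w within S)"
        using d(1)[of n] by (auto intro!: derivative_eq_intros)
      from DERIV_chain2[OF B(2) this] show ?thesis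
        unfolding has_real_derivative_iff_has_vector_derivative[symmetric] by simp
    qed
    \<comment> \<open>The sum in place of the difference of the two steps: it is increasing,
      dominates the variation of the difference, and increases by at most 2 for every n.\<close>
    let ?G = "\<lambda>w. B ((w + s) / d n) + B ((w + - s) / d n)"
    let ?g = "\<lambda>w. b ((w + s) / d n) / d n + b ((w + - s) / d n) / d n"
    let ?f = "\<lambda>w. complex_of_real (b ((w + s) / d n) / d n - b ((w + - s) / d n) / d n)"
    have "2 * pi * \<bar>v\<bar> * norm ?I \<le> norm (complex_of_real (\<phi> n (-(s+1)))) + norm (complex_of_real (\<phi> n (s+1))) + ?G (s+1) - ?G (-(s+1))"
    proof (rule by_parts_bound[where g = ?g and F' = ?f])
      fix x
      have "((\<lambda>w. B ((w + s) / d n) - B ((w + - s) / d n)) has_vector_derivative b ((x + s) / d n) / d n - b ((x + - s) / d n) / d n) (at x within {-(s+1)..s+1})"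
        by (intro has_vector_derivative_diff D)
      then show "((\<lambda>w. complex_of_real (\<phi> n w)) has_vector_derivative ?f x) (at x within {-(s+1)..s+1})"
        by (intro has_vector_derivative_of_real) (simp add: \<phi>_def has_real_derivative_iff_has_vector_derivative)
      show "(?G has_vector_derivative ?g x) (at x within {-(s+1)..s+1})"
        by (intro has_vector_derivative_add D)
      have "b ((x + s) / d n) / d n \<ge> 0" "b ((x + - s) / d n) / d n \<ge> 0" using B(3) d(1)[of n] by (simp_all add: less_imp_le)
      then show "norm (?f x) \<le> ?g x" unfolding norm_of_real by (simp add: abs_le_iff)
    qed (use assms in auto)
    also have "\<dots> \<le> 2"
      using z[of n "s+1"] z[of n "-(s+1)"] d(2)[of n] assms B01[of "(s + 1 + s) / d n"] B01[of "(s + 1 + - s) / d n"]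
        B01[of "(-(s + 1) + s) / d n"] B01[of "(-(s + 1) + - s) / d n"] by (auto simp: norm_of_real)
    finally have "pi * (\<bar>v\<bar> * norm ?I) \<le> 1" by simp
    moreover have "1 * (\<bar>v\<bar> * norm ?I) \<le> pi * (\<bar>v\<bar> * norm ?I)"
      using pi_gt3 by (intro mult_right_mono) auto
    ultimately show "\<bar>v\<bar> * norm ?I \<le> 1" by simp
  qed
  have lim: "(\<lambda>n. fourier (\<lambda>w. of_real (\<phi> n w)) v) \<longlonglongrightarrow> of_real (ker s v)" for v
  proof -
    have d0: "d \<longlonglongrightarrow> 0" unfolding d_def by (rule LIMSEQ_Suc[OF lim_1_over_n])
    let ?h = "\<lambda>w. indicator {-s..s} w * cis (- 2 * pi * v * w)"
    have [measurable]: "\<phi> n \<in> borel_measurable borel" for n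
      by (intro borel_measurable_continuous_onI smooth_real_continuous sm)
    have "(\<lambda>n. \<integral>w. of_real (\<phi> n w) * cis (- 2 * pi * v * w) \<partial>lebesgue) \<longlonglongrightarrow> (\<integral>w. ?h w \<partial>lebesgue)"
    proof (rule integral_dominated_convergence[where w = "indicator {-(s+1)..s+1}"])
      show "lmeas ?h" by (rule borel_measurable_lebesgueI) measurable
      show "lmeas (\<lambda>w. of_real (\<phi> n w) * cis (- 2 * pi * v * w))" for n
        by (rule borel_measurable_lebesgueI) measurable
      show "integrable lebesgue (indicat_real {-(s+1)..s+1})"
        by (intro integrable_real_indicator) (auto simp: emeasure_lborel_Icc_eq)
      show "AE x in lebesgue. norm (of_real (\<phi> n x) * cis (- 2 * pi * v * x)) \<le> indicat_real {-(s+1)..s+1} x" for n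
      proof (rule AE_I2, goal_cases)
        case (1 x)
        show ?case
          using ub[of n x] zR[of x n] by (cases "s + 1 < \<bar>x\<bar>") (auto simp: norm_mult indicator_def not_less abs_le_iff)
      qed
      have "AE w in lebesgue. w \<noteq> s \<and> w \<noteq> -s"
        by (intro AE_completion AE_conjI AE_lborel_singleton)
      then show "AE w in lebesgue. (\<lambda>n. of_real (\<phi> n w) * cis (- 2 * pi * v * w)) \<longlonglongrightarrow> ?h w"
      proof eventually_elim
        case (elim w)
        have "\<bar>\<bar>w\<bar> - s\<bar> > 0" using elim by (auto simp: abs_if split: if_splits)
        then have "\<forall>\<^sub>F n in sequentially. d n < \<bar>\<bar>w\<bar> - s\<bar>"
          using order_tendstoD(2)[OF d0] by blast
        then have "\<forall>\<^sub>F n in sequentially. ?h w = of_real (\<phi> n w) * cis (- 2 * pi * v * w)"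
        proof eventually_elim
          case (elim n)
          then consider "\<bar>w\<bar> \<le> s - d n" | "s + d n \<le> \<bar>w\<bar>" using d(1)[of n] by linarith
          then show ?case
          proof cases
            case 1
            then show ?thesis using o[OF 1] d(1)[of n] by (auto simp: indicator_def abs_le_iff)
          next
            case 2
            then show ?thesis using z[OF 2] d(1)[of n] by (auto simp: indicator_def)
          qed
        qed
        then show ?case by (rule Lim_transform_eventually[OF tendsto_const])
      qed
    qed
    also have "(\<integral>w. ?h w \<partial>lebesgue) = of_real (ker s v)"
    proof -
      have "(\<lambda>w. cis (- 2 * pi * v * w)) absolutely_integrable_on {-s..s}"
        by (intro absolutely_integrable_continuous_real continuous_intros)
      from set_lebesgue_integral_eq_integral(2)[OF this]
      have "(\<integral>w. ?h w \<partial>lebesgue) = integral {-s..s} (\<lambda>w. cis (- 2 * pi * v * w))"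
        by (simp add: set_lebesgue_integral_def scaleR_conv_of_real of_real_indicator)
      also have "\<dots> = of_real (ker s v)"
        using has_integral_cis_ker[of s v] assms by (intro integral_unique) (simp add: mult_ac)
      finally show ?thesis .
    qed
    finally show ?thesis by (simp add: fourier_def)
  qed
  show thesis
    by (rule that[of \<phi>]) (use sm z o bound lim in \<open>auto simp: plateau_def d_def\<close>)
qed

section \<open>The reproducing property\<close>

text \<open>The spectral clause of \<open>PW\<close> alone, so that it can be combined with other
  integrability classes than L^p.\<close>

definition band_lim :: "real \<Rightarrow> (real \<Rightarrow> complex) \<Rightarrow> bool" where
  "band_lim c f \<longleftrightarrow> (\<forall>\<phi>. test_fun \<phi> \<and> closure {x. \<phi> x \<noteq> 0} \<inter> {-c..c} = {} \<longrightarrow>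
        (\<integral>x. f x * fourier \<phi> x \<partial>lebesgue) = 0)"

text \<open>Absolute convergence against anything of size 1 / (1 + |t|), such as sinc kernels and
  transforms of test functions. The class contains both L^1 and L^2, so the reproducing property is
  proved once for the two exponents.\<close>

definition mem_wgt :: "(real \<Rightarrow> complex) \<Rightarrow> bool" where
  "mem_wgt f \<longleftrightarrow> lmeas f \<and> integrable lebesgue (\<lambda>t. wgt t * norm (f t))"

lemma integrable_mult_wgt_bound:
  fixes g :: "real \<Rightarrow> complex"
  assumes f: "mem_wgt f" and g: "lmeas g" "\<And>t. norm (g t) \<le> C * wgt t"
  shows "integrable lebesgue (\<lambda>t. f t * g t)"
proof (rule Bochner_Integration.integrable_bound)
  show "integrable lebesgue (\<lambda>t. C * (wgt t * norm (f t)))" using f by (auto simp: mem_wgt_def)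
  show "lmeas (\<lambda>t. f t * g t)" using f g by (auto simp: mem_wgt_def)
  show "AE t in lebesgue. norm (f t * g t) \<le> norm (C * (wgt t * norm (f t)))"
  proof (rule AE_I2, goal_cases)
    case (1 t)
    have "norm (f t * g t) \<le> norm (f t) * (C * wgt t)"
      unfolding norm_mult using g(2) by (intro mult_left_mono) auto
    also have "\<dots> \<le> norm (C * (wgt t * norm (f t)))" by (simp add: abs_mult mult_ac mult_right_mono)
    finally show ?case .
  qed
qed

lemma ker_translate_bound:
  assumes "c \<ge> 0" shows "norm (complex_of_real (ker c (y - t))) \<le> (2 * c + 1) * (1 + \<bar>y\<bar>) * wgt t"
proof -
  have "norm (complex_of_real (ker c (y - t))) = \<bar>ker c (t - y)\<bar>" by (simp add: ker_commute)
  also have "\<dots> \<le> (2 * c + 1) * wgt (t - y)" by (rule ker_le[OF assms])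
  also have "\<dots> \<le> (2 * c + 1) * ((1 + \<bar>y\<bar>) * wgt t)"
    using assms by (intro mult_left_mono wgt_diff_le) auto
  finally show ?thesis by (simp add: mult_ac)
qed

lemma ker_translate_measurable: "lmeas (\<lambda>t. complex_of_real (ker c (y - t)))"
  by (rule borel_measurable_lebesgueI) measurable

abbreviation ker_conv :: "real \<Rightarrow> (real \<Rightarrow> complex) \<Rightarrow> real \<Rightarrow> complex" where
  "ker_conv s f y \<equiv> \<integral>t. f t * complex_of_real (ker s (y - t)) \<partial>lebesgue"

lemma integrable_mult_ker:
  assumes "c \<ge> 0" "mem_wgt f" shows "integrable lebesgue (\<lambda>t. f t * of_real (ker c (y - t)))"
  by (rule integrable_mult_wgt_bound[OF assms(2) ker_translate_measurable ker_translate_bound[OF assms(1)]])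

text \<open>For each x the integrands differ at most at t = x, so the equality holds at every x and
  not just almost everywhere.\<close>

lemma Pc_eq_ker:
  assumes "lmeas f"
  shows "Pc c f x = ker_conv c f x"
  unfolding Pc_def
proof (rule integral_cong_AE)
  show "lmeas (\<lambda>t. f t * of_real (ker c (x - t)))"
    using assms ker_translate_measurable by (intro borel_measurable_times) auto
  have "lmeas (\<lambda>t. complex_of_real (sin (2 * pi * c * (x - t)) / (pi * (x - t))))"
    by (rule borel_measurable_lebesgueI) measurable
  then show "lmeas (\<lambda>t. f t * complex_of_real (sin (2 * pi * c * (x - t)) / (pi * (x - t))))"
    using assms by (intro borel_measurable_times) auto
  have "AE t in lebesgue. t \<noteq> x" by (intro AE_completion AE_lborel_singleton)
  then show "AE t in lebesgue. f t * complex_of_real (sin (2 * pi * c * (x - t)) / (pi * (x - t))) = f t * of_real (ker c (x - t))"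
    by eventually_elim (simp add: ker_eq)
qed

lemma fourier_modulate: "fourier (\<lambda>w. g w * cis (2 * pi * y * w)) t = fourier g (t - y)"
  unfolding fourier_def by (simp add: cis_mult mult.assoc algebra_simps)

text \<open>The difference of two plateaus over \<open>[-s,s]\<close> and \<open>[-s',s']\<close>, modulated by \<open>cis (2 * pi * y * w)\<close>,
  is a test function supported off \<open>[-c,c]\<close>; its transform tends to the difference of the
  kernels as the plateaus sharpen.\<close>

lemma convolution_ker_indep:
  assumes f: "mem_wgt f" "band_lim c f" and c: "0 < c" "c < s" "c < s'"
  shows "ker_conv s f y = ker_conv s' f y"
proof -
  have s0: "0 < s" "0 < s'" using c by auto
  obtain \<phi> \<phi>' where "plateau s \<phi>" "plateau s' \<phi>'"
    using plateau_exists s0 by metis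
  note \<phi> = plateauD[OF this(1)] and \<phi>' = plateauD[OF this(2)]
  define Z where "Z n v = fourier (\<lambda>w. of_real (\<phi> n w)) v" for n v
  define Z' where "Z' n v = fourier (\<lambda>w. of_real (\<phi>' n w)) v" for n v
  define \<Phi> where "\<Phi> n w = of_real (\<phi> n w - \<phi>' n w) * cis (2 * pi * y * w)" for n w
  define m where "m = min s s'"
  \<comment> \<open>The difference vanishes where both plateaus are 1 and where both are 0; what
    remains is the region between s and s', widened by the smoothing.\<close>
  have supp: "\<Phi> n w \<noteq> 0 \<Longrightarrow> m - 1 / real (Suc n) \<le> \<bar>w\<bar> \<and> \<bar>w\<bar> \<le> max s s' + 1" for n w
  proof (rule ccontr)
    assume a: "\<Phi> n w \<noteq> 0" "\<not> (m - 1 / real (Suc n) \<le> \<bar>w\<bar> \<and> \<bar>w\<bar> \<le> max s s' + 1)"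
    have "1 / real (Suc n) \<le> 1" by simp
    then consider "\<bar>w\<bar> \<le> s - 1 / real (Suc n)" "\<bar>w\<bar> \<le> s' - 1 / real (Suc n)"
      | "s + 1 / real (Suc n) \<le> \<bar>w\<bar>" "s' + 1 / real (Suc n) \<le> \<bar>w\<bar>"
      using a(2) unfolding m_def by linarith
    then show False using \<phi>(2,3) \<phi>'(2,3) a(1) by cases (auto simp: \<Phi>_def)
  qed
  have closed: "closure {x. \<Phi> n x \<noteq> 0} \<subseteq> {x. m - 1 / real (Suc n) \<le> \<bar>x\<bar> \<and> \<bar>x\<bar> \<le> max s s' + 1}" for n
  proof (rule closure_minimal)
    show "closed {x. m - 1 / real (Suc n) \<le> \<bar>x\<bar> \<and> \<bar>x\<bar> \<le> max s s' + 1}"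
      by (intro closed_Collect_conj closed_Collect_le continuous_intros)
  qed (use supp in auto)
  have test: "test_fun (\<Phi> n)" for n
    unfolding test_fun_def
  proof (intro conjI)
    have cs: "smooth_real (\<lambda>x. cos (2 * pi * y * x))" "smooth_real (\<lambda>x. sin (2 * pi * y * x))"
      using smooth_real_affine[OF smooth_real_sin_cos[of 0 1], of "2 * pi * y" 0]
        smooth_real_affine[OF smooth_real_sin_cos[of 1 0], of "2 * pi * y" 0] by simp_all
    have df: "smooth_real (\<lambda>x. \<phi> n x - \<phi>' n x)"
      using smooth_real_add[OF \<phi>(1) smooth_real_mult[OF smooth_real_const[of "-1"] \<phi>'(1)], of n n] by simp
    show "smooth_real (\<lambda>x. Re (\<Phi> n x))" "smooth_real (\<lambda>x. Im (\<Phi> n x))"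
      using smooth_real_mult[OF df cs(1)] smooth_real_mult[OF df cs(2)] by (simp_all add: \<Phi>_def)
    have "bounded {x. m - 1 / real (Suc n) \<le> \<bar>x\<bar> \<and> \<bar>x\<bar> \<le> max s s' + 1}"
      by (rule boundedI[of _ "max s s' + 1"]) auto
    then show "compact (closure {x. \<Phi> n x \<noteq> 0})"
      using bounded_subset[OF _ closed] by (simp add: compact_eq_bounded_closed)
  qed
  have intg: "integrable lebesgue (\<lambda>w. complex_of_real (\<phi> n w) * cis (- 2 * pi * v * w))"
     "integrable lebesgue (\<lambda>w. complex_of_real (\<phi>' n w) * cis (- 2 * pi * v * w))" for n v
  proof -
    have le: "1 / real (Suc n) \<le> 1" by simp
    have z: "\<phi> n w = 0" if "s + 1 < \<bar>w\<bar>" for w by (rule \<phi>(2)) (use le that in linarith)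
    have z': "\<phi>' n w = 0" if "s' + 1 < \<bar>w\<bar>" for w by (rule \<phi>'(2)) (use le that in linarith)
    show "integrable lebesgue (\<lambda>w. complex_of_real (\<phi> n w) * cis (- 2 * pi * v * w))"
      by (rule fourier_compact_support(1)[where R = "s + 1"])
         (use z in \<open>auto intro!: continuous_intros smooth_real_continuous \<phi>(1)\<close>)
    show "integrable lebesgue (\<lambda>w. complex_of_real (\<phi>' n w) * cis (- 2 * pi * v * w))"
      by (rule fourier_compact_support(1)[where R = "s' + 1"])
         (use z' in \<open>auto intro!: continuous_intros smooth_real_continuous \<phi>'(1)\<close>)
  qed
  have four: "fourier (\<Phi> n) t = Z n (t - y) - Z' n (t - y)" for n t
    unfolding \<Phi>_def fourier_modulate unfolding Z_def Z'_def fourier_def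
    by (subst Bochner_Integration.integral_diff[OF intg, symmetric]) (simp add: algebra_simps)
  have Zm: "Z n \<in> borel_measurable borel" "Z' n \<in> borel_measurable borel" for n
    unfolding Z_def[abs_def] Z'_def[abs_def]
    by (intro fourier_measurable borel_measurable_continuous_onI continuous_intros smooth_real_continuous \<phi> \<phi>')+
  define K where "K = (2 * (s + 1) + 1) + (2 * (s' + 1) + 1)"
  have K0: "K \<ge> 0" using s0 by (simp add: K_def)
  have Zb: "norm (Z n (t - y) - Z' n (t - y)) \<le> K * (1 + \<bar>y\<bar>) * wgt t" for n t
  proof -
    have "norm (Z n (t - y) - Z' n (t - y)) \<le> norm (Z n (t - y)) + norm (Z' n (t - y))" by (rule norm_triangle_ineq4)
    also have "\<dots> \<le> K * wgt (t - y)" using \<phi>(4)[of n "t - y"] \<phi>'(4)[of n "t - y"] by (simp add: Z_def Z'_def K_def algebra_simps)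
    also have "\<dots> \<le> K * ((1 + \<bar>y\<bar>) * wgt t)" using K0 by (intro mult_left_mono wgt_diff_le) auto
    finally show ?thesis by (simp add: mult_ac)
  qed
  have fm: "lmeas f" using f by (simp add: mem_wgt_def)
  \<comment> \<open>Since s and s' exceed c strictly, the smoothing width is eventually below the
    gap m - c, and the support then avoids [-c,c].\<close>
  have ev0: "\<forall>\<^sub>F n in sequentially. (\<integral>t. f t * (Z n (t - y) - Z' n (t - y)) \<partial>lebesgue) = 0"
  proof -
    have "(\<lambda>n. 1 / real (Suc n)) \<longlonglongrightarrow> 0" by (rule LIMSEQ_Suc[OF lim_1_over_n])
    moreover have "0 < m - c" using c by (simp add: m_def)
    ultimately have "\<forall>\<^sub>F n in sequentially. 1 / real (Suc n) < m - c" by (rule order_tendstoD(2))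
    then show ?thesis
    proof eventually_elim
      case (elim n)
      have "closure {x. \<Phi> n x \<noteq> 0} \<inter> {-c..c} = {}"
      proof (rule ccontr)
        assume "closure {x. \<Phi> n x \<noteq> 0} \<inter> {-c..c} \<noteq> {}"
        then obtain x where "x \<in> closure {x. \<Phi> n x \<noteq> 0}" "x \<in> {-c..c}" by blast
        with closed[of n] have "m - 1 / real (Suc n) \<le> \<bar>x\<bar>" "\<bar>x\<bar> \<le> c" by (auto simp: abs_le_iff)
        with elim show False by linarith
      qed
      then have "(\<integral>x. f x * fourier (\<Phi> n) x \<partial>lebesgue) = 0"
        using f(2) test[of n] unfolding band_lim_def by blast
      then show ?case by (simp add: four)
    qed
  qed
  have "(\<lambda>n. \<integral>t. f t * (Z n (t - y) - Z' n (t - y)) \<partial>lebesgue)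
     \<longlonglongrightarrow> (\<integral>t. f t * (of_real (ker s (y - t)) - of_real (ker s' (y - t))) \<partial>lebesgue)"
  proof (rule integral_dominated_convergence[where w = "\<lambda>t. K * (1 + \<bar>y\<bar>) * (wgt t * norm (f t))"])
    show "lmeas (\<lambda>t. f t * (of_real (ker s (y - t)) - of_real (ker s' (y - t))))"
      using fm ker_translate_measurable by (intro borel_measurable_times borel_measurable_diff) auto
    have "lmeas (\<lambda>t. Z n (t - y) - Z' n (t - y))" for n
      using Zm[measurable] by (intro borel_measurable_lebesgueI) measurable
    then show "lmeas (\<lambda>t. f t * (Z n (t - y) - Z' n (t - y)))" for n
      using fm by (intro borel_measurable_times) auto
    show "integrable lebesgue (\<lambda>t. K * (1 + \<bar>y\<bar>) * (wgt t * norm (f t)))"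
      using f by (auto simp: mem_wgt_def)
    show "AE t in lebesgue. (\<lambda>n. f t * (Z n (t - y) - Z' n (t - y))) \<longlonglongrightarrow> f t * (of_real (ker s (y - t)) - of_real (ker s' (y - t)))"
      unfolding Z_def Z'_def ker_commute[of _ y]
      by (intro AE_I2 tendsto_intros \<phi>(5) \<phi>'(5))
    show "AE t in lebesgue. norm (f t * (Z n (t - y) - Z' n (t - y))) \<le> K * (1 + \<bar>y\<bar>) * (wgt t * norm (f t))" for n
    proof (rule AE_I2, goal_cases)
      case (1 t)
      show ?case
        using mult_right_mono[OF Zb[of n t] norm_ge_zero[of "f t"]] by (simp add: norm_mult mult_ac)
    qed
  qed
  moreover have "(\<lambda>n. \<integral>t. f t * (Z n (t - y) - Z' n (t - y)) \<partial>lebesgue) \<longlonglongrightarrow> 0"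
    using ev0 by (rule tendsto_eventually)
  ultimately have "(\<integral>t. f t * (of_real (ker s (y - t)) - of_real (ker s' (y - t))) \<partial>lebesgue) = 0"
    by (rule LIMSEQ_unique)
  moreover have "(\<integral>t. f t * (of_real (ker s (y - t)) - of_real (ker s' (y - t))) \<partial>lebesgue)
     = ker_conv s f y - ker_conv s' f y"
    using s0 f(1) by (simp add: right_diff_distrib integrable_mult_ker Bochner_Integration.integral_diff)
  ultimately show ?thesis by simp
qed

text \<open>A smoothed cutoff spills over its interval, so test functions reach only s > c. The
  value s = c is recovered by letting s decrease to c, along which the integrals are
  constant.\<close>

lemma convolution_ker_eq_Pc:
  assumes f: "mem_wgt f" "band_lim c f" and c: "0 < c" "c < s"
  shows "ker_conv s f y = Pc c f y"
proof -
  have fm: "lmeas f" using f by (simp add: mem_wgt_def)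
  define \<sigma> where "\<sigma> n = c + 1 / real (Suc n)" for n
  have \<sigma>: "c < \<sigma> n" "\<sigma> n \<le> c + 1" for n by (auto simp: \<sigma>_def)
  have \<sigma>_lim: "\<sigma> \<longlonglongrightarrow> c"
    unfolding \<sigma>_def using tendsto_add[OF tendsto_const LIMSEQ_Suc[OF lim_1_over_n], of c] by simp
  let ?K = "(2 * (c + 1) + 1) * (1 + \<bar>y\<bar>)"
  have "(\<lambda>n. \<integral>t. f t * of_real (ker (\<sigma> n) (y - t)) \<partial>lebesgue) \<longlonglongrightarrow> ker_conv c f y"
  proof (rule integral_dominated_convergence[where w = "\<lambda>t. ?K * (wgt t * norm (f t))"])
    show "lmeas (\<lambda>t. f t * of_real (ker c (y - t)))"
      "lmeas (\<lambda>t. f t * of_real (ker (\<sigma> n) (y - t)))" for n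
      using fm ker_translate_measurable by (auto intro!: borel_measurable_times)
    show "integrable lebesgue (\<lambda>t. ?K * (wgt t * norm (f t)))"
      using f by (auto simp: mem_wgt_def)
    have "filterlim \<sigma> (at c) sequentially"
      unfolding filterlim_at using \<sigma>_lim \<sigma>(1) by (auto intro!: always_eventually simp: less_imp_neq[THEN not_sym])
    then show "AE t in lebesgue. (\<lambda>n. f t * of_real (ker (\<sigma> n) (y - t))) \<longlonglongrightarrow> f t * of_real (ker c (y - t))"
      by (intro AE_I2 tendsto_intros filterlim_compose[OF tendsto_ker])
    show "AE t in lebesgue. norm (f t * of_real (ker (\<sigma> n) (y - t))) \<le> ?K * (wgt t * norm (f t))" for n
    proof (rule AE_I2, goal_cases)
      case (1 t)
      have "norm (complex_of_real (ker (\<sigma> n) (y - t))) \<le> (2 * \<sigma> n + 1) * (1 + \<bar>y\<bar>) * wgt t"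
        using \<sigma>[of n] c by (intro ker_translate_bound) auto
      also have "\<dots> \<le> ?K * wgt t"
        using \<sigma>[of n] c by (intro mult_right_mono) auto
      finally have "norm (complex_of_real (ker (\<sigma> n) (y - t))) * norm (f t) \<le> ?K * wgt t * norm (f t)"
        by (rule mult_right_mono) simp
      then show ?case
        by (simp add: norm_mult mult_ac)
    qed
  qed
  moreover have "ker_conv (\<sigma> n) f y = ker_conv s f y" for n
    by (rule convolution_ker_indep[OF f c(1) \<sigma>(1) c(2)])
  ultimately show ?thesis
    using LIMSEQ_unique[OF tendsto_const] by (simp add: Pc_eq_ker[OF fm])
qed

text \<open>Fubini is applied on products of \<open>lborel\<close>, which calls for Borel functions
  in place of Lebesgue measurable ones.\<close>

lemma lebesgue_borel_representative:
  fixes f :: "real \<Rightarrow> complex"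
  assumes "lmeas f"
  obtains f' where "f' \<in> borel_measurable borel" "AE x in lebesgue. f x = f' x"
proof -
  have "lmeas (\<lambda>x. Re (f x))" "lmeas (\<lambda>x. Im (f x))"
    using assms by simp_all
  from this[THEN completion_ex_borel_measurable_real]
  obtain r i where ri: "r \<in> borel_measurable lborel" "AE x in lborel. Re (f x) = r x"
    "i \<in> borel_measurable lborel" "AE x in lborel. Im (f x) = i x" by blast
  show thesis
  proof (rule that[of "\<lambda>x. Complex (r x) (i x)"])
    show "(\<lambda>x. Complex (r x) (i x)) \<in> borel_measurable borel"
      using ri(1,3) unfolding Complex_eq by simp
    have "AE x in lborel. f x = Complex (r x) (i x)"
      using ri(2,4) by eventually_elim (simp add: complex_eq_iff)
    then show "AE x in lebesgue. f x = Complex (r x) (i x)"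
      by (rule AE_completion)
  qed
qed

lemma integral_Ioc_ker:
  assumes "a \<le> b"
  shows "(\<integral>y. indicator {a<..b} y * complex_of_real (ker s (y - t)) \<partial>lborel) = of_real (dirichlet a b s t)"
proof -
  have "(\<lambda>y. ker s (t - y)) absolutely_integrable_on {a..b}"
    by (intro absolutely_integrable_continuous_real continuous_intros)
  from set_lebesgue_integral_eq_integral(2)[OF this]
  have "(\<integral>y. indicator {a..b} y * ker s (t - y) \<partial>lebesgue) = dirichlet a b s t"
    using dirichlet_has_integral[OF assms, of s t] by (simp add: set_lebesgue_integral_def integral_unique)
  then have "(\<integral>y. indicator {a..b} y * ker s (t - y) \<partial>lborel) = dirichlet a b s t"
    by (subst (asm) integral_completion) auto
  also have "(\<integral>y. indicator {a..b} y * ker s (t - y) \<partial>lborel) = (\<integral>y. indicator {a<..b} y * ker s (y - t) \<partial>lborel)"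
  proof (rule integral_cong_AE)
    show "AE y in lborel. indicator {a..b} y * ker s (t - y) = indicator {a<..b} y * ker s (y - t)"
      using AE_lborel_singleton[of a] by eventually_elim (auto simp: indicator_def ker_commute)
  qed auto
  finally have "complex_of_real (\<integral>y. indicator {a<..b} y * ker s (y - t) \<partial>lborel) = of_real (dirichlet a b s t)" by simp
  then show ?thesis
    by (subst (asm) integral_complex_of_real[symmetric]) (simp add: of_real_indicator)
qed

text \<open>Integrating the convolution over (a,b] moves the kernel onto the indicator of that
  interval. For y in a bounded set the kernel is at most a multiple of \<open>wgt t\<close>, so the
  double integral converges absolutely.\<close>

lemma convolution_Fubini:
  assumes [measurable]: "f \<in> borel_measurable borel" and f: "mem_wgt f" and s: "s \<ge> 0" and ab: "a \<le> b"
  shows "integrable lborel (\<lambda>y. indicator {a<..b} y * ker_conv s f y)" (is ?A)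
    "(\<integral>y. indicator {a<..b} y * ker_conv s f y \<partial>lborel)
       = (\<integral>t. f t * of_real (dirichlet a b s t) \<partial>lebesgue)" (is ?B)
proof -
  define H where "H = (\<lambda>(y, t). indicator {a<..b} y * (f t * complex_of_real (ker s (y - t))))"
  have Hm [measurable]: "H \<in> borel_measurable (lborel \<Otimes>\<^sub>M lborel)" unfolding H_def by measurable
  have conv: "ker_conv s f y = (\<integral>t. f t * of_real (ker s (y - t)) \<partial>lborel)" for y
    by (rule integral_completion) measurable
  have fi: "integrable lborel (\<lambda>t. f t * complex_of_real (ker s (y - t)))" for y
    using integrable_mult_ker[OF s f, of y] by (subst (asm) integrable_completion) auto
  have wi: "integrable lborel (\<lambda>t. wgt t * norm (f t))"
    using f by (auto simp: mem_wgt_def integrable_completion)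
  define K where "K = (2 * s + 1) * (1 + max \<bar>a\<bar> \<bar>b\<bar>)"
  have Hb: "norm (H (y, t)) \<le> indicator {a<..b} y * K * (wgt t * norm (f t))" for y t
  proof (cases "y \<in> {a<..b}")
    case True
    have "norm (complex_of_real (ker s (y - t))) \<le> (2 * s + 1) * (1 + \<bar>y\<bar>) * wgt t"
      by (rule ker_translate_bound[OF s])
    also have "\<dots> \<le> K * wgt t"
      unfolding K_def using s True by (intro mult_right_mono mult_left_mono) auto
    finally have "norm (complex_of_real (ker s (y - t))) * norm (f t) \<le> K * wgt t * norm (f t)"
      by (rule mult_right_mono) simp
    then show ?thesis using True by (simp add: H_def norm_mult mult_ac)
  qed (simp add: H_def)
  have Hi: "integrable (lborel \<Otimes>\<^sub>M lborel) H"
  proof (rule lborel_pair.Fubini_integrable)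
    show "AE y in lborel. integrable lborel (\<lambda>t. H (y, t))"
      using fi by (simp add: H_def)
    show "integrable lborel (\<lambda>y. \<integral>t. norm (H (y, t)) \<partial>lborel)"
    proof (rule Bochner_Integration.integrable_bound)
      show "integrable lborel (\<lambda>y. indicator {a<..b} y * (K * (\<integral>t. wgt t * norm (f t) \<partial>lborel)))"
        using ab by (intro integrable_mult_left integrable_real_indicator) auto
      show "(\<lambda>y. \<integral>t. norm (H (y, t)) \<partial>lborel) \<in> borel_measurable lborel"
        by (intro sigma_finite_measure.borel_measurable_lebesgue_integral[OF sigma_finite_lborel]) measurable
      show "AE y in lborel. norm (\<integral>t. norm (H (y, t)) \<partial>lborel)
          \<le> norm (indicator {a<..b} y * (K * (\<integral>t. wgt t * norm (f t) \<partial>lborel)))"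
      proof (rule AE_I2, goal_cases)
        case (1 y)
        have "norm (\<integral>t. norm (H (y, t)) \<partial>lborel) = (\<integral>t. norm (H (y, t)) \<partial>lborel)" by simp
        also have "\<dots> \<le> (\<integral>t. indicator {a<..b} y * K * (wgt t * norm (f t)) \<partial>lborel)"
          using wi fi Hb by (intro integral_mono integrable_norm) (auto simp: H_def)
        also have "\<dots> = indicator {a<..b} y * (K * (\<integral>t. wgt t * norm (f t) \<partial>lborel))" by simp
        finally show ?case by simp
      qed
    qed
  qed simp
  have eq1: "(\<integral>t. H (y, t) \<partial>lborel) = indicator {a<..b} y * ker_conv s f y" for y
    unfolding conv by (simp add: H_def)
  have eq2: "(\<integral>y. H (y, t) \<partial>lborel) = f t * of_real (dirichlet a b s t)" for t
    unfolding integral_Ioc_ker[OF ab, symmetric] by (simp add: H_def mult.left_commute)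
  show ?A using lborel_pair.integrable_fst'[OF Hi] by (simp add: eq1)
  have "(\<integral>t. (\<integral>y. H (y, t) \<partial>lborel) \<partial>lborel) = (\<integral>y. (\<integral>t. H (y, t) \<partial>lborel) \<partial>lborel)"
    using lborel_pair.Fubini_integral[of "\<lambda>y t. H (y, t)"] Hi by simp
  then show ?B unfolding eq1 eq2 by (subst integral_completion) auto
qed

text \<open>\<open>ker_conv s f\<close> is the same function for all \<open>s > c\<close>, while its integral over an interval tends to that
  of \<open>f\<close> as \<open>s\<close> grows.\<close>

lemma reproducing_borel:
  assumes [measurable]: "f \<in> borel_measurable borel" and f: "mem_wgt f" "band_lim c f" and c: "c > 0"
  shows "AE x in lborel. f x - Pc c f x = 0"
proof (rule AE_zero_of_integrals_Ioc)
  fix a b :: real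
  have "integrable lborel (\<lambda>t. indicator {a<..b} t * (f t - Pc c f t)) \<and> (\<integral>t. indicator {a<..b} t * (f t - Pc c f t) \<partial>lborel) = 0"
  proof (cases "a \<le> b")
    case True
    have i1: "integrable lborel (\<lambda>t. indicator {a<..b} t * f t)"
    proof (rule Bochner_Integration.integrable_bound)
      show "integrable lborel (\<lambda>t. (1 + max \<bar>a\<bar> \<bar>b\<bar>) * (wgt t * norm (f t)))"
        using f by (auto simp: mem_wgt_def integrable_completion)
      show "AE t in lborel. norm (indicator {a<..b} t * f t) \<le> norm ((1 + max \<bar>a\<bar> \<bar>b\<bar>) * (wgt t * norm (f t)))"
      proof (rule AE_I2, goal_cases)
        case (1 t)
        have "norm (f t) \<le> (1 + max \<bar>a\<bar> \<bar>b\<bar>) * (wgt t * norm (f t))" if "t \<in> {a<..b}"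
        proof -
          have "1 \<le> (1 + max \<bar>a\<bar> \<bar>b\<bar>) * wgt t"
            using that by (auto simp: wgt_def divide_simps)
          from mult_right_mono[OF this norm_ge_zero[of "f t"]] show ?thesis by (simp add: mult_ac)
        qed
        then show ?case
          by (auto simp: indicator_def abs_mult)
      qed
    qed measurable
    have Pc: "ker_conv s f y = Pc c f y" if "c < s" for s y
      by (rule convolution_ker_eq_Pc[OF f c that])
    have i2: "integrable lborel (\<lambda>t. indicator {a<..b} t * Pc c f t)"
      using convolution_Fubini(1)[OF _ f(1) _ True, of "c + 1"] c by (simp add: Pc)
    obtain C where C: "C \<ge> 0" "\<And>s t. s \<ge> 1 \<Longrightarrow> \<bar>dirichlet a b s t\<bar> \<le> C * wgt t"
      using dirichlet_bound[OF True] by blast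
    \<comment> \<open>\<open>Suc n\<close> keeps the cutoff at least 1, where
      \<open>dirichlet_bound\<close> supplies the dominating function.\<close>
    have "(\<lambda>n. \<integral>t. f t * of_real (dirichlet a b (real (Suc n)) t) \<partial>lebesgue) \<longlonglongrightarrow> (\<integral>t. f t * of_real (indicator {a<..b} t) \<partial>lebesgue)"
    proof (rule integral_dominated_convergence[where w = "\<lambda>t. C * (wgt t * norm (f t))"])
      show "integrable lebesgue (\<lambda>t. C * (wgt t * norm (f t)))" using f by (auto simp: mem_wgt_def)
      have "AE t in lebesgue. t \<noteq> a \<and> t \<noteq> b" by (intro AE_completion AE_conjI AE_lborel_singleton)
      then show "AE t in lebesgue. (\<lambda>n. f t * of_real (dirichlet a b (real (Suc n)) t)) \<longlonglongrightarrow> f t * of_real (indicator {a<..b} t)"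
        by eventually_elim (intro tendsto_intros LIMSEQ_Suc dirichlet_limit True; simp)
      show "AE t in lebesgue. norm (f t * of_real (dirichlet a b (real (Suc n)) t)) \<le> C * (wgt t * norm (f t))" for n
      proof (rule AE_I2, goal_cases)
        case (1 t)
        show ?case
          using mult_right_mono[OF C(2)[of "real (Suc n)" t] norm_ge_zero[of "f t"]] by (simp add: norm_mult mult_ac)
      qed
    qed (auto intro!: borel_measurable_lebesgueI)
    moreover have "\<forall>\<^sub>F n in sequentially. (\<integral>t. f t * of_real (dirichlet a b (real (Suc n)) t) \<partial>lebesgue)
        = (\<integral>y. indicator {a<..b} y * Pc c f y \<partial>lborel)"
    proof -
      obtain N where N: "c < real N" using reals_Archimedean2 by blast
      show ?thesis
      proof (rule eventually_sequentiallyI[of N])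
        fix n assume "N \<le> n"
        then have "c < real (Suc n)" using N by simp
        with convolution_Fubini(2)[OF _ f(1) _ True, of "real (Suc n)"]
        show "(\<integral>t. f t * of_real (dirichlet a b (real (Suc n)) t) \<partial>lebesgue)
          = (\<integral>y. indicator {a<..b} y * Pc c f y \<partial>lborel)"
          by (simp add: Pc)
      qed
    qed
    ultimately have "(\<lambda>n::nat. \<integral>y. indicator {a<..b} y * Pc c f y \<partial>lborel) \<longlonglongrightarrow> (\<integral>t. f t * of_real (indicator {a<..b} t) \<partial>lebesgue)"
      by (rule Lim_transform_eventually)
    then have "(\<integral>y. indicator {a<..b} y * Pc c f y \<partial>lborel) = (\<integral>t. f t * of_real (indicator {a<..b} t) \<partial>lebesgue)"
      by (simp add: LIMSEQ_const_iff)
    also have "\<dots> = (\<integral>t. indicator {a<..b} t * f t \<partial>lborel)"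
      by (subst integral_completion) (auto simp: of_real_indicator mult.commute)
    finally show ?thesis
      using i1 i2 by (simp add: right_diff_distrib)
  qed simp
  then show "integrable lborel (\<lambda>t. indicator {a<..b} t * (f t - Pc c f t))"
    "(\<integral>t. indicator {a<..b} t * (f t - Pc c f t) \<partial>lborel) = 0" by auto
qed

lemma test_fun_fourier_measurable: "test_fun \<phi> \<Longrightarrow> lmeas (fourier \<phi>)"
  by (intro borel_measurable_lebesgueI fourier_measurable borel_measurable_continuous_onI test_fun_continuous)

lemma Pc_cong_AE:
  assumes "lmeas f" "lmeas g" "AE x in lebesgue. f x = g x"
  shows "Pc c f x = Pc c g x"
  unfolding Pc_eq_ker[OF assms(1)] Pc_eq_ker[OF assms(2)]
proof (rule integral_cong_AE)
  show "AE t in lebesgue. f t * of_real (ker c (x - t)) = g t * of_real (ker c (x - t))"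
    using assms(3) by eventually_elim simp
qed (use assms ker_translate_measurable in \<open>auto intro!: borel_measurable_times\<close>)

text \<open>Both hypotheses and the values of \<open>Pc c f\<close> depend on f only up to null
  sets, so a Borel representative may be used.\<close>

lemma reproducing:
  assumes f: "mem_wgt f" "band_lim c f" and c: "c > 0"
  shows "AE x in lebesgue. f x = Pc c f x"
proof -
  have fm: "lmeas f" using f by (simp add: mem_wgt_def)
  obtain g where g: "g \<in> borel_measurable borel" "AE x in lebesgue. f x = g x"
    using lebesgue_borel_representative[OF fm] by blast
  have gm: "lmeas g" by (rule borel_measurable_lebesgueI[OF g(1)])
  have wm: "lmeas wgt" by (rule borel_measurable_lebesgueI) measurable
  have g1: "mem_wgt g"
  proof -
    have "integrable lebesgue (\<lambda>t. wgt t * norm (g t))"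
    proof (rule integrable_cong_AE_imp)
      show "integrable lebesgue (\<lambda>t. wgt t * norm (f t))" using f by (simp add: mem_wgt_def)
      show "AE t in lebesgue. wgt t * norm (f t) = wgt t * norm (g t)" using g(2) by eventually_elim simp
    qed (use gm wm in \<open>auto intro!: borel_measurable_times\<close>)
    then show ?thesis using gm by (simp add: mem_wgt_def)
  qed
  have g2: "band_lim c g"
    unfolding band_lim_def
  proof (intro allI impI)
    fix \<phi> assume a: "test_fun \<phi> \<and> closure {x. \<phi> x \<noteq> 0} \<inter> {-c..c} = {}"
    then have "(\<integral>x. f x * fourier \<phi> x \<partial>lebesgue) = 0" using f(2) unfolding band_lim_def by blast
    moreover have "(\<integral>x. f x * fourier \<phi> x \<partial>lebesgue) = (\<integral>x. g x * fourier \<phi> x \<partial>lebesgue)"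
    proof (rule integral_cong_AE)
      show "AE x in lebesgue. f x * fourier \<phi> x = g x * fourier \<phi> x" using g(2) by eventually_elim simp
    qed (use fm gm a test_fun_fourier_measurable in \<open>auto intro!: borel_measurable_times\<close>)
    ultimately show "(\<integral>x. g x * fourier \<phi> x \<partial>lebesgue) = 0" by simp
  qed
  have "AE x in lebesgue. g x - Pc c g x = 0"
    by (intro AE_completion reproducing_borel g g1 g2 c)
  then show ?thesis
    using g(2) by eventually_elim (simp add: Pc_cong_AE[OF fm gm g(2)])
qed

lemma band_lim_add:
  assumes "mem_wgt f" "mem_wgt g" "band_lim c f" "band_lim c g"
  shows "band_lim c (\<lambda>x. f x + z * g x)"
  unfolding band_lim_def
proof (intro allI impI)
  fix \<phi> assume a: "test_fun \<phi> \<and> closure {x. \<phi> x \<noteq> 0} \<inter> {-c..c} = {}"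
  obtain C where C: "\<And>v. norm (fourier \<phi> v) \<le> C * wgt v" using test_fun_fourier_bound a by blast
  have m: "lmeas (fourier \<phi>)" using a by (intro test_fun_fourier_measurable) simp
  have "integrable lebesgue (\<lambda>x. f x * fourier \<phi> x)" "integrable lebesgue (\<lambda>x. g x * fourier \<phi> x)"
    by (rule integrable_mult_wgt_bound[OF _ m C]; fact)+
  moreover have "(\<integral>x. f x * fourier \<phi> x \<partial>lebesgue) = 0" "(\<integral>x. g x * fourier \<phi> x \<partial>lebesgue) = 0"
    using assms(3,4) a unfolding band_lim_def by blast+
  ultimately show "(\<integral>x. (f x + z * g x) * fourier \<phi> x \<partial>lebesgue) = 0"
    by (simp add: distrib_right mult.assoc)
qed

section \<open>Translates of the sinc kernel are band-limited\<close>

text \<open>The sinc kernel is not absolutely integrable; truncation to [-s,s] permits exchanging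
  the integrals. The result is again a Dirichlet integral, now in the frequency variable, which
  approximates the indicator of [-c,c] as s grows.\<close>

lemma integral_ker_cis:
  assumes "c > 0" "s \<ge> 0"
  shows "integral {-s..s} (\<lambda>u. of_real (ker c u) * cis (- 2 * pi * u * w)) = of_real (dirichlet (-c) c s (-w))"
proof -
  let ?h = "\<lambda>u \<eta>. cis (- 2 * pi * \<eta> * u) * cis (- 2 * pi * u * w)"
  have "integral (cbox (-s) s) (\<lambda>u. integral (cbox (-c) c) (?h u)) = integral (cbox (-c) c) (\<lambda>\<eta>. integral (cbox (-s) s) (\<lambda>u. ?h u \<eta>))"
    by (rule integral_swap_continuous) (auto intro!: continuous_intros simp: case_prod_beta)
  moreover have "integral {-c..c} (?h u) = of_real (ker c u) * cis (- 2 * pi * u * w)" for u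
    using assms by (intro integral_unique has_integral_mult_left has_integral_cis_ker) auto
  moreover have "integral {-s..s} (\<lambda>u. ?h u \<eta>) = of_real (ker s (- w - \<eta>))" for \<eta>
  proof -
    have "?h u \<eta> = cis (- 2 * pi * u * (\<eta> + w))" for u by (simp add: cis_mult algebra_simps)
    moreover have "((\<lambda>u. cis (- 2 * pi * u * (\<eta> + w))) has_integral of_real (ker s (\<eta> + w))) {-s..s}"
      by (rule has_integral_cis_ker[OF assms(2)])
    moreover have "ker s (\<eta> + w) = ker s (- w - \<eta>)"
    proof -
      have "- w - \<eta> = - (\<eta> + w)" by simp
      then show ?thesis by (simp only: ker_minus)
    qed
    ultimately show ?thesis by (simp add: integral_unique)
  qed
  moreover have "integral {-c..c} (\<lambda>\<eta>. complex_of_real (ker s (- w - \<eta>))) = of_real (dirichlet (-c) c s (-w))"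
    using has_integral_of_real[OF dirichlet_has_integral[of "-c" c s "-w"]] assms
    by (intro integral_unique) auto
  ultimately show ?thesis by simp
qed

text \<open>Truncated to a bounded interval, the pairing becomes the integral of
  \<open>\<phi>\<close> against a Dirichlet integral over frequencies, whose limit lives on [-c,c],
  where \<open>\<phi>\<close> vanishes.\<close>

lemma integral_ker_fourier_0:
  fixes \<phi> :: "real \<Rightarrow> complex"
  assumes c: "c > 0" and \<phi>: "continuous_on UNIV \<phi>" "\<And>x. R < \<bar>x\<bar> \<Longrightarrow> \<phi> x = 0" "\<And>x. \<bar>x\<bar> \<le> c \<Longrightarrow> \<phi> x = 0"
    and i: "integrable lebesgue (\<lambda>u. of_real (ker c u) * fourier \<phi> u)"
  shows "(\<integral>u. of_real (ker c u) * fourier \<phi> u \<partial>lebesgue) = 0"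
proof -
  let ?g = "\<lambda>u. of_real (ker c u) * fourier \<phi> u"
  let ?G = "\<lambda>n u. indicator {-real (Suc n)..real (Suc n)} u * ?g u"
  define D where "D n w = dirichlet (-c) c (real (Suc n)) (-w)" for n w
  obtain K where K: "K \<ge> 0" "\<And>s t. s \<ge> 1 \<Longrightarrow> \<bar>dirichlet (-c) c s t\<bar> \<le> K * wgt t"
    using dirichlet_bound[of "-c" c] c by auto
  have eq: "integral\<^sup>L lebesgue (?G n)
      = (\<integral>w. \<phi> w * of_real (D n w) \<partial>lebesgue)" for n
  proof -
    let ?s = "real (Suc n)"
    let ?h = "\<lambda>u w. of_real (ker c u) * (\<phi> w * cis (- 2 * pi * w * u))"
    have f: "?g u = integral {-R..R} (?h u)" for u
      by (simp add: fourier_compact_support(2)[OF \<phi>(1,2)])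
    have cont: "continuous_on S (\<lambda>(u, w). ?h u w)" for S
      unfolding case_prod_beta
      by (intro continuous_intros continuous_on_compose2[OF \<phi>(1)]) auto
    have swap: "integral (cbox (-?s) ?s) (\<lambda>u. integral (cbox (-R) R) (?h u)) = integral (cbox (-R) R) (\<lambda>w. integral (cbox (-?s) ?s) (\<lambda>u. ?h u w))"
      by (rule integral_swap_continuous[OF cont])
    have "set_integrable lebesgue {-?s..?s} ?g"
      unfolding set_integrable_def by (rule integrable_mult_indicator[OF _ i]) simp
    from set_lebesgue_integral_eq_integral(2)[OF this]
    have "integral\<^sup>L lebesgue (?G n) = integral {-?s..?s} (\<lambda>u. integral {-R..R} (?h u))"
      by (simp add: set_lebesgue_integral_def scaleR_conv_of_real of_real_indicator f)
    also have "\<dots> = integral {-R..R} (\<lambda>w. integral {-?s..?s} (\<lambda>u. ?h u w))"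
      using swap by simp
    also have "\<dots> = integral {-R..R} (\<lambda>w. \<phi> w * of_real (D n w))"
    proof (rule integral_cong)
      fix w
      have "integral {-?s..?s} (\<lambda>u. ?h u w) = integral {-?s..?s} (\<lambda>u. \<phi> w * (of_real (ker c u) * cis (- 2 * pi * u * w)))"
        by (simp add: mult_ac)
      also have "\<dots> = \<phi> w * of_real (D n w)"
        using integral_ker_cis[OF c, of ?s w] by (simp only: D_def integral_mult_right)
      finally show "integral {-?s..?s} (\<lambda>u. ?h u w) = \<phi> w * of_real (D n w)" .
    qed
    also have "\<dots> = (\<integral>w. \<phi> w * of_real (D n w) \<partial>lebesgue)"
    proof (rule lebesgue_integral_compact_support(2)[symmetric])
      show "continuous_on {-R..R} (\<lambda>w. \<phi> w * of_real (D n w))"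
        unfolding D_def dirichlet_def
        by (intro continuous_intros continuous_on_subset[OF \<phi>(1)] continuous_on_compose2[OF continuous_at_imp_continuous_on[of UNIV Si]])
           (auto simp: isCont_Si)
    qed (simp add: \<phi>(2))
    finally show ?thesis .
  qed
  have "(\<lambda>n. \<integral>w. \<phi> w * of_real (D n w) \<partial>lebesgue) \<longlonglongrightarrow> integral\<^sup>L lebesgue (\<lambda>w::real. 0)"
  proof (rule integral_dominated_convergence[where w = "\<lambda>w. K * norm (\<phi> w)" and f = "\<lambda>_. 0" and s = "\<lambda>n w. \<phi> w * of_real (D n w)"])
    have [measurable]: "\<phi> \<in> borel_measurable borel" by (intro borel_measurable_continuous_onI \<phi>)
    show "lmeas (\<lambda>w. \<phi> w * of_real (D n w))" for n
      unfolding D_def by (rule borel_measurable_lebesgueI) measurable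
    have "integrable lebesgue \<phi>"
      by (rule lebesgue_integral_compact_support(1)[where R = R]) (auto intro: continuous_on_subset[OF \<phi>(1)] \<phi>(2))
    then show "integrable lebesgue (\<lambda>w. K * norm (\<phi> w))" by auto
    \<comment> \<open>The points -c and c, exceptional for \<open>dirichlet_limit\<close>, lie where
      \<open>\<phi>\<close> vanishes, so the limit holds for every w.\<close>
    have "(\<lambda>n. \<phi> w * of_real (D n w)) \<longlonglongrightarrow> 0" for w
    proof (cases "\<bar>w\<bar> \<le> c")
      case False
      have "(\<lambda>n. \<phi> w * of_real (D n w)) \<longlonglongrightarrow> \<phi> w * of_real (indicator {-c<..c} (-w))"
        unfolding D_def using False c by (intro tendsto_intros LIMSEQ_Suc dirichlet_limit) auto
      moreover have "- w \<notin> {-c<..c}" using False by auto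
      ultimately show ?thesis by simp
    qed (simp add: \<phi>(3))
    then show "AE w in lebesgue. (\<lambda>n. \<phi> w * of_real (D n w)) \<longlonglongrightarrow> 0" by simp
    show "AE w in lebesgue. norm (\<phi> w * of_real (D n w)) \<le> K * norm (\<phi> w)" for n
    proof (rule AE_I2, goal_cases)
      case (1 w)
      have "\<bar>D n w\<bar> \<le> K * wgt (-w)" unfolding D_def by (rule K(2)) simp
      also have "\<dots> \<le> K * 1" using K(1) by (intro mult_left_mono) auto
      finally have "\<bar>D n w\<bar> * norm (\<phi> w) \<le> K * norm (\<phi> w)" by (intro mult_right_mono) auto
      then show ?case by (simp add: norm_mult mult.commute)
    qed
  qed simp
  moreover have "(\<lambda>n. \<integral>u. ?G n u \<partial>lebesgue)
     \<longlonglongrightarrow> integral\<^sup>L lebesgue ?g"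
  proof (rule integral_dominated_convergence[where w = "\<lambda>u. norm (?g u)"])
    show "lmeas ?g" using i by auto
    show "lmeas (?G n)" for n
    proof (rule borel_measurable_times)
      show "lmeas ?g" using i by auto
    qed (rule borel_measurable_lebesgueI, measurable)
    show "integrable lebesgue (\<lambda>u. norm (?g u))" using i by (rule integrable_norm)
    show "AE u in lebesgue. (\<lambda>n. ?G n u) \<longlonglongrightarrow> ?g u"
    proof (rule AE_I2, goal_cases)
      case (1 u)
      obtain N where N: "\<bar>u\<bar> < real N" using reals_Archimedean2 by blast
      have "\<forall>\<^sub>F n in sequentially. ?g u = ?G n u"
        by (rule eventually_sequentiallyI[of N]) (use N in \<open>auto simp: indicator_def\<close>)
      then show ?case
        by (rule Lim_transform_eventually[OF tendsto_const])
    qed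
  qed (auto simp: indicator_def)
  ultimately show ?thesis unfolding eq by (simp add: LIMSEQ_unique)
qed

text \<open>Translating the kernel amounts to modulating the test function, which still vanishes on
  [-c,c]; this reduces the claim to x = 0.\<close>

lemma band_lim_ker:
  assumes "c > 0" shows "band_lim c (\<lambda>t. of_real (ker c (x - t)))"
  unfolding band_lim_def
proof (intro allI impI)
  fix \<phi> assume a: "test_fun \<phi> \<and> closure {x. \<phi> x \<noteq> 0} \<inter> {-c..c} = {}"
  then have t: "test_fun \<phi>" by simp
  obtain C where C: "C \<ge> 0" "\<And>v. norm (fourier \<phi> v) \<le> C * wgt v" using test_fun_fourier_bound t by blast
  obtain R where R: "\<And>x. R < \<bar>x\<bar> \<Longrightarrow> \<phi> x = 0" using test_fun_support t by blast
  have z: "\<phi> w = 0" if "\<bar>w\<bar> \<le> c" for w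
  proof (rule ccontr)
    assume "\<phi> w \<noteq> 0"
    then have "w \<in> closure {x. \<phi> x \<noteq> 0}" using closure_subset[of "{x. \<phi> x \<noteq> 0}"] by auto
    then show False using a that by (auto simp: abs_le_iff)
  qed
  define \<psi> where "\<psi> w = \<phi> w * cis (2 * pi * (- x) * w)" for w
  have f: "fourier \<psi> u = fourier \<phi> (u + x)" for u
    unfolding \<psi>_def using fourier_modulate[of \<phi> "-x" u] by simp
  have fm [measurable]: "fourier \<phi> \<in> borel_measurable borel"
    by (intro fourier_measurable borel_measurable_continuous_onI test_fun_continuous t)
  have b: "norm (fourier \<psi> u) \<le> C * (1 + \<bar>x\<bar>) * wgt u" for u
  proof -
    have "norm (fourier \<psi> u) \<le> C * wgt (u - (- x))" using C(2)[of "u + x"] by (simp add: f)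
    also have "\<dots> \<le> C * ((1 + \<bar>x\<bar>) * wgt u)" using C(1) by (intro mult_left_mono wgt_diff_le) auto
    finally show ?thesis by (simp add: mult_ac)
  qed
  have "(\<integral>u. of_real (ker c u) * fourier \<psi> u \<partial>lebesgue) = 0"
  proof (rule integral_ker_fourier_0[where R = R, OF assms])
    show "continuous_on UNIV \<psi>" unfolding \<psi>_def by (intro continuous_intros test_fun_continuous t)
    show "integrable lebesgue (\<lambda>u. of_real (ker c u) * fourier \<psi> u)"
    proof (rule integrable_mult_wgt_bound[OF _ _ b])
      show "lmeas (fourier \<psi>)"
        unfolding f by (rule borel_measurable_lebesgueI) measurable
      have "integrable lebesgue (\<lambda>t. wgt t * \<bar>ker c t\<bar>)"
      proof (rule Bochner_Integration.integrable_bound)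
        show "integrable lebesgue (\<lambda>t. (2 * c + 1) * (wgt t)^2)" using integrable_wgt_square by simp
        show "AE t in lebesgue. norm (wgt t * \<bar>ker c t\<bar>) \<le> norm ((2 * c + 1) * (wgt t)^2)"
        proof (rule AE_I2, goal_cases)
          case (1 t)
          show ?case
            using mult_left_mono[OF ker_le[of c t] wgt_nonneg[of t]] assms
            by (simp add: abs_mult power2_eq_square mult_ac)
        qed
      qed (rule borel_measurable_lebesgueI, measurable)
      then show "mem_wgt (\<lambda>u. of_real (ker c u))"
        unfolding mem_wgt_def by (auto intro!: borel_measurable_lebesgueI)
    qed
  qed (auto simp: \<psi>_def R z)
  then have "(\<integral>u. of_real (ker c u) * fourier \<phi> (u + x) \<partial>lborel) = 0"
    unfolding f by (subst (asm) integral_completion) auto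
  also have "(\<integral>u. of_real (ker c u) * fourier \<phi> (u + x) \<partial>lborel) = (\<integral>t. of_real (ker c (x - t)) * fourier \<phi> t \<partial>lborel)"
    using lborel_integral_real_affine[of 1 "\<lambda>t. of_real (ker c (x - t)) * fourier \<phi> t" x] by (simp add: add.commute)
  also have "\<dots> = (\<integral>t. of_real (ker c (x - t)) * fourier \<phi> t \<partial>lebesgue)"
    by (subst integral_completion) auto
  finally show "(\<integral>t. of_real (ker c (x - t)) * fourier \<phi> t \<partial>lebesgue) = 0" .
qed

section \<open>Square-integrable functions\<close>

abbreviation L2 :: "(real \<Rightarrow> complex) \<Rightarrow> bool" where
  "L2 \<equiv> memLp 2"

lemma L2_iff: "L2 f \<longleftrightarrow> lmeas f \<and> integrable lebesgue (\<lambda>x. (cmod (f x))^2)"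
proof -
  have "cmod (f x) powr 2 = (cmod (f x))^2" for x by (cases "f x = 0") (auto simp: powr_numeral)
  then show ?thesis by (simp add: memLp_def)
qed

lemma L2_measurable: "L2 f \<Longrightarrow> lmeas f"
  by (simp add: L2_iff)

lemma L2_bound:
  assumes "L2 g" "lmeas f" "AE x in lebesgue. cmod (f x) \<le> cmod (g x)"
  shows "L2 f"
  unfolding L2_iff
proof
  show "integrable lebesgue (\<lambda>x. (cmod (f x))^2)"
  proof (rule Bochner_Integration.integrable_bound)
    show "integrable lebesgue (\<lambda>x. (cmod (g x))^2)" using assms by (simp add: L2_iff)
    show "AE x in lebesgue. norm ((cmod (f x))^2) \<le> norm ((cmod (g x))^2)"
      using assms(3) by eventually_elim (auto intro: power_mono)
  qed (use assms in auto)
qed fact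

lemma L2_mult_integrable:
  assumes "L2 f" "L2 g" shows "integrable lebesgue (\<lambda>x. f x * g x)"
proof (rule Bochner_Integration.integrable_bound)
  show "integrable lebesgue (\<lambda>x. (cmod (f x))^2 + (cmod (g x))^2)" using assms by (simp add: L2_iff)
  show "lmeas (\<lambda>x. f x * g x)"
    using assms by (auto simp: L2_iff)
  have "a * b \<le> a^2 + b^2" if "0 \<le> a" "0 \<le> b" for a b :: real
    using sum_squares_bound[of a b] mult_nonneg_nonneg[OF that] by linarith
  then show "AE x in lebesgue. norm (f x * g x) \<le> norm ((cmod (f x))^2 + (cmod (g x))^2)"
    by (auto simp: norm_mult)
qed

lemma L2_cnj: "L2 f \<Longrightarrow> L2 (\<lambda>x. cnj (f x))"
  using borel_measurable_continuous_on[of cnj f lebesgue] by (simp add: L2_iff continuous_intros)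

lemma L2_inner_integrable: "L2 f \<Longrightarrow> L2 g \<Longrightarrow> integrable lebesgue (\<lambda>x. f x * cnj (g x))"
  by (intro L2_mult_integrable L2_cnj)

lemma L2_scale: "L2 f \<Longrightarrow> L2 (\<lambda>x. z * f x)"
  by (auto simp: L2_iff norm_mult power_mult_distrib)

lemma L2_add: assumes "L2 f" "L2 g" shows "L2 (\<lambda>x. f x + g x)"
proof -
  have "L2 (\<lambda>x. of_real (2 * max (cmod (f x)) (cmod (g x))))"
    unfolding L2_iff
  proof
    show m: "lmeas (\<lambda>x. complex_of_real (2 * max (cmod (f x)) (cmod (g x))))"
      using assms by (auto simp: L2_iff)
    show "integrable lebesgue (\<lambda>x. (cmod (complex_of_real (2 * max (cmod (f x)) (cmod (g x)))))^2)"
    proof (rule Bochner_Integration.integrable_bound)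
      show "integrable lebesgue (\<lambda>x. 4 * ((cmod (f x))^2 + (cmod (g x))^2))" using assms by (simp add: L2_iff)
      show "lmeas (\<lambda>x. (cmod (complex_of_real (2 * max (cmod (f x)) (cmod (g x)))))^2)"
        using m by (intro borel_measurable_power) (rule measurable_compose[OF _ borel_measurable_norm])
    qed (auto simp: max_def power_mult_distrib)
  qed
  then show ?thesis
  proof (rule L2_bound)
    show "lmeas (\<lambda>x. f x + g x)" using assms by (auto simp: L2_iff)
    show "AE x in lebesgue. cmod (f x + g x) \<le> cmod (complex_of_real (2 * max (cmod (f x)) (cmod (g x))))"
    proof (rule AE_I2, goal_cases)
      case (1 x)
      show ?case
        using norm_triangle_ineq[of "f x" "g x"] by (simp del: of_real_mult)
    qed
  qed
qed

lemma L2_zero: "L2 (\<lambda>x. 0)"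
  by (simp add: L2_iff)

lemma L2_sum: "(\<And>i. i \<in> I \<Longrightarrow> L2 (f i)) \<Longrightarrow> L2 (\<lambda>x. \<Sum>i\<in>I. f i x)"
  by (induction I rule: infinite_finite_induct) (auto intro: L2_add L2_zero)

lemma L2_wgt_bound:
  assumes "lmeas f" "\<And>x. cmod (f x) \<le> C * wgt x" shows "L2 f"
proof (rule L2_bound[where g = "\<lambda>x. of_real (C * wgt x)"])
  show "L2 (\<lambda>x. of_real (C * wgt x))"
    unfolding L2_iff using integrable_wgt_square
    by (auto intro!: borel_measurable_lebesgueI simp: norm_mult power_mult_distrib)
qed (use assms in \<open>auto intro!: AE_I2 order_trans[OF assms(2) abs_ge_self] simp del: of_real_mult\<close>)

lemma L2_wgt: "L2 (\<lambda>x. of_real (wgt x))"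
  by (rule L2_wgt_bound[where C = 1]) (auto intro!: borel_measurable_lebesgueI)

lemma L2_ker: "c \<ge> 0 \<Longrightarrow> L2 (\<lambda>t. of_real (ker c (x - t)))"
  by (rule L2_wgt_bound[OF ker_translate_measurable ker_translate_bound])

lemma L2_mem_wgt: assumes "L2 f" shows "mem_wgt f"
proof -
  have "integrable lebesgue (\<lambda>x. norm (of_real (wgt x) * f x))"
    by (intro integrable_norm L2_mult_integrable L2_wgt assms)
  then show ?thesis using assms by (simp add: mem_wgt_def norm_mult L2_iff)
qed

lemma L2norm_nonneg [simp]: "0 \<le> L2norm f"
  by (simp add: L2norm_def)

lemma L2norm_sq: "(L2norm f)^2 = (\<integral>x. (cmod (f x))^2 \<partial>lebesgue)"
  by (simp add: L2norm_def)

lemma inner_L_self: "inner_L f f = of_real ((L2norm f)^2)"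
  unfolding inner_L_def L2norm_sq integral_complex_of_real[symmetric]
  by (simp add: complex_norm_square del: of_real_power)

lemma inner_L_add_left: "L2 f \<Longrightarrow> L2 g \<Longrightarrow> L2 h \<Longrightarrow> inner_L (\<lambda>x. f x + g x) h = inner_L f h + inner_L g h"
  unfolding inner_L_def by (simp add: distrib_right L2_inner_integrable)

lemma inner_L_scale_left: "inner_L (\<lambda>x. z * f x) h = z * inner_L f h"
  unfolding inner_L_def by (simp add: mult.assoc)

lemma inner_L_cnj: "cnj (inner_L f g) = inner_L g f"
  unfolding inner_L_def Bochner_Integration.integral_cnj[symmetric] by (simp add: mult.commute)

lemma inner_L_sum_left:
  "(\<And>i. i \<in> I \<Longrightarrow> L2 (f i)) \<Longrightarrow> L2 h \<Longrightarrow> inner_L (\<lambda>x. \<Sum>i\<in>I. f i x) h = (\<Sum>i\<in>I. inner_L (f i) h)"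
proof (induction I rule: infinite_finite_induct)
  case (insert i I)
  then show ?case by (simp add: inner_L_add_left L2_sum)
qed (simp_all add: inner_L_def)

lemma inner_L_add_right: "L2 f \<Longrightarrow> L2 g \<Longrightarrow> L2 h \<Longrightarrow> inner_L h (\<lambda>x. f x + g x) = inner_L h f + inner_L h g"
  using arg_cong[OF inner_L_add_left[of f g h], of cnj] by (simp add: inner_L_cnj)

lemma inner_L_scale_right: "inner_L h (\<lambda>x. z * f x) = cnj z * inner_L h f"
  using arg_cong[OF inner_L_scale_left[of z f h], of cnj] by (simp add: inner_L_cnj)

lemma L2norm_cong_AE:
  assumes "lmeas f" "lmeas g" "AE x in lebesgue. f x = g x"
  shows "L2norm f = L2norm g"
  unfolding L2norm_def
proof (rule arg_cong[where f = sqrt], rule integral_cong_AE)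
  show "AE x in lebesgue. (cmod (f x))^2 = (cmod (g x))^2" using assms(3) by eventually_elim simp
qed (use assms in auto)

lemma L2norm_mono_AE:
  assumes "L2 g" "lmeas f" "AE x in lebesgue. cmod (f x) \<le> cmod (g x)"
  shows "L2norm f \<le> L2norm g"
  unfolding L2norm_def
proof (rule real_sqrt_le_mono, rule integral_mono_AE)
  show "integrable lebesgue (\<lambda>x. (cmod (f x))^2)" using L2_bound[OF assms] by (simp add: L2_iff)
  show "AE x in lebesgue. (cmod (f x))^2 \<le> (cmod (g x))^2"
    using assms(3) by eventually_elim (simp add: power_mono)
qed (use assms in \<open>simp add: L2_iff\<close>)

lemma L2norm_scale: "L2norm (\<lambda>x. z * f x) = cmod z * L2norm f"
  unfolding L2norm_def by (simp add: norm_mult power_mult_distrib real_sqrt_mult)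

lemma L2norm_eq_0_AE: "L2 f \<Longrightarrow> L2norm f = 0 \<Longrightarrow> AE x in lebesgue. f x = 0"
  unfolding L2norm_def L2_iff
  using integral_nonneg_eq_0_iff_AE[of lebesgue "\<lambda>x. (cmod (f x))^2"] by auto

text \<open>if false then nothing here is special: the quadratic expansion in the complex parameter
  z yields both the Cauchy-Schwarz inequality and the first variation of the concentration.\<close>

lemma L2norm_add_sq:
  assumes "L2 f" "L2 g"
  shows "(L2norm (\<lambda>x. f x + z * g x))^2 = (L2norm f)^2 + 2 * Re (cnj z * inner_L f g) + (cmod z)^2 * (L2norm g)^2"
proof -
  have zg: "L2 (\<lambda>x. z * g x)" by (rule L2_scale[OF assms(2)])
  have "complex_of_real ((L2norm (\<lambda>x. f x + z * g x))^2) = inner_L (\<lambda>x. f x + z * g x) (\<lambda>x. f x + z * g x)"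
    by (simp only: inner_L_self)
  also have "\<dots> = inner_L f f + cnj z * inner_L f g + (z * cnj (inner_L f g) + z * cnj z * inner_L g g)"
    using assms zg L2_add[OF assms(1) zg]
    by (simp add: inner_L_add_left inner_L_add_right inner_L_scale_left inner_L_scale_right inner_L_cnj algebra_simps)
  also have "z * cnj (inner_L f g) = cnj (cnj z * inner_L f g)" by simp
  finally have "(L2norm (\<lambda>x. f x + z * g x))^2 = Re (inner_L f f + cnj z * inner_L f g + (cnj (cnj z * inner_L f g) + z * cnj z * inner_L g g))"
    by (metis Re_complex_of_real)
  then show ?thesis
    by (simp only: inner_L_self complex_norm_square[symmetric] of_real_mult[symmetric] plus_complex.sel Re_complex_of_real complex_cnj(1) cnj.sel)
qed

lemma inner_L_Cauchy_Schwarz: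
  assumes "L2 f" "L2 g" shows "cmod (inner_L f g) \<le> L2norm f * L2norm g"
proof (cases "L2norm g = 0")
  case True
  have "AE x in lebesgue. g x = 0" by (rule L2norm_eq_0_AE[OF assms(2) True])
  then have "AE x in lebesgue. f x * cnj (g x) = 0" by eventually_elim simp
  then have "inner_L f g = 0" unfolding inner_L_def by (rule integral_eq_zero_AE)
  then show ?thesis using True by simp
next
  case False
  then have G: "(L2norm g)^2 > 0" by simp
  \<comment> \<open>The minimizer of the quadratic in z.\<close>
  let ?z = "- inner_L f g / of_real ((L2norm g)^2)"
  have "0 \<le> (L2norm f)^2 + 2 * Re (cnj ?z * inner_L f g) + (cmod ?z)^2 * (L2norm g)^2"
    unfolding L2norm_add_sq[OF assms, symmetric] by simp
  also have "cnj ?z * inner_L f g = - of_real ((cmod (inner_L f g))^2 / (L2norm g)^2)"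
    using complex_norm_square[of "inner_L f g", symmetric] by (simp add: mult.commute)
  also have "(cmod ?z)^2 * (L2norm g)^2 = (cmod (inner_L f g))^2 / (L2norm g)^2"
  proof -
    have "cmod ?z = cmod (inner_L f g) / (L2norm g)^2" by (simp add: norm_divide norm_power)
    then show ?thesis using G by (simp add: power2_eq_square)
  qed
  finally have "(cmod (inner_L f g))^2 / (L2norm g)^2 \<le> (L2norm f)^2" by simp
  then have "(cmod (inner_L f g))^2 \<le> (L2norm f * L2norm g)^2"
    using G by (simp add: field_simps power_mult_distrib)
  then show ?thesis by (rule power2_le_imp_le) simp
qed

text \<open>Cauchy-Schwarz against the fixed square-integrable weight: a pointwise bound C / (1 +
  |t|) on a kernel becomes a bound by the L^2 norm of f.\<close>

lemma L2_integral_wgt_bound: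
  assumes "L2 f" "lmeas h" "\<And>t. cmod (h t) \<le> C * wgt t"
  shows "cmod (\<integral>t. f t * h t \<partial>lebesgue) \<le> C * L2norm (\<lambda>x. of_real (wgt x)) * L2norm f"
proof -
  have C: "C \<ge> 0" using order_trans[OF norm_ge_zero assms(3)[of 0]] by (simp add: zero_le_mult_iff wgt_def)
  have h: "L2 (\<lambda>t. cnj (h t))" using assms by (intro L2_cnj L2_wgt_bound)
  have "cmod (inner_L f (\<lambda>t. cnj (h t))) \<le> L2norm f * L2norm (\<lambda>t. cnj (h t))"
    by (rule inner_L_Cauchy_Schwarz[OF assms(1) h])
  also have "\<dots> \<le> L2norm f * L2norm (\<lambda>t. of_real C * of_real (wgt t))"
    using assms C h by (intro mult_left_mono L2norm_mono_AE L2_scale L2_wgt) (auto simp: norm_mult L2_iff)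
  also have "L2norm (\<lambda>t. of_real C * of_real (wgt t)) = C * L2norm (\<lambda>x. of_real (wgt x))"
    using C by (simp add: L2norm_scale)
  finally show ?thesis by (simp add: inner_L_def mult_ac)
qed

section \<open>The Paley-Wiener space in L^2\<close>

lemma PW2_iff: "PW c 2 f \<longleftrightarrow> L2 f \<and> band_lim c f"
  by (simp add: PW_def band_lim_def)

lemma PW2_L2: "PW c 2 f \<Longrightarrow> L2 f"
  by (simp add: PW2_iff)

lemma PW2_add: "PW c 2 f \<Longrightarrow> PW c 2 g \<Longrightarrow> PW c 2 (\<lambda>x. f x + z * g x)"
  by (simp add: PW2_iff L2_add L2_scale band_lim_add L2_mem_wgt)

lemma PW2_sum: "(\<And>i. i \<in> I \<Longrightarrow> PW c 2 (f i)) \<Longrightarrow> PW c 2 (\<lambda>x. \<Sum>i\<in>I. z i * f i x)"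
proof (induction I rule: infinite_finite_induct)
  case (insert i I)
  then show ?case using PW2_add[of c "\<lambda>x. \<Sum>i\<in>I. z i * f i x" "f i" "z i"] by (simp add: add.commute)
qed (auto simp: PW2_iff L2_zero band_lim_def)

lemma PW2_ker: "c > 0 \<Longrightarrow> PW c 2 (\<lambda>t. of_real (ker c (x - t)))"
  by (simp add: PW2_iff L2_ker band_lim_ker)

lemma PW2_reproducing: "c > 0 \<Longrightarrow> PW c 2 f \<Longrightarrow> AE x in lebesgue. f x = Pc c f x"
  by (simp add: PW2_iff reproducing L2_mem_wgt)

section \<open>Taylor polynomials and extrapolation\<close>

lemma cis_taylor_bound: "cmod (cis y - (\<Sum>k<n. (\<i> * of_real y) ^ k / fact k)) \<le> \<bar>y\<bar> ^ n / fact n"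
proof (cases n)
  case (Suc m)
  then show ?thesis using iexp_approx1[of y m] by (simp add: lessThan_Suc_atMost cis_conv_exp)
qed simp

lemma taylor_poly_deriv:
  "((\<lambda>w. \<Sum>k<Suc n. (\<i> * of_real (y * w)) ^ k / fact k) has_vector_derivative
     \<i> * of_real y * (\<Sum>k<n. (\<i> * of_real (y * w)) ^ k / fact k)) (at w within S)"
proof (induction n)
  case (Suc n)
  have 1: "((\<lambda>w. \<i> * of_real (y * w)) has_vector_derivative \<i> * of_real y) (at w within S)"
    by (auto intro!: derivative_eq_intros simp: has_vector_derivative_def scaleR_conv_of_real)
  have "((\<lambda>z::complex. z ^ Suc n / fact (Suc n)) has_field_derivative (of_nat (Suc n) * z ^ n) / fact (Suc n)) (at z)" for z
    by (auto intro!: derivative_eq_intros simp del: power_Suc fact_Suc of_nat_Suc)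
  moreover have "(of_nat (Suc n) * z ^ n) / fact (Suc n) = z ^ n / fact n" for z :: complex
    by (simp add: divide_simps del: of_nat_Suc)
  ultimately have 2: "((\<lambda>z::complex. z ^ Suc n / fact (Suc n)) has_field_derivative z ^ n / fact n) (at z)" for z
    by metis
  have "((\<lambda>w. (\<i> * of_real (y * w)) ^ Suc n / fact (Suc n)) has_vector_derivative
      \<i> * of_real y * ((\<i> * of_real (y * w)) ^ n / fact n)) (at w within S)"
    using field_vector_diff_chain_within[OF 1 has_field_derivative_at_within[OF 2]]
    by (simp only: o_def)
  from has_vector_derivative_add[OF Suc this] show ?case
    by (simp add: distrib_left)
qed simp

text \<open>The coefficient of x^j when exp (2 * pi * i * x * w) is expanded under the frequency
  integral representing \<open>ker c (x - t)\<close>.\<close>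

definition taylor_ker :: "real \<Rightarrow> nat \<Rightarrow> real \<Rightarrow> complex" where
  "taylor_ker c j t = integral {-c..c} (\<lambda>w. (2 * of_real pi * \<i> * of_real w) ^ j / fact j * cis (- 2 * pi * w * t))"

text \<open>For f in L^2, the j-th Taylor coefficient of \<open>Pc c f\<close> at 0.\<close>

definition taylor_coeff :: "real \<Rightarrow> nat \<Rightarrow> (real \<Rightarrow> complex) \<Rightarrow> complex" where
  "taylor_coeff c j f = (\<integral>t. f t * taylor_ker c j t \<partial>lebesgue)"

lemma interval_transform_measurable:
  fixes F :: "real \<Rightarrow> complex"
  assumes "continuous_on UNIV F"
  shows "lmeas (\<lambda>t. integral {-c..c} (\<lambda>w. F w * cis (- 2 * pi * w * t)))"
proof -
  have [measurable]: "F \<in> borel_measurable borel" by (intro borel_measurable_continuous_onI assms)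
  have "integral {-c..c} (\<lambda>w. F w * cis (- 2 * pi * w * t)) = fourier (\<lambda>w. indicator {-c..c} w * F w) t" for t
  proof -
    have "(\<lambda>w. F w * cis (- 2 * pi * w * t)) absolutely_integrable_on {-c..c}"
      by (intro absolutely_integrable_continuous_real continuous_intros continuous_on_subset[OF assms]) auto
    from set_lebesgue_integral_eq_integral(2)[OF this] show ?thesis
      by (simp add: set_lebesgue_integral_def fourier_def scaleR_conv_of_real of_real_indicator mult_ac)
  qed
  moreover have "lmeas (fourier (\<lambda>w. indicator {-c..c} w * F w))"
    by (intro borel_measurable_lebesgueI fourier_measurable) measurable
  ultimately show ?thesis by simp
qed

lemma L2_taylor_ker:
  assumes "c \<ge> 0" shows "L2 (taylor_ker c j)"
proof -
  define F where "F w = (2 * of_real pi * \<i> * of_real w) ^ j / fact j" for w :: real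
  define F' where "F' w = of_nat j * (2 * of_real pi * \<i> * of_real w) ^ (j - 1) * (2 * of_real pi * \<i>) / fact j" for w :: real
  have D: "(F has_vector_derivative F' w) (at w within S)" for w S
  proof -
    have 1: "((\<lambda>w. 2 * of_real pi * \<i> * of_real w) has_vector_derivative 2 * of_real pi * \<i>) (at w within S)"
      by (auto intro!: derivative_eq_intros simp: has_vector_derivative_def scaleR_conv_of_real)
    have "((\<lambda>z::complex. z ^ j / fact j) has_field_derivative of_nat j * z ^ (j - 1) / fact j) (at z within T)" for z T
      by (auto intro!: derivative_eq_intros)
    from field_vector_diff_chain_within[OF 1 this] show ?thesis
      by (simp add: F_def[abs_def] F'_def o_def mult_ac)
  qed
  have "continuous_on {-c..c} F" "continuous_on {-c..c} F'"
    unfolding F_def F'_def by (intro continuous_intros; simp)+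
  then have "bounded (F ` {-c..c})" "bounded (F' ` {-c..c})"
    by (intro compact_imp_bounded compact_continuous_image; simp)+
  then obtain M M' where M: "\<And>x. x \<in> {-c..c} \<Longrightarrow> norm (F x) \<le> M" "\<And>x. x \<in> {-c..c} \<Longrightarrow> norm (F' x) \<le> M'"
    unfolding bounded_iff by (metis imageI)
  have "L2 (\<lambda>t. integral {-c..c} (\<lambda>w. F w * cis (- 2 * pi * w * t)))"
  proof (rule L2_wgt_bound[OF interval_transform_measurable fourier_interval_bound])
    show "continuous_on UNIV F" unfolding F_def by (intro continuous_intros) simp
  qed (use assms D M in auto)
  then show ?thesis by (simp add: taylor_ker_def[abs_def] F_def)
qed

text \<open>The remainder of the exponential is treated as a function of the frequency w, so that
  \<open>fourier_interval_bound\<close> yields the factor \<open>wgt t\<close> and the error is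
  square-integrable in t. Differentiating the remainder in w costs a factor 2 * pi * A and one
  order, hence the second summand with m in place of m + 1.\<close>

lemma ker_taylor:
  assumes "c \<ge> 0" "\<bar>x\<bar> \<le> A"
  shows "cmod (of_real (ker c (x - t)) - (\<Sum>j\<le>m. of_real x ^ j * taylor_ker c j t))
    \<le> (2 * c + 1) * ((2 * pi * c * A) ^ Suc m / fact (Suc m) + 2 * pi * A * ((2 * pi * c * A) ^ m / fact m)) * wgt t"
proof -
  let ?e = "\<lambda>w. cis (- 2 * pi * w * t)"
  let ?T = "\<lambda>n w. \<Sum>k<n. (\<i> * of_real ((2 * pi * x) * w)) ^ k / fact k"
  let ?F = "\<lambda>w. cis (2 * pi * x * w) - ?T (Suc m) w"
  let ?F' = "\<lambda>w. \<i> * of_real (2 * pi * x) * (cis (2 * pi * x * w) - ?T m w)"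
  have A: "0 \<le> A" using assms by linarith
  have "((\<lambda>w. cis (- 2 * pi * w * (t - x))) has_integral of_real (ker c (t - x))) {-c..c}"
    by (rule has_integral_cis_ker[OF assms(1)])
  moreover have "cis (- 2 * pi * w * (t - x)) = cis (2 * pi * x * w) * ?e w" for w
    by (simp add: cis_mult algebra_simps)
  ultimately have 1: "((\<lambda>w. cis (2 * pi * x * w) * ?e w) has_integral of_real (ker c (x - t))) {-c..c}"
    by (simp add: ker_commute)
  have 2: "((\<lambda>w. of_real x ^ j * ((2 * of_real pi * \<i> * of_real w) ^ j / fact j * ?e w)) has_integral
     of_real x ^ j * taylor_ker c j t) {-c..c}" for j
    unfolding taylor_ker_def
    by (intro has_integral_mult_right integrable_integral integrable_continuous_real continuous_intros) auto
  have "((\<lambda>w. cis (2 * pi * x * w) * ?e w - (\<Sum>j\<le>m. of_real x ^ j * ((2 * of_real pi * \<i> * of_real w) ^ j / fact j * ?e w)))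
     has_integral of_real (ker c (x - t)) - (\<Sum>j\<le>m. of_real x ^ j * taylor_ker c j t)) {-c..c}"
    by (intro has_integral_diff 1 has_integral_sum 2) auto
  moreover have "cis (2 * pi * x * w) * ?e w - (\<Sum>j\<le>m. of_real x ^ j * ((2 * of_real pi * \<i> * of_real w) ^ j / fact j * ?e w))
     = ?F w * ?e w" for w
    by (simp add: left_diff_distrib sum_distrib_right lessThan_Suc_atMost power_mult_distrib) (simp add: mult_ac)
  ultimately have "of_real (ker c (x - t)) - (\<Sum>j\<le>m. of_real x ^ j * taylor_ker c j t) = integral {-c..c} (\<lambda>w. ?F w * ?e w)"
    by (simp only: integral_unique)
  moreover have "cmod (integral {-c..c} (\<lambda>w. ?F w * ?e w))
     \<le> (2 * c + 1) * ((2 * pi * c * A) ^ Suc m / fact (Suc m) + 2 * pi * A * ((2 * pi * c * A) ^ m / fact m)) * wgt t"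
  proof (rule fourier_interval_bound[where F' = ?F', OF assms(1)])
    fix w assume w: "w \<in> {-c..c}"
    have "(?F has_vector_derivative \<i> * of_real (2 * pi * x) * cis (2 * pi * x * w) - \<i> * of_real (2 * pi * x) * ?T m w) (at w within {-c..c})"
    proof (rule has_vector_derivative_diff[OF _ taylor_poly_deriv])
      show "((\<lambda>w. cis (2 * pi * x * w)) has_vector_derivative \<i> * of_real (2 * pi * x) * cis (2 * pi * x * w)) (at w within {-c..c})"
        using cis_deriv[of "-x" w "{-c..c}"] by (simp add: mult_ac)
    qed
    then show "(?F has_vector_derivative ?F' w) (at w within {-c..c})" by (simp only: right_diff_distrib)
    have y: "\<bar>2 * pi * x * w\<bar> \<le> 2 * pi * c * A"
    proof -
      have "\<bar>x\<bar> * \<bar>w\<bar> \<le> A * c" using assms w A by (intro mult_mono) auto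
      then show ?thesis by (simp add: abs_mult mult_ac)
    qed
    have b: "cmod (cis (2 * pi * x * w) - ?T n w) \<le> (2 * pi * c * A) ^ n / fact n" for n
    proof -
      have "cmod (cis (2 * pi * x * w) - ?T n w) \<le> \<bar>2 * pi * x * w\<bar> ^ n / fact n" by (rule cis_taylor_bound)
      also have "\<dots> \<le> (2 * pi * c * A) ^ n / fact n" using y by (intro divide_right_mono power_mono) auto
      finally show ?thesis .
    qed
    show "cmod (?F w) \<le> (2 * pi * c * A) ^ Suc m / fact (Suc m)" by (rule b)
    have "cmod (?F' w) = 2 * pi * \<bar>x\<bar> * cmod (cis (2 * pi * x * w) - ?T m w)"
      by (simp only: norm_mult norm_of_real norm_ii abs_mult) simp
    also have "\<dots> \<le> 2 * pi * A * ((2 * pi * c * A) ^ m / fact m)"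
      using assms(2) A b[of m] by (intro mult_mono) auto
    finally show "cmod (?F' w) \<le> 2 * pi * A * ((2 * pi * c * A) ^ m / fact m)" .
  qed
  ultimately show ?thesis by simp
qed

text \<open>Cauchy-Schwarz applied to the kernel error. The orders m and m + 1 are merged through
  q^(m+1) / (m+1)! \<le> q * q^m / m!, which keeps C free of m.\<close>

lemma Pc_taylor:
  assumes "c > 0" "A \<ge> 0"
  obtains C where "C \<ge> 0" "\<And>f m x. L2 f \<Longrightarrow> \<bar>x\<bar> \<le> A \<Longrightarrow>
    cmod (Pc c f x - (\<Sum>j\<le>m. taylor_coeff c j f * of_real x ^ j)) \<le> C * ((2 * pi * c * A) ^ m / fact m) * L2norm f"
proof -
  define q where "q = 2 * pi * c * A"
  have q: "q \<ge> 0" using assms by (simp add: q_def)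
  define W where "W = L2norm (\<lambda>x. of_real (wgt x))"
  define C where "C = (2 * c + 1) * (q + 2 * pi * A) * W"
  show thesis
  proof (rule that[of C])
    show "C \<ge> 0" using assms q by (simp add: C_def W_def)
    fix f m x assume f: "L2 f" and x: "\<bar>x\<bar> \<le> A"
    let ?r = "\<lambda>t. of_real (ker c (x - t)) - (\<Sum>j\<le>m. of_real x ^ j * taylor_ker c j t)"
    have i: "integrable lebesgue (\<lambda>t. f t * taylor_ker c j t)" for j
      using assms by (intro L2_mult_integrable f L2_taylor_ker) simp
    have ik: "integrable lebesgue (\<lambda>t. f t * of_real (ker c (x - t)))"
      using assms by (intro L2_mult_integrable f L2_ker) simp
    have eq: "Pc c f x - (\<Sum>j\<le>m. taylor_coeff c j f * of_real x ^ j) = (\<integral>t. f t * ?r t \<partial>lebesgue)"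
    proof -
      have "(\<integral>t. f t * ?r t \<partial>lebesgue) = (\<integral>t. f t * of_real (ker c (x - t)) - (\<Sum>j\<le>m. of_real x ^ j * (f t * taylor_ker c j t)) \<partial>lebesgue)"
        by (simp add: right_diff_distrib sum_distrib_left mult_ac)
      also have "\<dots> = Pc c f x - (\<Sum>j\<le>m. of_real x ^ j * taylor_coeff c j f)"
        using i ik by (simp add: Pc_eq_ker[OF L2_measurable[OF f]] taylor_coeff_def)
      finally show ?thesis by (simp add: mult.commute)
    qed
    have "cmod (\<integral>t. f t * ?r t \<partial>lebesgue) \<le>
       ((2 * c + 1) * (q ^ Suc m / fact (Suc m) + 2 * pi * A * (q ^ m / fact m))) * W * L2norm f"
      unfolding W_def
    proof (rule L2_integral_wgt_bound[OF f])
      show "lmeas ?r"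
        using assms by (intro borel_measurable_diff borel_measurable_sum borel_measurable_times ker_translate_measurable
            L2_measurable[OF L2_taylor_ker]) auto
      show "cmod (?r t) \<le> (2 * c + 1) * (q ^ Suc m / fact (Suc m) + 2 * pi * A * (q ^ m / fact m)) * wgt t" for t
        unfolding q_def using assms x by (intro ker_taylor) auto
    qed
    also have "\<dots> \<le> ((2 * c + 1) * (q * (q ^ m / fact m) + 2 * pi * A * (q ^ m / fact m))) * W * L2norm f"
    proof (intro mult_right_mono mult_left_mono add_mono)
      have "q ^ Suc m / fact (Suc m) = q * (q ^ m / fact m) / real (Suc m)"
        by (simp add: field_simps)
      also have "\<dots> \<le> q * (q ^ m / fact m) / 1"
        using q by (intro divide_left_mono) auto
      finally show "q ^ Suc m / fact (Suc m) \<le> q * (q ^ m / fact m)" by simp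
    qed (use assms q in \<open>auto simp: W_def\<close>)
    also have "\<dots> = C * (q ^ m / fact m) * L2norm f" by (simp add: C_def algebra_simps add_divide_distrib)
    finally show "cmod (Pc c f x - (\<Sum>j\<le>m. taylor_coeff c j f * of_real x ^ j)) \<le> C * ((2 * pi * c * A) ^ m / fact m) * L2norm f"
      by (simp add: eq q_def)
  qed
qed

section \<open>Lagrange extrapolation of polynomials\<close>

lemma Lagrange_interpolation:
  fixes p :: "'a::field poly" and t :: "nat \<Rightarrow> 'a"
  assumes "degree p \<le> m" and inj: "inj_on t {..m}"
  shows "poly p x = (\<Sum>j\<le>m. poly p (t j) * (\<Prod>i\<in>{..m} - {j}. (x - t i) / (t j - t i)))"
proof -
  define L where "L j = (\<Prod>i\<in>{..m} - {j}. smult (1 / (t j - t i)) [:- t i, 1:])" for j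
  define q where "q = p - (\<Sum>j\<le>m. smult (poly p (t j)) (L j))"
  have L: "poly (L j) x = (\<Prod>i\<in>{..m} - {j}. (x - t i) / (t j - t i))" for j x
    by (simp add: L_def poly_prod diff_divide_distrib)
  have dL: "degree (L j) \<le> m" if "j \<le> m" for j
  proof -
    have "degree (L j) \<le> (\<Sum>i\<in>{..m} - {j}. 1)"
      unfolding L_def by (intro order_trans[OF degree_prod_sum_le] sum_mono) (auto intro: order_trans[OF degree_smult_le])
    then show ?thesis using that by simp
  qed
  have dq: "degree q \<le> m"
    unfolding q_def using assms(1) dL
    by (intro degree_diff_le degree_sum_le) (auto intro: order_trans[OF degree_smult_le])
  have Lt: "poly (L j) (t k) = (if j = k then 1 else 0)" if "j \<le> m" "k \<le> m" for j k
  proof (cases "j = k")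
    case True
    have "(t k - t i) / (t k - t i) = 1" if "i \<in> {..m} - {k}" for i
      using inj_onD[OF inj, of k i] that \<open>k \<le> m\<close> by auto
    then show ?thesis using True by (simp add: L)
  next
    case False
    have "(\<Prod>i\<in>{..m} - {j}. (t k - t i) / (t j - t i)) = 0"
      using False that by (intro prod_zero bexI[of _ k]) auto
    then show ?thesis using False by (simp add: L)
  qed
  have root: "poly q (t k) = 0" if "k \<le> m" for k
  proof -
    have "(\<Sum>j\<le>m. poly p (t j) * poly (L j) (t k)) = (\<Sum>j\<le>m. if j = k then poly p (t k) else 0)"
      using that Lt by (intro sum.cong) auto
    then show ?thesis using that by (simp add: q_def poly_sum)
  qed
  have "q = 0"
  proof (rule ccontr)
    assume "q \<noteq> 0"
    then have "card {x. poly q x = 0} \<le> m" "finite {x. poly q x = 0}"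
      using card_poly_roots_bound[of q] poly_roots_finite[of q] dq by linarith+
    moreover have "card (t ` {..m}) = Suc m" using inj by (simp add: card_image)
    moreover have "t ` {..m} \<subseteq> {x. poly q x = 0}" using root by auto
    ultimately show False using card_mono[of "{x. poly q x = 0}" "t ` {..m}"] by simp
  qed
  then have "poly p x = poly (\<Sum>j\<le>m. smult (poly p (t j)) (L j)) x" by (simp add: q_def)
  then show ?thesis by (simp add: poly_sum L)
qed

lemma prod_abs_diff:
  fixes j m :: nat
  assumes "j \<le> m" shows "(\<Prod>i\<in>{..m} - {j}. \<bar>real j - real i\<bar>) = fact j * fact (m - j)"
proof -
  have e: "{..m} - {j} = {..<j} \<union> {j<..m}" using assms by auto
  have "(\<Prod>i\<in>{..m} - {j}. \<bar>real j - real i\<bar>) = (\<Prod>i<j. \<bar>real j - real i\<bar>) * (\<Prod>i\<in>{j<..m}. \<bar>real j - real i\<bar>)"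
    unfolding e by (rule prod.union_disjoint) auto
  also have "(\<Prod>i<j. \<bar>real j - real i\<bar>) = (\<Prod>i<j. real (Suc i))"
    by (rule prod.reindex_bij_witness[of _ "\<lambda>i. j - Suc i" "\<lambda>i. j - Suc i"]) (auto simp: of_nat_diff)
  also have "\<dots> = fact j" by (simp add: fact_prod_Suc atLeast0LessThan)
  also have "(\<Prod>i\<in>{j<..m}. \<bar>real j - real i\<bar>) = (\<Prod>i<m - j. real (Suc i))"
    by (rule prod.reindex_bij_witness[of _ "\<lambda>i. Suc (i + j)" "\<lambda>i. i - Suc j"]) (auto simp: of_nat_diff)
  also have "\<dots> = fact (m - j)" by (simp add: fact_prod_Suc atLeast0LessThan)
  finally show ?thesis .
qed

lemma power_div_fact_le_exp: "0 \<le> (x::real) \<Longrightarrow> x ^ n / fact n \<le> exp x"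
proof -
  assume x: "0 \<le> x"
  have "(\<Sum>k\<in>{n}. x ^ k /\<^sub>R fact k) \<le> exp x"
    unfolding exp_def using x by (intro sum_le_suminf summable_exp_generic) auto
  then show ?thesis by (simp add: divide_inverse mult.commute)
qed

text \<open>The nodes lie in every second cell of the grid of mesh 1/K on [0,1], K = 2 * (m + 1).
  The skipped cells keep them |j - i| / K apart while each node stays free within its cell, which
  matters because f is controlled only on average. The Lagrange basis is then at most ((A+1) * K)^m
  / (j! * (m-j)!), the reciprocal factorials sum to 2^m / m!, and (m+1)^m / m! \<le> exp (m+1)
  leaves a geometric loss.\<close>

lemma poly_extrapolation:
  fixes p :: "complex poly" and t :: "nat \<Rightarrow> real"
  assumes p: "degree p \<le> m" and A: "A \<ge> 1" and x: "\<bar>x\<bar> \<le> A"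
    and t: "\<And>j. j \<le> m \<Longrightarrow> real (2 * j) / real (2 * Suc m) < t j \<and> t j < real (2 * j + 1) / real (2 * Suc m)"
    and e: "\<And>j. j \<le> m \<Longrightarrow> cmod (poly p (of_real (t j))) \<le> e"
  shows "cmod (poly p (of_real x)) \<le> exp 1 * (4 * exp 1 * (A + 1)) ^ m * e"
proof -
  define K where "K = real (2 * Suc m)"
  have K: "K > 0" by (simp add: K_def)
  have e0: "0 \<le> e" using order_trans[OF norm_ge_zero e[of 0]] by simp
  have tb: "2 * real j < K * t j" "K * t j < 2 * real j + 1" if "j \<le> m" for j
    using t[OF that] K unfolding K_def[symmetric] by (auto simp: field_simps)
  have sep: "\<bar>real j - real i\<bar> / K \<le> \<bar>t j - t i\<bar>" if "j \<le> m" "i \<le> m" for i j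
  proof (cases "i = j")
    case False
    have "\<bar>real j - real i\<bar> \<le> \<bar>K * t j - K * t i\<bar>"
    proof (cases "i < j")
      case True
      then have "real i + 1 \<le> real j" by linarith
      then show ?thesis using tb[OF that(1)] tb[OF that(2)] by linarith
    next
      case False
      then have "real j + 1 \<le> real i" using \<open>i \<noteq> j\<close> by linarith
      then show ?thesis using tb[OF that(1)] tb[OF that(2)] by linarith
    qed
    also have "\<dots> = K * \<bar>t j - t i\<bar>" using K by (simp add: abs_mult right_diff_distrib[symmetric])
    finally show ?thesis using K by (simp add: field_simps)
  qed simp
  have pos: "0 < \<bar>real j - real i\<bar> / K" if "i \<in> {..m} - {j}" for i j using that K by auto
  have inj: "inj_on (\<lambda>j. complex_of_real (t j)) {..m}"
  proof (rule inj_onI)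
    fix i j assume "i \<in> {..m}" "j \<in> {..m}" "complex_of_real (t i) = complex_of_real (t j)"
    then show "i = j" using sep[of j i] pos[of i j] by fastforce
  qed
  have t01: "\<bar>t i\<bar> \<le> 1" if "i \<le> m" for i
  proof -
    have "K = 2 * real m + 2" "real i \<le> real m" using that by (simp_all add: K_def)
    then have "K * t i < K" using tb(2)[OF that] by linarith
    moreover have "0 < K * t i" using tb(1)[OF that] by (smt (verit) of_nat_0_le_iff)
    ultimately show ?thesis using K by (simp add: zero_less_mult_iff)
  qed
  have l: "(\<Prod>i\<in>{..m} - {j}. \<bar>x - t i\<bar> / \<bar>t j - t i\<bar>) \<le> ((A + 1) * K) ^ m / (fact j * fact (m - j))" if "j \<le> m" for j
  proof -
    have "(\<Prod>i\<in>{..m} - {j}. \<bar>x - t i\<bar> / \<bar>t j - t i\<bar>) \<le> (\<Prod>i\<in>{..m} - {j}. ((A + 1) * K) / \<bar>real j - real i\<bar>)"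
    proof (rule prod_mono)
      fix i assume i: "i \<in> {..m} - {j}"
      have "\<bar>x - t i\<bar> / \<bar>t j - t i\<bar> \<le> (A + 1) / (\<bar>real j - real i\<bar> / K)"
        using x t01[of i] sep[OF that, of i] pos[OF i] i A by (intro frac_le) auto
      then show "0 \<le> \<bar>x - t i\<bar> / \<bar>t j - t i\<bar> \<and> \<bar>x - t i\<bar> / \<bar>t j - t i\<bar> \<le> ((A + 1) * K) / \<bar>real j - real i\<bar>"
        by simp
    qed
    also have "\<dots> = ((A + 1) * K) ^ m / (fact j * fact (m - j))"
      using that by (simp add: prod_dividef prod_abs_diff)
    finally show ?thesis .
  qed
  have "cmod (poly p (of_real x)) \<le> (\<Sum>j\<le>m. cmod (poly p (of_real (t j)) * (\<Prod>i\<in>{..m} - {j}. (of_real x - of_real (t i)) / (of_real (t j) - of_real (t i)))))"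
    unfolding Lagrange_interpolation[OF p inj, of "of_real x"] by (rule norm_sum)
  also have "\<dots> \<le> (\<Sum>j\<le>m. e * (((A + 1) * K) ^ m / (fact j * fact (m - j))))"
  proof (rule sum_mono)
    fix j assume j: "j \<in> {..m}"
    have "cmod (\<Prod>i\<in>{..m} - {j}. (of_real x - of_real (t i)) / (of_real (t j) - of_real (t i))) = (\<Prod>i\<in>{..m} - {j}. \<bar>x - t i\<bar> / \<bar>t j - t i\<bar>)"
      by (simp only: prod_norm[symmetric] norm_divide of_real_diff[symmetric] norm_of_real)
    then show "cmod (poly p (of_real (t j)) * (\<Prod>i\<in>{..m} - {j}. (of_real x - of_real (t i)) / (of_real (t j) - of_real (t i))))
      \<le> e * (((A + 1) * K) ^ m / (fact j * fact (m - j)))"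
      unfolding norm_mult using e[of j] l[of j] j e0 by (simp only:) (intro mult_mono prod_nonneg; simp)
  qed
  also have "\<dots> = e * ((A + 1) * K) ^ m * (\<Sum>j\<le>m. 1 / (fact j * fact (m - j)))"
    by (simp add: sum_distrib_left)
  also have "(\<Sum>j\<le>m. 1 / (fact j * fact (m - j))) = (2::real) ^ m / fact m"
  proof -
    have "(\<Sum>j\<le>m. 1 / (fact j * fact (m - j))) = (\<Sum>j\<le>m. real (m choose j) / fact m)"
      by (intro sum.cong refl) (simp add: binomial_fact)
    also have "\<dots> = (2::real) ^ m / fact m"
      using choose_row_sum[of m] by (simp add: sum_divide_distrib[symmetric] of_nat_sum[symmetric] del: of_nat_sum)
    finally show ?thesis .
  qed
  also have "e * ((A + 1) * K) ^ m * (2 ^ m / fact m) = e * (4 * (A + 1)) ^ m * (real (Suc m) ^ m / fact m)"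
  proof -
    have "((A + 1) * K) * 2 = (4 * (A + 1)) * real (Suc m)" by (simp add: K_def algebra_simps)
    then have "((A + 1) * K) ^ m * 2 ^ m = (4 * (A + 1)) ^ m * real (Suc m) ^ m"
      by (simp only: power_mult_distrib[symmetric])
    then show ?thesis by (simp only: times_divide_eq_right mult.assoc)
  qed
  also have "\<dots> \<le> e * (4 * (A + 1)) ^ m * exp (real (Suc m))"
    using e0 A by (intro mult_left_mono power_div_fact_le_exp mult_nonneg_nonneg) auto
  also have "exp (real (Suc m)) = exp 1 * exp 1 ^ m"
    by (simp add: exp_add exp_of_nat_mult[symmetric])
  finally show ?thesis by (simp add: power_mult_distrib mult_ac)
qed

section \<open>From concentration on (-1,1) to pointwise bounds\<close>

text \<open>Cutting off by zero makes the numerator of \<open>conc_ratio\<close> an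
  \<open>L2norm\<close> over the whole line, so the same Hilbert space lemmas serve both
  norms.\<close>

definition rst :: "(real \<Rightarrow> complex) \<Rightarrow> real \<Rightarrow> complex" where
  "rst f x = indicator {-1<..<1} x * f x"

lemma rst_L2: "L2 f \<Longrightarrow> L2 (rst f)"
proof (rule L2_bound)
  assume "L2 f"
  then show "lmeas (rst f)"
    unfolding rst_def[abs_def]
    by (intro borel_measurable_times[OF borel_measurable_lebesgueI]) (auto simp: L2_iff)
qed (auto simp: rst_def indicator_def)

lemma L2norm_rst_le: "L2 f \<Longrightarrow> L2norm (rst f) \<le> L2norm f"
  by (rule L2norm_mono_AE) (auto simp: rst_L2 L2_measurable rst_def indicator_def)

lemma rst_add: "rst (\<lambda>x. f x + z * g x) = (\<lambda>x. rst f x + z * rst g x)"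
  by (auto simp: rst_def indicator_def)

lemma L2norm_on_rst: "L2norm_on {-1<..<1} f = L2norm (rst f)"
  unfolding L2norm_on_def L2norm_def set_lebesgue_integral_def
  by (rule arg_cong[where f = sqrt], rule Bochner_Integration.integral_cong) (auto simp: rst_def indicator_def)

text \<open>If h exceeded its mean at every t with P, the function u below would be nonnegative with
  integral 0, yet positive almost everywhere on (a,b). P lets the point be chosen where f equals
  \<open>Pc c f\<close>.\<close>

lemma exists_le_average:
  fixes h :: "real \<Rightarrow> real"
  assumes ab: "a < b" and h: "integrable lebesgue (\<lambda>x. indicator {a<..<b} x * h x)" and P: "AE x in lebesgue. P x"
  shows "\<exists>t. a < t \<and> t < b \<and> P t \<and> h t * (b - a) \<le> (\<integral>x. indicator {a<..<b} x * h x \<partial>lebesgue)"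
proof (rule ccontr)
  assume neg: "\<not> ?thesis"
  define I where "I = (\<integral>x. indicator {a<..<b} x * h x \<partial>lebesgue)"
  define u where "u t = (indicator {a<..<b} t * h t) * (b - a) - indicator {a<..<b} t * I" for t
  have ind: "integrable lebesgue (indicat_real {a<..<b})" using ab by (intro integrable_real_indicator) auto
  have u: "integrable lebesgue u" unfolding u_def using h ind by auto
  have "(\<integral>t. u t \<partial>lebesgue) = I * (b - a) - (b - a) * I"
    unfolding u_def using h ind ab by (simp add: I_def)
  then have "(\<integral>t. u t \<partial>lebesgue) = 0" by simp
  moreover have pos: "AE t in lebesgue. t \<in> {a<..<b} \<longrightarrow> I < h t * (b - a)"
    using P by eventually_elim (use neg in \<open>auto simp: I_def not_le\<close>)
  moreover have "AE t in lebesgue. 0 \<le> u t"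
    using pos by eventually_elim (auto simp: u_def indicator_def)
  ultimately have "AE t in lebesgue. u t = 0"
    using integral_nonneg_eq_0_iff_AE[OF u] by simp
  with pos have "AE t in lebesgue. t \<notin> {a<..<b}"
    by eventually_elim (auto simp: u_def)
  then have "{a<..<b} \<in> null_sets lebesgue"
    by (subst AE_iff_null_sets) auto
  then show False using ab by (auto simp: null_sets_def)
qed

text \<open>\<open>Pc c f\<close> is replaced by its Taylor polynomial of degree m. The values at
  nodes in (0,1) are bounded by the L^2 norm on (-1,1) up to the Taylor error, and the polynomial is
  extrapolated to [-A,A]. The degree stays free: D^m is the price of extrapolation, q^m / m! the
  gain.\<close>

lemma PW_extrapolation:
  assumes c: "c > 0" and A: "A \<ge> 1"
  obtains C D q where "C \<ge> 0" "D \<ge> 2" "q \<ge> 0"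
    "\<And>f m x. PW c 2 f \<Longrightarrow> \<bar>x\<bar> \<le> A \<Longrightarrow> cmod (Pc c f x) \<le> C * D ^ m * (L2norm (rst f) + q ^ m / fact m * L2norm f)"
proof -
  define q where "q = 2 * pi * c * A"
  obtain C where C: "C \<ge> 0" "\<And>f m x. L2 f \<Longrightarrow> \<bar>x\<bar> \<le> A \<Longrightarrow>
    cmod (Pc c f x - (\<Sum>j\<le>m. taylor_coeff c j f * of_real x ^ j)) \<le> C * (q ^ m / fact m) * L2norm f"
    unfolding q_def using A by (rule_tac Pc_taylor[OF c, of A]) (auto intro: that)
  have q: "q \<ge> 0" using c A by (simp add: q_def)
  define D where "D = 4 * exp 1 * (A + 1)"
  have e1: "exp (1::real) \<ge> 1" by simp
  have D: "D \<ge> 8"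
    unfolding D_def using mult_mono[of 4 "4 * exp (1::real)" 2 "A + 1"] e1 A by auto
  show thesis
  \<comment> \<open>Doubling D absorbs the factor K = 2 * (m + 1), which is at most 2 * 2^m.\<close>
  proof (rule that[of "2 * exp 1 * (C + 1) + C" "2 * D" q])
    fix f m x assume f: "PW c 2 f" and x: "\<bar>x\<bar> \<le> A"
    have f2: "L2 f" by (rule PW2_L2[OF f])
    define N where "N = L2norm f"
    define d where "d = L2norm (rst f)"
    define E where "E = q ^ m / fact m"
    have nn: "N \<ge> 0" "d \<ge> 0" "E \<ge> 0" using q by (auto simp: N_def d_def E_def)
    define p where "p = (\<Sum>j\<le>m. monom (taylor_coeff c j f) j)"
    have pv: "poly p (of_real y) = (\<Sum>j\<le>m. taylor_coeff c j f * of_real y ^ j)" for y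
      by (simp add: p_def poly_sum poly_monom)
    have dp: "degree p \<le> m"
      unfolding p_def by (intro degree_sum_le) (auto intro: order_trans[OF degree_monom_le])
    have err: "cmod (Pc c f y - poly p (of_real y)) \<le> C * E * N" if "\<bar>y\<bar> \<le> A" for y
      using C(2)[OF f2 that, of m] by (simp add: pv E_def N_def)
    define K where "K = real (2 * Suc m)"
    have K: "K > 0" by (simp add: K_def)
    have "\<exists>t. real (2 * j) / K < t \<and> t < real (2 * j + 1) / K \<and> f t = Pc c f t \<and> (cmod (f t))^2 \<le> K * d^2" if j: "j \<le> m" for j
    proof -
      let ?a = "real (2 * j) / K" and ?b = "real (2 * j + 1) / K"
      have sub: "{?a<..<?b} \<subseteq> {-1<..<1}"
      proof -
        have "?b \<le> 1" "0 \<le> ?a" using K j by (auto simp: K_def)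
        then show ?thesis by auto
      qed
      have ba: "?b - ?a = 1 / K" by (simp add: diff_divide_distrib[symmetric])
      have i: "integrable lebesgue (\<lambda>x. indicator {?a<..<?b} x * (cmod (f x))^2)"
        using integrable_mult_indicator[of "{?a<..<?b}" lebesgue "\<lambda>x. (cmod (f x))^2"] f2 by (simp add: L2_iff)
      have i2: "integrable lebesgue (\<lambda>x. (cmod (rst f x))^2)" using rst_L2[OF f2] by (simp add: L2_iff)
      have "?a < ?b" using K by (simp add: divide_strict_right_mono)
      from exists_le_average[OF this i PW2_reproducing[OF c f]]
      obtain t where t: "?a < t" "t < ?b" "f t = Pc c f t"
        "(cmod (f t))^2 * (1 / K) \<le> (\<integral>x. indicator {?a<..<?b} x * (cmod (f x))^2 \<partial>lebesgue)" unfolding ba by blast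
      note t(4)
      also have "(\<integral>x. indicator {?a<..<?b} x * (cmod (f x))^2 \<partial>lebesgue) \<le> d^2"
        unfolding d_def L2norm_sq by (rule integral_mono[OF i i2]) (use sub in \<open>auto simp: rst_def indicator_def\<close>)
      finally have "(cmod (f t))^2 \<le> K * d^2" using K by (simp add: field_simps)
      then show ?thesis using t by blast
    qed
    then have "\<forall>j\<in>{..m}. \<exists>t. real (2 * j) / K < t \<and> t < real (2 * j + 1) / K \<and> f t = Pc c f t \<and> (cmod (f t))^2 \<le> K * d^2"
      by simp
    from bchoice[OF this] obtain t where t: "\<And>j. j \<le> m \<Longrightarrow> real (2 * j) / K < t j \<and> t j < real (2 * j + 1) / K \<and> f (t j) = Pc c f (t j) \<and> (cmod (f (t j)))^2 \<le> K * d^2"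
      by auto
    have "real (Suc m) \<le> real (2 ^ m)" using less_exp[of m] by (simp only: of_nat_le_iff Suc_le_eq)
    then have "K \<le> 2 * 2 ^ m" by (simp add: K_def)
    have K2: "K \<ge> 1" by (simp add: K_def)
    have node: "cmod (poly p (of_real (t j))) \<le> K * d + C * E * N" if "j \<le> m" for j
    proof -
      have "(cmod (f (t j)))^2 \<le> K * d^2" using t[OF that] by blast
      also have "\<dots> \<le> (K * K) * d^2" using K2 by (intro mult_right_mono) auto
      also have "\<dots> = (K * d)^2" by (simp add: power2_eq_square)
      finally have "cmod (f (t j)) \<le> K * d" by (rule power2_le_imp_le) (use nn K in auto)
      moreover have "\<bar>t j\<bar> \<le> A"
      proof -
        have "real (2 * j + 1) / K \<le> 1" "0 \<le> real (2 * j) / K" using K that by (auto simp: K_def)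
        then show ?thesis using t[OF that] A by auto
      qed
      moreover have "cmod (poly p (of_real (t j))) \<le> cmod (Pc c f (t j)) + cmod (Pc c f (t j) - poly p (of_real (t j)))"
        using norm_triangle_sub[of "poly p (of_real (t j))" "Pc c f (t j)"] by (simp add: norm_minus_commute)
      ultimately show ?thesis using err[of "t j"] t[OF that] by auto
    qed
    have "cmod (poly p (of_real x)) \<le> exp 1 * D ^ m * (K * d + C * E * N)"
      unfolding D_def by (rule poly_extrapolation[OF dp A x _ node]) (use t in \<open>auto simp: K_def\<close>)
    moreover have "cmod (Pc c f x) \<le> cmod (poly p (of_real x)) + cmod (Pc c f x - poly p (of_real x))"
      by (rule norm_triangle_sub)
    ultimately have "cmod (Pc c f x) \<le> exp 1 * D ^ m * (K * d + C * E * N) + C * E * N"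
      using err[OF x] by linarith
    also have "\<dots> \<le> exp 1 * D ^ m * ((2 * 2 ^ m) * (C + 1) * (d + E * N)) + C * (2 * D) ^ m * (d + E * N)"
    proof (intro add_mono mult_left_mono)
      have "K * d \<le> (2 * 2 ^ m) * (C + 1) * d"
      proof (intro mult_right_mono nn)
        have "K \<le> (2 * 2 ^ m) * 1" using \<open>K \<le> 2 * 2 ^ m\<close> by simp
        also have "\<dots> \<le> (2 * 2 ^ m) * (C + 1)" using C(1) by (intro mult_left_mono) auto
        finally show "K \<le> (2 * 2 ^ m) * (C + 1)" .
      qed
      moreover have "C * E * N \<le> (2 * 2 ^ m) * (C + 1) * (E * N)"
      proof -
        have "1 * C \<le> (2 * 2 ^ m) * (C + 1)" using C(1) by (intro mult_mono) (auto intro: order_trans[of 1 2])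
        from mult_right_mono[OF this, of "E * N"] nn show ?thesis by (simp add: mult_ac)
      qed
      ultimately show "K * d + C * E * N \<le> (2 * 2 ^ m) * (C + 1) * (d + E * N)" by (simp add: distrib_left)
      have "1 \<le> (2 * D) ^ m" using D by (intro one_le_power) auto
      then have "C * 1 * (E * N) \<le> C * (2 * D) ^ m * (d + E * N)" using C(1) nn by (intro mult_mono) auto
      then show "C * E * N \<le> C * (2 * D) ^ m * (d + E * N)" by (simp add: mult_ac)
    qed (use D in auto)
    also have "\<dots> = (2 * exp 1 * (C + 1) + C) * (2 * D) ^ m * (d + E * N)"
      by (simp add: power_mult_distrib algebra_simps)
    finally show "cmod (Pc c f x) \<le> (2 * exp 1 * (C + 1) + C) * (2 * D) ^ m * (L2norm (rst f) + q ^ m / fact m * L2norm f)"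
      by (simp add: d_def E_def N_def)
  qed (use C D q in auto)
qed

text \<open>Gaussian elimination by induction on the equations: a pivot unknown k0 is solved for and
  substituted into the others, leaving one equation and one unknown fewer.\<close>

lemma underdetermined_solution:
  fixes a :: "'i \<Rightarrow> 'k \<Rightarrow> 'a::field"
  assumes "finite J" "finite K" "card J < card K"
  shows "\<exists>z. (\<exists>k\<in>K. z k \<noteq> 0) \<and> (\<forall>j\<in>J. (\<Sum>k\<in>K. a j k * z k) = 0)"
  using assms
proof (induction J arbitrary: K a rule: finite_induct)
  case empty
  then have "K \<noteq> {}" by auto
  then show ?case by (intro exI[of _ "\<lambda>_. 1"]) auto
next
  case (insert j J)
  show ?case
  proof (cases "\<forall>k\<in>K. a j k = 0")
    case True
    have "card J < card K" using insert by simp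
    with insert.IH[of K a] insert.prems obtain z where "\<exists>k\<in>K. z k \<noteq> 0" "\<forall>j\<in>J. (\<Sum>k\<in>K. a j k * z k) = 0" by blast
    then show ?thesis using True by (intro exI[of _ z]) auto
  next
    case False
    then obtain k0 where k0: "k0 \<in> K" "a j k0 \<noteq> 0" by blast
    let ?K = "K - {k0}"
    have "card J < card ?K" using insert k0 by simp
    from insert.IH[OF finite_Diff[OF insert.prems(1)] this, of "\<lambda>i k. a i k - a i k0 * a j k / a j k0"]
    obtain z where z: "\<exists>k\<in>?K. z k \<noteq> 0" "\<And>i. i \<in> J \<Longrightarrow> (\<Sum>k\<in>?K. (a i k - a i k0 * a j k / a j k0) * z k) = 0"
      by blast
    define s where "s = (\<Sum>k\<in>?K. a j k * z k)"
    define y where "y = z(k0 := - s / a j k0)"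
    have sum: "(\<Sum>k\<in>K. a i k * y k) = a i k0 * (- s / a j k0) + (\<Sum>k\<in>?K. a i k * z k)" for i
      using insert.prems k0 by (simp add: sum.remove[of K k0] y_def)
    have "(\<Sum>k\<in>K. a i k * y k) = 0" if "i \<in> J" for i
    proof -
      have "(\<Sum>k\<in>?K. (a i k - a i k0 * a j k / a j k0) * z k) = (\<Sum>k\<in>?K. a i k * z k) - a i k0 / a j k0 * s"
        by (simp add: s_def sum_distrib_left left_diff_distrib sum_subtractf mult.assoc)
      then show ?thesis using z(2)[OF that] by (simp add: sum)
    qed
    moreover have "(\<Sum>k\<in>K. a j k * y k) = 0" using k0 by (simp add: sum s_def[symmetric])
    moreover have "\<exists>k\<in>K. y k \<noteq> 0" using z(1) by (auto simp: y_def)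
    ultimately show ?thesis by (intro exI[of _ y]) auto
  qed
qed

text \<open>m is the integer part of e * ln (1/d) / ln D, the largest degree with D^m \<le> d powr
  (-e). The factorial yields any geometric gain; H = D powr (1/e) is the ratio for which H^m reaches
  1/d up to one more factor H.\<close>

lemma extrapolation_optimize:
  assumes D: "D \<ge> 2" and q: "q \<ge> 0" and e: "e > 0"
  obtains C where "C \<ge> 0" "\<And>d::real. 0 < d \<Longrightarrow> d \<le> 1 \<Longrightarrow> \<exists>m. D ^ m * (d + q ^ m / fact m) \<le> C * d powr (1 - e)"
proof -
  define L where "L = ln D"
  have L: "L > 0" using D by (simp add: L_def)
  define H where "H = exp (L / e)"
  have H: "H > 0" by (simp add: H_def)
  define C0 where "C0 = exp (q * D * H)"
  show thesis
  proof (rule that[of "1 + C0 * H"])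
    show "0 \<le> 1 + C0 * H" using H by (simp add: C0_def add_nonneg_nonneg)
    fix d :: real assume d: "0 < d" "d \<le> 1"
    define r where "r = e * ln (1 / d) / L"
    have r: "r \<ge> 0" using d e L by (simp add: r_def)
    define m where "m = nat \<lfloor>r\<rfloor>"
    have m: "real m \<le> r" "r \<le> real m + 1" using r by (auto simp: m_def; linarith)+
    have Dm: "D ^ m \<le> d powr (- e)"
    proof -
      have "D ^ m = exp (real m * L)" using D by (simp add: L_def exp_of_nat_mult)
      also have "\<dots> \<le> exp (r * L)" using m L by simp
      also have "r * L = - e * ln d" using L d by (simp add: r_def ln_div)
      also have "exp (- e * ln d) = d powr (- e)" using d by (simp add: powr_def)
      finally show ?thesis .
    qed
    have "D ^ m * d \<le> d powr (- e) * d powr 1" using Dm d by (intro mult_mono) auto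
    also have "\<dots> = d powr (1 - e)" by (simp only: powr_add[symmetric]) simp
    finally have 1: "D ^ m * d \<le> d powr (1 - e)" .
    have "D ^ m * (q ^ m / fact m) * H ^ m = (q * D * H) ^ m / fact m" by (simp add: power_mult_distrib mult_ac)
    also have "\<dots> \<le> C0" unfolding C0_def using q D H by (intro power_div_fact_le_exp) auto
    finally have "D ^ m * (q ^ m / fact m) \<le> C0 / H ^ m" using H by (simp add: field_simps)
    also have "1 / H ^ m \<le> H * d"
    proof -
      have "1 / d = exp (r * L / e)" using d L e by (simp add: r_def)
      also have "\<dots> \<le> exp ((real m + 1) * L / e)"
        using m L e by (simp add: divide_right_mono mult_right_mono)
      also have "\<dots> = H ^ m * H" by (simp add: H_def exp_of_nat_mult[symmetric] exp_add[symmetric] field_simps add_divide_distrib)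
      finally show ?thesis using H d by (simp add: field_simps)
    qed
    then have "C0 / H ^ m \<le> C0 * (H * d)" using mult_left_mono[of "1 / H ^ m" "H * d" C0] by (simp add: C0_def)
    also have "\<dots> \<le> C0 * (H * d powr (1 - e))"
    proof (intro mult_left_mono)
      have "d powr 1 \<le> d powr (1 - e)" using d e by (intro powr_mono') auto
      then show "d \<le> d powr (1 - e)" using d by simp
    qed (use H in \<open>auto simp: C0_def\<close>)
    finally have "D ^ m * (q ^ m / fact m) \<le> C0 * H * d powr (1 - e)" by simp
    with 1 have "D ^ m * (d + q ^ m / fact m) \<le> (1 + C0 * H) * d powr (1 - e)" by (simp add: distrib_left distrib_right)
    then show "\<exists>m. D ^ m * (d + q ^ m / fact m) \<le> (1 + C0 * H) * d powr (1 - e)" ..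
  qed
qed

lemma wgt_ge_half: "\<bar>t\<bar> \<le> 1 \<Longrightarrow> 1 \<le> 2 * wgt t"
  using pos_le_divide_eq[of "1 + \<bar>t\<bar>" 1 2] by (simp add: wgt_def)

lemma inner_L_sum_right:
  assumes "\<And>i. i \<in> I \<Longrightarrow> L2 (f i)" "L2 h"
  shows "inner_L h (\<lambda>x. \<Sum>i\<in>I. z i * f i x) = (\<Sum>i\<in>I. cnj (z i) * inner_L h (f i))"
proof -
  have "inner_L (\<lambda>x. \<Sum>i\<in>I. z i * f i x) h = (\<Sum>i\<in>I. z i * inner_L (f i) h)"
    using assms by (simp add: inner_L_sum_left L2_scale inner_L_scale_left)
  from arg_cong[OF this, of cnj] show ?thesis by (simp add: inner_L_cnj)
qed

lemma L2norm_sum_orthogonal: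
  assumes "finite I" "\<And>i. i \<in> I \<Longrightarrow> L2 (g i)" "\<And>i j. i \<in> I \<Longrightarrow> j \<in> I \<Longrightarrow> i \<noteq> j \<Longrightarrow> inner_L (g i) (g j) = 0"
  shows "(L2norm (\<lambda>x. \<Sum>i\<in>I. z i * g i x))^2 = (\<Sum>i\<in>I. (cmod (z i))^2 * (L2norm (g i))^2)"
proof -
  have S: "L2 (\<lambda>x. \<Sum>i\<in>I. z i * g i x)" using assms by (intro L2_sum L2_scale) auto
  have "complex_of_real ((L2norm (\<lambda>x. \<Sum>i\<in>I. z i * g i x))^2) = inner_L (\<lambda>x. \<Sum>i\<in>I. z i * g i x) (\<lambda>x. \<Sum>i\<in>I. z i * g i x)"
    by (simp only: inner_L_self)
  also have "\<dots> = (\<Sum>i\<in>I. z i * inner_L (g i) (\<lambda>x. \<Sum>i\<in>I. z i * g i x))"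
    using assms S by (simp add: inner_L_sum_left L2_scale inner_L_scale_left)
  also have "\<dots> = (\<Sum>i\<in>I. z i * (\<Sum>j\<in>I. cnj (z j) * inner_L (g i) (g j)))"
    using assms by (intro sum.cong refl) (simp add: inner_L_sum_right)
  also have "\<dots> = (\<Sum>i\<in>I. z i * (cnj (z i) * inner_L (g i) (g i)))"
  proof (intro sum.cong refl arg_cong[where f = "\<lambda>y. z _ * y"])
    fix i assume i: "i \<in> I"
    have "(\<Sum>j\<in>I. cnj (z j) * inner_L (g i) (g j)) = (\<Sum>j\<in>I. if j = i then cnj (z i) * inner_L (g i) (g i) else 0)"
      using assms(3)[OF i] by (intro sum.cong) auto
    then show "(\<Sum>j\<in>I. cnj (z j) * inner_L (g i) (g j)) = cnj (z i) * inner_L (g i) (g i)"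
      using assms(1) i by simp
  qed
  also have "\<dots> = of_real (\<Sum>i\<in>I. (cmod (z i))^2 * (L2norm (g i))^2)"
    unfolding of_real_sum
  proof (intro sum.cong refl)
    fix i
    have "z i * (cnj (z i) * inner_L (g i) (g i)) = (z i * cnj (z i)) * inner_L (g i) (g i)" by simp
    then show "z i * (cnj (z i) * inner_L (g i) (g i)) = of_real ((cmod (z i))^2 * (L2norm (g i))^2)"
      by (simp only: inner_L_self complex_norm_square[symmetric] of_real_mult)
  qed
  finally show ?thesis by (simp only: of_real_eq_iff)
qed

lemma inner_L_rst: "inner_L (rst f) (rst g) = inner_L (rst f) g"
  unfolding inner_L_def by (intro Bochner_Integration.integral_cong) (auto simp: rst_def indicator_def)

lemma inner_L_ker: "lmeas f \<Longrightarrow> inner_L f (\<lambda>t. of_real (ker c (x - t))) = Pc c f x"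
  by (simp add: inner_L_def Pc_eq_ker)

lemma L2norm_ker: "L2norm (\<lambda>t. of_real (ker c (x - t))) = L2norm (\<lambda>t. of_real (ker c t))"
proof -
  have "(\<integral>t. (ker c (x - t))^2 \<partial>lborel) = (\<integral>t. (ker c t)^2 \<partial>lborel)"
    using lborel_integral_real_affine[of "-1" "\<lambda>t. (ker c t)^2" x] by simp
  moreover have "(\<integral>t. (ker c (x - t))^2 \<partial>lborel) = (\<integral>t. (ker c (x - t))^2 \<partial>lebesgue)"
     "(\<integral>t. (ker c t)^2 \<partial>lborel) = (\<integral>t. (ker c t)^2 \<partial>lebesgue)"
    by (subst integral_completion; measurable)+
  ultimately show ?thesis by (simp add: L2norm_def)
qed

lemma Pc_bound:
  assumes "c > 0" "L2 f" shows "cmod (Pc c f x) \<le> L2norm f * L2norm (\<lambda>t. of_real (ker c t))"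
  using inner_L_Cauchy_Schwarz[OF assms(2) L2_ker[of c x]] assms
  by (simp add: inner_L_ker L2_measurable L2norm_ker)

text \<open>The cut-off function lives on (-1,1), so the decay of the kernel in x survives the
  integration. One factor 2 comes from \<open>wgt (x - t)\<close> \<le> 2 * \<open>wgt x\<close>,
  the other from inserting 1 \<le> 2 * \<open>wgt t\<close> so that
  \<open>L2_integral_wgt_bound\<close> applies.\<close>

lemma Pc_rst_bound:
  assumes "c > 0" "L2 f"
  shows "cmod (Pc c (rst f) x) \<le> 4 * (2 * c + 1) * wgt x * L2norm (\<lambda>x. of_real (wgt x)) * L2norm (rst f)"
proof -
  have "Pc c (rst f) x = (\<integral>t. rst f t * (indicator {-1<..<1} t * of_real (ker c (x - t))) \<partial>lebesgue)"
    unfolding Pc_eq_ker[OF L2_measurable[OF rst_L2[OF assms(2)]]]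
    by (intro Bochner_Integration.integral_cong) (auto simp: rst_def indicator_def)
  also have "cmod \<dots> \<le> (4 * (2 * c + 1) * wgt x) * L2norm (\<lambda>x. of_real (wgt x)) * L2norm (rst f)"
  proof (rule L2_integral_wgt_bound[OF rst_L2[OF assms(2)]])
    show "lmeas (\<lambda>t. indicator {-1<..<1} t * complex_of_real (ker c (x - t)))"
      by (rule borel_measurable_lebesgueI) measurable
    show "cmod (indicator {-1<..<1} t * complex_of_real (ker c (x - t))) \<le> 4 * (2 * c + 1) * wgt x * wgt t" for t
    proof (cases "t \<in> {-1<..<1}")
      case True
      then have t: "\<bar>t\<bar> \<le> 1" by auto
      have "\<bar>ker c (x - t)\<bar> \<le> (2 * c + 1) * wgt (x - t)" using assms by (intro ker_le) simp
      also have "\<dots> \<le> (2 * c + 1) * (2 * wgt x)"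
        using assms wgt_diff_le[OF t, of x] by (intro mult_left_mono) auto
      also have "\<dots> \<le> (2 * c + 1) * (2 * wgt x) * (2 * wgt t)"
      proof -
        have "1 \<le> 2 * wgt t" using t by (rule wgt_ge_half)
        from mult_left_mono[OF this, of "(2 * c + 1) * (2 * wgt x)"] show ?thesis using assms by simp
      qed
      finally show ?thesis using True by (simp add: mult_ac)
    qed (use assms in simp)
  qed
  finally show ?thesis .
qed

section \<open>Prolate spheroidal wave functions\<close>

locale pswf =
  fixes c :: real and \<psi> :: "nat \<Rightarrow> real \<Rightarrow> complex"
  assumes c_pos: "c > 0" and is_pswf: "is_PSWF c \<psi>"
begin

lemma PW_psi: "PW c 2 (\<psi> n)" and norm_psi: "L2norm (\<psi> n) = 1"
  using is_pswf unfolding is_PSWF_def by blast+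

lemma L2_psi: "L2 (\<psi> n)"
  by (rule PW2_L2[OF PW_psi])

lemma orthonormal: "inner_L (\<psi> i) (\<psi> j) = (if i = j then 1 else 0)"
proof -
  have o: "inner_L (\<psi> n) (\<psi> k) = 0" if "k < n" for n k
    using is_pswf that unfolding is_PSWF_def by blast
  consider "i = j" | "i < j" | "j < i" by linarith
  then show ?thesis
  proof cases
    case 1 then show ?thesis by (simp add: inner_L_self norm_psi)
  next
    case 2 then show ?thesis using o[OF 2] inner_L_cnj[of "\<psi> j" "\<psi> i"] by simp
  next
    case 3 then show ?thesis using o[OF 3] by simp
  qed
qed

text \<open>Since \<open>\<psi> n\<close> has norm 1, this equals
  \<open>conc_ratio (\<psi> n)\<close>.\<close>

definition sig :: "nat \<Rightarrow> real" where
  "sig n = L2norm (rst (\<psi> n))"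

lemma sig_nonneg: "0 \<le> sig n"
  by (simp add: sig_def)

lemma sig_le_1: "sig n \<le> 1"
  using L2norm_rst_le[OF L2_psi[of n]] by (simp add: sig_def norm_psi)

text \<open>The extremal property freed of the quotient, so that it also covers functions of norm
  0.\<close>

lemma concentration_max:
  assumes "PW c 2 f" "\<And>k. k < n \<Longrightarrow> inner_L f (\<psi> k) = 0"
  shows "L2norm (rst f) \<le> sig n * L2norm f"
proof (cases "L2norm f = 0")
  case True
  then show ?thesis using L2norm_rst_le[OF PW2_L2[OF assms(1)]] by simp
next
  case False
  then have "conc_ratio f \<le> conc_ratio (\<psi> n)"
    using is_pswf assms unfolding is_PSWF_def by blast
  then have "L2norm (rst f) / L2norm f \<le> sig n"
    by (simp add: conc_ratio_def L2norm_on_rst norm_psi sig_def)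
  moreover have "L2norm f > 0" using False L2norm_nonneg[of f] by linarith
  ultimately show ?thesis by (simp add: field_simps)
qed

lemma sig_antimono: "k \<le> n \<Longrightarrow> sig n \<le> sig k"
  using concentration_max[OF PW_psi, of k n] by (simp add: orthonormal norm_psi sig_def)

text \<open>The first variation of the concentration at its maximum, along \<open>\<psi> n\<close> +
  z * h, which stays orthogonal to the earlier functions. A complex z captures real and imaginary
  parts at once.\<close>

lemma euler_lagrange:
  assumes h: "PW c 2 h" "\<And>k. k < n \<Longrightarrow> inner_L h (\<psi> k) = 0"
  shows "inner_L (rst (\<psi> n)) (rst h) = of_real ((sig n)^2) * inner_L (\<psi> n) h"
proof (rule ccontr)
  assume neq: "\<not> ?thesis"
  define a where "a = inner_L (rst (\<psi> n)) (rst h)"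
  define b where "b = inner_L (\<psi> n) h"
  define d where "d = a - of_real ((sig n)^2) * b"
  have d0: "d \<noteq> 0" using neq by (simp add: d_def a_def b_def)
  have h2: "L2 h" by (rule PW2_L2[OF h(1)])
  define M where "M = (sig n)^2 * (L2norm h)^2"
  have M0: "M \<ge> 0" by (simp add: M_def)
  have key: "2 * Re (cnj z * d) \<le> (cmod z)^2 * M" for z
  proof -
    have "PW c 2 (\<lambda>x. \<psi> n x + z * h x)" by (rule PW2_add[OF PW_psi h(1)])
    moreover have "inner_L (\<lambda>x. \<psi> n x + z * h x) (\<psi> k) = 0" if "k < n" for k
      using that h h2 by (simp add: inner_L_add_left L2_scale L2_psi inner_L_scale_left orthonormal)
    ultimately have "L2norm (rst (\<lambda>x. \<psi> n x + z * h x)) \<le> sig n * L2norm (\<lambda>x. \<psi> n x + z * h x)"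
      by (rule concentration_max)
    then have "(L2norm (rst (\<lambda>x. \<psi> n x + z * h x)))^2 \<le> (sig n * L2norm (\<lambda>x. \<psi> n x + z * h x))^2"
      by (intro power_mono) auto
    also have "\<dots> = (sig n)^2 * (1 + 2 * Re (cnj z * b) + (cmod z)^2 * (L2norm h)^2)"
      unfolding power_mult_distrib L2norm_add_sq[OF L2_psi h2] by (simp add: norm_psi b_def)
    also have "(L2norm (rst (\<lambda>x. \<psi> n x + z * h x)))^2 = (sig n)^2 + 2 * Re (cnj z * a) + (cmod z)^2 * (L2norm (rst h))^2"
      unfolding rst_add L2norm_add_sq[OF rst_L2[OF L2_psi] rst_L2[OF h2]] by (simp add: sig_def a_def)
    finally have "2 * Re (cnj z * a) + (cmod z)^2 * (L2norm (rst h))^2 \<le> 2 * ((sig n)^2 * Re (cnj z * b)) + (cmod z)^2 * M"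
      by (simp add: M_def algebra_simps)
    moreover have "Re (cnj z * d) = Re (cnj z * a) - (sig n)^2 * Re (cnj z * b)"
    proof -
      have "cnj z * d = cnj z * a - of_real ((sig n)^2) * (cnj z * b)" by (simp add: d_def algebra_simps)
      then show ?thesis by (simp only: minus_complex.sel Re_complex_of_real times_complex.sel Im_complex_of_real)
    qed
    moreover have "0 \<le> (cmod z)^2 * (L2norm (rst h))^2" by simp
    ultimately show ?thesis by linarith
  qed
  \<comment> \<open>For z = e * d the linear term 2 * e * |d|^2 exceeds the quadratic term e^2 *
    |d|^2 * M as soon as e * M < 2.\<close>
  define e where "e = 1 / (M + 1)"
  have e: "e > 0" using M0 by (simp add: e_def)
  have "cnj (of_real e * d) * d = of_real (e * (cmod d)^2)"
    using complex_norm_square[of d] by (simp add: mult_ac)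
  then have "2 * (e * (cmod d)^2) \<le> (e * cmod d)^2 * M"
    using key[of "of_real e * d"] e by (simp only: Re_complex_of_real norm_mult norm_of_real abs_of_pos)
  then have "(e * (cmod d)^2) * 2 \<le> (e * (cmod d)^2) * (e * M)" by (simp add: power2_eq_square mult_ac)
  then have "2 \<le> e * M" using e d0 by (subst (asm) mult_le_cancel_left_pos) auto
  moreover have "e * M \<le> 1" using M0 by (simp add: e_def)
  ultimately show False by simp
qed

text \<open>Double orthogonality: for k < n the later function \<open>\<psi> n\<close> is an
  admissible variation of \<open>\<psi> k\<close>, and the two are orthogonal on the line.\<close>

lemma rst_orthogonal: "i \<noteq> j \<Longrightarrow> inner_L (rst (\<psi> i)) (rst (\<psi> j)) = 0"
proof -
  have o: "inner_L (rst (\<psi> k)) (rst (\<psi> n)) = 0" if "k < n" for k n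
    using euler_lagrange[OF PW_psi, of k n] that by (simp add: orthonormal)
  assume "i \<noteq> j"
  then consider "i < j" | "j < i" by linarith
  then show ?thesis
  proof cases
    case 2
    then show ?thesis using o[OF 2] inner_L_cnj[of "rst (\<psi> j)" "rst (\<psi> i)"] by simp
  qed (rule o)
qed

text \<open>Removing from h its components along the earlier functions makes it admissible in
  \<open>euler_lagrange\<close>. These components contribute to neither side, by orthogonality on
  (-1,1) and on the line.\<close>

lemma eigen:
  assumes h: "PW c 2 h"
  shows "inner_L (rst (\<psi> n)) (rst h) = of_real ((sig n)^2) * inner_L (\<psi> n) h"
proof -
  define s where "s x = (\<Sum>k<n. inner_L h (\<psi> k) * \<psi> k x)" for x
  define g where "g x = h x + (- 1) * s x" for x
  have s: "PW c 2 s" unfolding s_def[abs_def] by (intro PW2_sum PW_psi)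
  have h2: "L2 h" and s2: "L2 s" using h s by (auto intro: PW2_L2)
  have rs: "rst s = (\<lambda>x. \<Sum>k<n. inner_L h (\<psi> k) * rst (\<psi> k) x)"
    by (auto simp: rst_def s_def fun_eq_iff sum_distrib_left mult_ac)
  have g: "PW c 2 g" unfolding g_def[abs_def] by (rule PW2_add[OF h s])
  have "inner_L g (\<psi> k) = 0" if "k < n" for k
  proof -
    have "inner_L s (\<psi> k) = (\<Sum>j<n. inner_L h (\<psi> j) * inner_L (\<psi> j) (\<psi> k))"
      unfolding s_def by (simp add: inner_L_sum_left L2_scale L2_psi inner_L_scale_left)
    also have "\<dots> = (\<Sum>j<n. if j = k then inner_L h (\<psi> k) else 0)" by (intro sum.cong) (auto simp: orthonormal)
    also have "\<dots> = inner_L h (\<psi> k)" using that by simp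
    finally show ?thesis
      unfolding g_def by (subst inner_L_add_left[OF h2 L2_scale[OF s2] L2_psi], simp only: inner_L_scale_left) simp
  qed
  from euler_lagrange[OF g this]
  have "inner_L (rst (\<psi> n)) (rst g) = of_real ((sig n)^2) * inner_L (\<psi> n) g" .
  moreover have "inner_L (rst (\<psi> n)) (rst g) = inner_L (rst (\<psi> n)) (rst h)"
  proof -
    have "inner_L (rst (\<psi> n)) (rst s) = 0"
      unfolding rs by (subst inner_L_sum_right) (auto simp: rst_L2 L2_psi rst_orthogonal)
    then show ?thesis
      unfolding g_def rst_add
      by (subst inner_L_add_right[OF rst_L2[OF h2] L2_scale[OF rst_L2[OF s2]] rst_L2[OF L2_psi]]) (simp add: inner_L_scale_right[of _ "-1", simplified])
  qed
  moreover have "inner_L (\<psi> n) g = inner_L (\<psi> n) h"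
  proof -
    have "inner_L (\<psi> n) s = 0"
      unfolding s_def by (subst inner_L_sum_right) (auto simp: L2_psi orthonormal)
    then show ?thesis
      unfolding g_def
      by (subst inner_L_add_right[OF h2 L2_scale[OF s2] L2_psi]) (simp add: inner_L_scale_right[of _ "-1", simplified])
  qed
  ultimately show ?thesis by simp
qed

text \<open>The continuous representative of \<open>\<psi> n\<close>, which is itself only determined up to null sets.\<close>

definition psi :: "nat \<Rightarrow> real \<Rightarrow> complex" where
  "psi n = Pc c (\<psi> n)"

lemma psi_AE: "AE x in lebesgue. \<psi> n x = psi n x"
  unfolding psi_def by (rule PW2_reproducing[OF c_pos PW_psi])

text \<open>Testing the weak eigenvalue equation against a translate of the sinc kernel turns it
  into an identity at every x.\<close>

lemma eigen_Pc: "of_real ((sig n)^2) * psi n x = Pc c (rst (\<psi> n)) x"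
  using eigen[OF PW2_ker[OF c_pos], of n x]
  by (simp add: inner_L_rst inner_L_ker L2_measurable rst_L2 L2_psi psi_def)

text \<open>Unique continuation: with no mass on (-1,1), extrapolation leaves only C * (D * q)^m /
  m!, which tends to 0, so \<open>psi n\<close> would vanish everywhere, against norm 1.\<close>

lemma sig_pos: "0 < sig n"
proof (rule ccontr)
  assume "\<not> 0 < sig n"
  then have s0: "L2norm (rst (\<psi> n)) = 0" using sig_nonneg[of n] unfolding sig_def by linarith
  have "psi n x = 0" for x
  proof -
    obtain C D q where C: "C \<ge> 0" "D \<ge> 2" "q \<ge> 0"
      "\<And>f m y. PW c 2 f \<Longrightarrow> \<bar>y\<bar> \<le> max 1 \<bar>x\<bar> \<Longrightarrow> cmod (Pc c f y) \<le> C * D ^ m * (L2norm (rst f) + q ^ m / fact m * L2norm f)"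
      by (rule PW_extrapolation[OF c_pos, of "max 1 \<bar>x\<bar>"]) auto
    have "cmod (psi n x) \<le> C * ((D * q) ^ m / fact m)" for m
      using C(4)[OF PW_psi[of n], of x m] by (simp add: psi_def s0 norm_psi power_mult_distrib mult_ac)
    moreover have "(\<lambda>m. C * ((D * q) ^ m / fact m)) \<longlonglongrightarrow> C * 0"
      using summable_LIMSEQ_zero[OF summable_exp_generic[of "D * q"]]
      by (intro tendsto_mult tendsto_const) (simp add: divide_inverse mult.commute)
    ultimately have "cmod (psi n x) \<le> C * 0"
      by (intro LIMSEQ_le_const[of _ _ "cmod (psi n x)"]) auto
    then show ?thesis by simp
  qed
  then have "AE x in lebesgue. \<psi> n x = 0" using psi_AE[of n] by simp
  then have "L2norm (\<psi> n) = L2norm (\<lambda>x. 0)" by (intro L2norm_cong_AE L2_measurable L2_psi L2_zero)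
  moreover have "L2norm (\<lambda>x. 0) = 0" by (simp add: L2norm_def)
  ultimately show False by (simp add: norm_psi)
qed

section \<open>Pointwise bounds for the eigenfunctions and decay of the eigenvalues\<close>

text \<open>The eigenvalue equation carries the square of \<open>sig n\<close>, but
  \<open>rst (\<psi> n)\<close> itself has norm \<open>sig n\<close>; one factor cancels.\<close>

lemma psi_bounds:
  obtains C where "C \<ge> 0" "\<And>n x. cmod (psi n x) \<le> C" "\<And>n x. sig n * cmod (psi n x) \<le> C * wgt x"
proof -
  define C1 where "C1 = L2norm (\<lambda>t. of_real (ker c t))"
  define C2 where "C2 = 4 * (2 * c + 1) * L2norm (\<lambda>x. of_real (wgt x))"
  have nn: "C1 \<ge> 0" "C2 \<ge> 0" using c_pos by (auto simp: C1_def C2_def)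
  show thesis
  proof (rule that[of "C1 + C2"])
    show "cmod (psi n x) \<le> C1 + C2" for n x
      using Pc_bound[OF c_pos L2_psi[of n], of x] nn by (simp add: psi_def norm_psi C1_def)
    fix n x
    have "(sig n)^2 * cmod (psi n x) = cmod (Pc c (rst (\<psi> n)) x)"
      unfolding eigen_Pc[symmetric] by (simp add: norm_mult norm_power sig_nonneg)
    also have "\<dots> \<le> C2 * wgt x * sig n"
      using Pc_rst_bound[OF c_pos L2_psi[of n], of x] by (simp add: C2_def sig_def mult_ac)
    finally have "sig n * (sig n * cmod (psi n x)) \<le> sig n * (C2 * wgt x)" by (simp add: power2_eq_square mult_ac)
    then have "sig n * cmod (psi n x) \<le> C2 * wgt x" using sig_pos[of n] by simp
    also have "\<dots> \<le> (C1 + C2) * wgt x" using nn by (intro mult_right_mono) auto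
    finally show "sig n * cmod (psi n x) \<le> (C1 + C2) * wgt x" .
  qed (use nn in auto)
qed

text \<open>The two bounds give C * min 1 z with z = \<open>wgt x / sig n\<close>, and min 1 z \<le>
  z powr a for a between 0 and 1.\<close>

lemma psi_interpolated_bound:
  obtains C where "C \<ge> 0" "\<And>n x a. 0 \<le> a \<Longrightarrow> a \<le> 1 \<Longrightarrow> cmod (psi n x) \<le> C * (sig n powr (- a) * wgt x powr a)"
proof -
  obtain C where C: "C \<ge> 0" "\<And>n x. cmod (psi n x) \<le> C" "\<And>n x. sig n * cmod (psi n x) \<le> C * wgt x"
    using psi_bounds by blast
  show thesis
  proof (rule that[of C])
    fix n x a assume a: "0 \<le> a" "a \<le> (1::real)"
    define z where "z = wgt x / sig n"
    have z: "z > 0" using sig_pos[of n] by (simp add: z_def)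
    have "cmod (psi n x) \<le> C * min 1 z"
      using C(2)[of n x] C(3)[of n x] sig_pos[of n] by (auto simp: min_def z_def field_simps)
    also have "\<dots> \<le> C * z powr a"
    proof (intro mult_left_mono C(1))
      show "min 1 z \<le> z powr a"
      proof (cases "z \<le> 1")
        case True
        have "z powr 1 \<le> z powr a" using a z True by (intro powr_mono') auto
        then show ?thesis using z by auto
      next
        case False
        then have "1 \<le> z powr a" using a by (intro ge_one_powr_ge_zero) auto
        then show ?thesis by auto
      qed
    qed
    also have "z powr a = sig n powr (- a) * wgt x powr a"
      using sig_pos[of n] by (simp add: z_def powr_divide powr_minus_divide)
    finally show "cmod (psi n x) \<le> C * (sig n powr (- a) * wgt x powr a)" .
  qed fact
qed

text \<open>\<open>PW_extrapolation\<close> with the degree chosen by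
  \<open>extrapolation_optimize\<close>. Q normalizes f, so that d acts as a relative
  concentration.\<close>

lemma PW_pointwise_decay:
  assumes "e > 0"
  obtains C where "C \<ge> 0" "\<And>f d. PW c 2 f \<Longrightarrow> 0 < d \<Longrightarrow> d \<le> 1 \<Longrightarrow> L2norm (rst f) \<le> d * Q \<Longrightarrow> L2norm f \<le> Q \<Longrightarrow>
     cmod (Pc c f x) \<le> C * Q * d powr (1 - e)"
proof -
  obtain C D q where C: "C \<ge> 0" "D \<ge> 2" "q \<ge> 0"
    "\<And>f m y. PW c 2 f \<Longrightarrow> \<bar>y\<bar> \<le> max 1 \<bar>x\<bar> \<Longrightarrow> cmod (Pc c f y) \<le> C * D ^ m * (L2norm (rst f) + q ^ m / fact m * L2norm f)"
    by (rule PW_extrapolation[OF c_pos, of "max 1 \<bar>x\<bar>"]) auto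
  obtain K where K: "K \<ge> 0" "\<And>d::real. 0 < d \<Longrightarrow> d \<le> 1 \<Longrightarrow> \<exists>m. D ^ m * (d + q ^ m / fact m) \<le> K * d powr (1 - e)"
    using extrapolation_optimize[OF C(2,3) assms] by blast
  show thesis
  proof (rule that[of "C * K"])
    show "0 \<le> C * K" using C K by simp
    fix f d assume f: "PW c 2 f" and d: "0 < d" "d \<le> 1" and n: "L2norm (rst f) \<le> d * Q" "L2norm f \<le> Q"
    have Q: "Q \<ge> 0" using n(2) L2norm_nonneg[of f] by linarith
    obtain m where m: "D ^ m * (d + q ^ m / fact m) \<le> K * d powr (1 - e)" using K(2)[OF d] by blast
    have "cmod (Pc c f x) \<le> C * D ^ m * (L2norm (rst f) + q ^ m / fact m * L2norm f)"
      by (rule C(4)[OF f]) simp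
    also have "\<dots> \<le> C * D ^ m * (d * Q + q ^ m / fact m * Q)"
      using C n by (intro mult_left_mono add_mono) auto
    also have "\<dots> = C * Q * (D ^ m * (d + q ^ m / fact m))" by (simp add: algebra_simps)
    also have "\<dots> \<le> C * Q * (K * d powr (1 - e))" using m C(1) Q by (intro mult_left_mono) auto
    finally show "cmod (Pc c f x) \<le> C * K * Q * d powr (1 - e)" by (simp add: mult_ac)
  qed
qed

text \<open>Some combination of \<open>\<psi> 0, \<dots>, \<psi> (m + 1)\<close> has vanishing Taylor coefficients of order at most \<open>m\<close>, hence is
  tiny on \<open>(-1,1)\<close>; but its concentration is at least \<open>sig (m + 1)\<close>.\<close>

lemma sig_decay:
  obtains C where "C > 0" "\<And>n. sig n \<le> C * (1 / 2) ^ n"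
proof -
  define q where "q = 2 * pi * c * 1"
  have q: "q \<ge> 0" using c_pos by (simp add: q_def)
  obtain C where C: "C \<ge> 0" "\<And>f m x. L2 f \<Longrightarrow> \<bar>x\<bar> \<le> 1 \<Longrightarrow>
    cmod (Pc c f x - (\<Sum>j\<le>m. taylor_coeff c j f * of_real x ^ j)) \<le> C * (q ^ m / fact m) * L2norm f"
    unfolding q_def by (rule Pc_taylor[OF c_pos, of 1]) auto
  define W where "W = L2norm (\<lambda>x. of_real (wgt x))"
  have s: "sig (Suc m) \<le> 2 * C * W * (q ^ m / fact m)" for m
  proof -
    \<comment> \<open>There are m + 1 linear conditions on m + 2 unknowns.\<close>
    obtain z where z: "\<exists>k\<in>{..Suc m}. z k \<noteq> 0" "\<And>j. j \<le> m \<Longrightarrow> (\<Sum>k\<le>Suc m. taylor_coeff c j (\<psi> k) * z k) = 0"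
      using underdetermined_solution[of "{..m}" "{..Suc m}" "\<lambda>j k. taylor_coeff c j (\<psi> k)"] by auto
    define f where "f x = (\<Sum>k\<le>Suc m. z k * \<psi> k x)" for x
    have f: "PW c 2 f" unfolding f_def[abs_def] by (intro PW2_sum PW_psi)
    have f2: "L2 f" by (rule PW2_L2[OF f])
    have rf: "rst f = (\<lambda>x. \<Sum>k\<le>Suc m. z k * rst (\<psi> k) x)"
      by (auto simp: rst_def f_def fun_eq_iff sum_distrib_left mult_ac simp del: sum.atMost_Suc)
    have nf: "(L2norm f)^2 = (\<Sum>k\<le>Suc m. (cmod (z k))^2)"
      unfolding f_def by (subst L2norm_sum_orthogonal) (auto simp: L2_psi orthonormal norm_psi simp del: sum.atMost_Suc)
    have nrf: "(L2norm (rst f))^2 = (\<Sum>k\<le>Suc m. (cmod (z k))^2 * (sig k)^2)"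
      unfolding rf by (subst L2norm_sum_orthogonal) (auto simp: L2_psi rst_L2 rst_orthogonal sig_def simp del: sum.atMost_Suc)
    have npos: "L2norm f > 0"
    proof -
      obtain k where k: "k \<in> {..Suc m}" "z k \<noteq> 0" using z(1) by blast
      have "0 < (\<Sum>k\<le>Suc m. (cmod (z k))^2)" by (rule sum_pos2[OF _ k(1)]) (use k in auto)
      then show ?thesis using nf L2norm_nonneg[of f] by (metis less_eq_real_def zero_power2 order_less_irrefl)
    qed
    \<comment> \<open>By double orthogonality the squared concentration of f is a weighted average
      of the squares of \<open>sig k\<close> for k \<le> m + 1, the smallest of which is the
      last.\<close>
    have "(sig (Suc m) * L2norm f)^2 \<le> (L2norm (rst f))^2"
      unfolding power_mult_distrib nf nrf sum_distrib_left
    proof (rule sum_mono)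
      fix k assume "k \<in> {..Suc m}"
      then have "(sig (Suc m))^2 \<le> (sig k)^2" by (intro power_mono sig_antimono sig_nonneg) simp
      then show "(sig (Suc m))^2 * (cmod (z k))^2 \<le> (cmod (z k))^2 * (sig k)^2"
        unfolding mult.commute[of "(cmod (z k))^2"] by (rule mult_right_mono) simp
    qed
    then have lo: "sig (Suc m) * L2norm f \<le> L2norm (rst f)" by (rule power2_le_imp_le) simp
    have "taylor_coeff c j f = 0" if "j \<le> m" for j
    proof -
      have i: "integrable lebesgue (\<lambda>t. \<psi> k t * taylor_ker c j t)" for k
        using c_pos by (intro L2_mult_integrable L2_psi L2_taylor_ker) simp
      have "taylor_coeff c j f = (\<integral>t. (\<Sum>k\<le>Suc m. z k * (\<psi> k t * taylor_ker c j t)) \<partial>lebesgue)"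
        unfolding taylor_coeff_def f_def by (simp add: sum_distrib_right mult.assoc del: sum.atMost_Suc)
      also have "\<dots> = (\<Sum>k\<le>Suc m. z k * taylor_coeff c j (\<psi> k))"
        unfolding taylor_coeff_def using i by (simp del: sum.atMost_Suc)
      finally show ?thesis using z(2)[OF that] by (simp only: mult.commute)
    qed
    then have "(\<Sum>j\<le>m. taylor_coeff c j f * of_real x ^ j) = 0" for x by simp
    with C(2)[OF f2, of _ m] have b: "cmod (Pc c f x) \<le> C * (q ^ m / fact m) * L2norm f" if "\<bar>x\<bar> \<le> 1" for x
      using that by fastforce
    define B where "B = C * (q ^ m / fact m) * L2norm f"
    have B: "B \<ge> 0" using C(1) q by (simp add: B_def)
    \<comment> \<open>2 * B * \<open>wgt x\<close> is a square-integrable majorant because 2 *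
      \<open>wgt x\<close> is at least 1 on (-1,1).\<close>
    have "L2norm (rst f) \<le> L2norm (\<lambda>x. of_real (2 * B) * of_real (wgt x))"
    proof (rule L2norm_mono_AE)
      show "AE x in lebesgue. cmod (rst f x) \<le> cmod (of_real (2 * B) * of_real (wgt x))"
        using PW2_reproducing[OF c_pos f]
      proof eventually_elim
        case (elim x)
        show ?case
        proof (cases "x \<in> {-1<..<1}")
          case True
          then have "1 \<le> 2 * wgt x" by (intro wgt_ge_half) auto
          from mult_left_mono[OF this B] have "B \<le> 2 * B * wgt x" by simp
          moreover have "cmod (rst f x) \<le> B" using b[of x] True elim abs_le_iff[of x 1] by (simp add: rst_def B_def)
          ultimately show ?thesis using B by (simp add: norm_mult)
        qed (simp add: rst_def)
      qed
    qed (auto intro!: L2_scale L2_wgt L2_measurable rst_L2 f2)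
    also have "\<dots> = 2 * B * W" using B unfolding L2norm_scale norm_of_real W_def by simp
    finally have "sig (Suc m) * L2norm f \<le> (2 * C * W * (q ^ m / fact m)) * L2norm f"
      using lo by (simp add: B_def mult_ac)
    then show ?thesis using npos by (rule mult_right_le_imp_le)
  qed
  \<comment> \<open>exp (2 * q) bounds (2 * q)^m / m! and leaves (1/2)^m; the factor 4 in place of 2
    pays for the shift n = m + 1, and the added 1 covers n = 0.\<close>
  define E where "E = 4 * C * W * exp (2 * q) + 1"
  have W: "W \<ge> 0" by (simp add: W_def)
  have EE: "4 * C * W * exp (2 * q) \<ge> 0" using C(1) W by simp
  show thesis
  proof (rule that[of E])
    show "E > 0" using EE by (simp add: E_def)
    show "sig n \<le> E * (1 / 2) ^ n" for n
    proof (cases n)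
      case 0
      then show ?thesis using sig_le_1[of n] EE by (simp add: E_def)
    next
      case (Suc m)
      have "q ^ m / fact m = ((2 * q) ^ m / fact m) * (1 / 2) ^ m" by (simp add: power_mult_distrib power_divide)
      also have "\<dots> \<le> exp (2 * q) * (1 / 2) ^ m" using q by (intro mult_right_mono power_div_fact_le_exp) auto
      finally have "2 * C * W * (q ^ m / fact m) \<le> 2 * C * W * (exp (2 * q) * (1 / 2) ^ m)"
        using C(1) W by (intro mult_left_mono) auto
      with s[of m] have "sig (Suc m) \<le> 2 * C * W * (exp (2 * q) * (1 / 2) ^ m)" by linarith
      also have "\<dots> = (4 * C * W * exp (2 * q)) * (1 / 2) ^ n" using Suc by simp
      also have "\<dots> \<le> E * (1 / 2) ^ n" by (intro mult_right_mono) (auto simp: E_def)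
      finally show ?thesis using Suc by simp
    qed
  qed
qed

end

section \<open>Almost everywhere convergence of the expansion\<close>

context pswf
begin

text \<open>With e = (1 - a) / 2 the bound \<open>sig n powr (1 - e)\<close> on
  \<open>psi n x\<close> leaves \<open>sig n powr e\<close> after multiplication by
  \<open>sig n powr (- a)\<close>, and this is dominated by a geometric sequence.\<close>

lemma psi_sig_summable:
  assumes "a < 1" shows "summable (\<lambda>n. cmod (psi n x) * sig n powr (- a))"
proof -
  define e where "e = (1 - a) / 2"
  have e: "e > 0" using assms by (simp add: e_def)
  obtain C where C: "C \<ge> 0" "\<And>f d. PW c 2 f \<Longrightarrow> 0 < d \<Longrightarrow> d \<le> 1 \<Longrightarrow> L2norm (rst f) \<le> d * 1 \<Longrightarrow> L2norm f \<le> 1 \<Longrightarrow>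
     cmod (Pc c f x) \<le> C * 1 * d powr (1 - e)"
    by (rule PW_pointwise_decay[OF e, of 1 x]) (rule that)
  obtain E where E: "E > 0" "\<And>n. sig n \<le> E * (1 / 2) ^ n" using sig_decay by blast
  show ?thesis
  proof (rule summable_comparison_test'[where N = 0])
    define q where "q = (1 / 2) powr e"
    have "q < (1 / 2) powr 0" unfolding q_def using e by (intro powr_less_mono') auto
    then have "norm q < 1" by (simp add: q_def)
    then show "summable (\<lambda>n. C * E powr e * q ^ n)" by (intro summable_mult summable_geometric)
    fix n
    have "cmod (psi n x) \<le> C * sig n powr (1 - e)"
      using C(2)[OF PW_psi sig_pos sig_le_1, of n n] by (simp add: psi_def norm_psi sig_def)
    then have "cmod (psi n x) * sig n powr (- a) \<le> C * sig n powr (1 - e) * sig n powr (- a)"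
      by (rule mult_right_mono) simp
    also have "\<dots> = C * sig n powr e"
    proof -
      have "1 - e + - a = e" by (simp add: e_def field_simps)
      then show ?thesis by (simp only: mult.assoc powr_add[symmetric])
    qed
    also have "\<dots> \<le> C * (E * (1 / 2) ^ n) powr e"
      using C(1) E e sig_nonneg by (intro mult_left_mono powr_mono2) auto
    also have "(E * (1 / 2) ^ n) powr e = E powr e * q ^ n"
      using E by (simp add: q_def powr_mult powr_power powr_realpow[symmetric] powr_powr mult.commute)
    finally show "norm (cmod (psi n x) * sig n powr (- a)) \<le> C * E powr e * q ^ n" by (simp add: mult_ac)
  qed
qed

text \<open>The remainder after \<open>N\<close> terms is orthogonal to \<open>\<psi> 0, \<dots>, \<psi> N\<close>, so its concentration is at most
  \<open>sig (N + 1)\<close>, and it tends to \<open>0\<close> pointwise by extrapolation.\<close>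

lemma kernel_expansion:
  "AE t in lebesgue. (\<lambda>N. \<Sum>n\<le>N. psi n x * cnj (\<psi> n t)) \<longlonglongrightarrow> of_real (ker c (x - t))"
proof -
  let ?k = "\<lambda>t. complex_of_real (ker c (x - t))"
  define Q where "Q = L2norm ?k"
  \<comment> \<open>The orthogonal projection of the kernel translate. It is the conjugate of the
    sum in the claim; conjugation at the end is harmless because the kernel is real.\<close>
  define S where "S N t = (\<Sum>n\<le>N. cnj (psi n x) * \<psi> n t)" for N t
  define h where "h N t = ?k t + (- 1) * S N t" for N t
  have k: "PW c 2 ?k" by (rule PW2_ker[OF c_pos])
  have k2: "L2 ?k" by (rule PW2_L2[OF k])
  have S: "PW c 2 (S N)" for N unfolding S_def[abs_def] by (intro PW2_sum PW_psi)
  have S2: "L2 (S N)" for N by (rule PW2_L2[OF S])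
  have h: "PW c 2 (h N)" for N unfolding h_def[abs_def] by (rule PW2_add[OF k S])
  have h2: "L2 (h N)" for N by (rule PW2_L2[OF h])
  have ik: "inner_L ?k (\<psi> j) = cnj (psi j x)" for j
    using inner_L_cnj[of "\<psi> j" ?k] inner_L_ker[OF L2_measurable[OF L2_psi], of j c x] by (simp add: psi_def)
  have orth: "inner_L (h N) (\<psi> j) = 0" if "j \<le> N" for N j
  proof -
    have "inner_L (S N) (\<psi> j) = (\<Sum>n\<le>N. cnj (psi n x) * inner_L (\<psi> n) (\<psi> j))"
      unfolding S_def by (simp add: inner_L_sum_left L2_scale L2_psi inner_L_scale_left)
    also have "\<dots> = (\<Sum>n\<le>N. if n = j then cnj (psi j x) else 0)" by (intro sum.cong) (auto simp: orthonormal)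
    also have "\<dots> = cnj (psi j x)" using that by simp
    finally show ?thesis
      unfolding h_def by (subst inner_L_add_left[OF k2 L2_scale[OF S2] L2_psi], simp only: inner_L_scale_left) (simp add: ik)
  qed
  \<comment> \<open>The remainder is orthogonal to the projection, so its squared norm equals its
    inner product with the kernel translate; Cauchy-Schwarz then bounds it uniformly in N.\<close>
  have hQ: "L2norm (h N) \<le> Q" for N
  proof -
    have "inner_L (h N) (S N) = 0"
      unfolding S_def by (subst inner_L_sum_right) (auto simp: L2_psi h2 orth)
    then have "inner_L (h N) (\<lambda>t. ?k t + (- 1) * S N t) = inner_L (h N) ?k"
      by (subst inner_L_add_right[OF k2 L2_scale[OF S2] h2], simp only: inner_L_scale_right) simp
    moreover have "h N = (\<lambda>t. ?k t + (- 1) * S N t)" by (simp add: h_def fun_eq_iff)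
    ultimately have "inner_L (h N) (h N) = inner_L (h N) ?k" by simp
    then have "(L2norm (h N))^2 = cmod (inner_L (h N) ?k)"
      by (metis inner_L_self norm_of_real abs_of_nonneg zero_le_power2)
    also have "\<dots> \<le> L2norm (h N) * Q" unfolding Q_def by (rule inner_L_Cauchy_Schwarz[OF h2 k2])
    finally have "L2norm (h N) * L2norm (h N) \<le> L2norm (h N) * Q" by (simp add: power2_eq_square)
    then show ?thesis
      by (cases "L2norm (h N) = 0") (auto simp: Q_def mult_le_cancel_left less_le)
  qed
  have lim: "(\<lambda>N. Pc c (h N) y) \<longlonglongrightarrow> 0" for y
  proof -
    \<comment> \<open>Any loss e < 1 would force convergence to 0; e = 1/2 turns the power into a
      square root.\<close>
    obtain C where C: "C \<ge> 0" "\<And>f d. PW c 2 f \<Longrightarrow> 0 < d \<Longrightarrow> d \<le> 1 \<Longrightarrow> L2norm (rst f) \<le> d * Q \<Longrightarrow> L2norm f \<le> Q \<Longrightarrow>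
       cmod (Pc c f y) \<le> C * Q * d powr (1 - 1 / 2)"
      by (rule PW_pointwise_decay[of "1/2" Q y]) auto
    obtain E where E: "E > 0" "\<And>n. sig n \<le> E * (1 / 2) ^ n" using sig_decay by blast
    have "(\<lambda>n. E * (1 / 2) ^ n) \<longlonglongrightarrow> E * 0" by (intro tendsto_intros LIMSEQ_power_zero) auto
    then have "sig \<longlonglongrightarrow> 0"
      using E sig_nonneg by (intro tendsto_sandwich[of "\<lambda>_. 0" sig sequentially "\<lambda>n. E * (1 / 2) ^ n"]) auto
    then have "(\<lambda>N. sqrt (sig (Suc N))) \<longlonglongrightarrow> sqrt 0"
      by (intro tendsto_real_sqrt LIMSEQ_Suc)
    then have t0: "(\<lambda>N. C * Q * sqrt (sig (Suc N))) \<longlonglongrightarrow> 0"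
      using tendsto_mult_right_zero by simp
    have "cmod (Pc c (h N) y) \<le> C * Q * sqrt (sig (Suc N))" for N
    proof -
      have "L2norm (rst (h N)) \<le> sig (Suc N) * L2norm (h N)"
        by (rule concentration_max[OF h]) (simp add: orth)
      also have "\<dots> \<le> sig (Suc N) * Q" by (intro mult_left_mono hQ sig_nonneg)
      finally have "cmod (Pc c (h N) y) \<le> C * Q * sig (Suc N) powr (1 - 1 / 2)"
        by (intro C(2) h sig_pos sig_le_1 hQ)
      then show ?thesis by (simp add: powr_half_sqrt sig_nonneg)
    qed
    then show ?thesis
      by (intro Lim_null_comparison[OF _ t0]) simp
  qed
  have "AE t in lebesgue. \<forall>N. h N t = Pc c (h N) t"
    unfolding AE_all_countable using PW2_reproducing[OF c_pos h] by blast
  then show ?thesis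
  proof eventually_elim
    case (elim t)
    then have "(\<lambda>N. h N t) \<longlonglongrightarrow> 0" using lim[of t] by simp
    then have "(\<lambda>N. ?k t - h N t) \<longlonglongrightarrow> ?k t - 0" by (intro tendsto_intros)
    then have "(\<lambda>N. cnj (?k t - h N t)) \<longlonglongrightarrow> cnj (?k t - 0)" by (rule tendsto_cnj)
    then show ?case by (simp add: h_def S_def)
  qed
qed

text \<open>A Young inequality with the conjugate exponent q. The exponent a is the midpoint of 1/q
  and 1: a * q > 1 makes \<open>wgt t powr (a * q)\<close> integrable, while a stays below
  1.\<close>

lemma memLp_wgt_integrable:
  assumes p: "1 < p" and f: "memLp p f"
  obtains a where "0 \<le> a" "a < 1" "integrable lebesgue (\<lambda>t. norm (f t) * wgt t powr a)"
proof -
  define q where "q = p / (p - 1)"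
  have q: "q > 1" using p by (simp add: q_def field_simps)
  define a where "a = (1 + 1 / q) / 2"
  have a: "0 \<le> a" "a < 1" "a * q > 1" using q by (auto simp: a_def field_simps)
  have fm: "lmeas f" using f by (simp add: memLp_def)
  have wm: "lmeas (\<lambda>t. wgt t powr r)" for r
    by (rule borel_measurable_lebesgueI) measurable
  \<comment> \<open>Either y \<le> x powr (p - 1), and the product is at most x powr p, or x is
    below y powr (1 / (p - 1)), and it is at most y powr q.\<close>
  have Young: "x * y \<le> x powr p + y powr q" if "0 \<le> x" "0 \<le> y" for x y :: real
  proof (cases "x = 0 \<or> y = 0")
    case False
    then have xy: "x > 0" "y > 0" using that by auto
    show ?thesis
    proof (cases "y \<le> x powr (p - 1)")
      case True
      then have "x * y \<le> x powr 1 * x powr (p - 1)" using xy by (intro mult_mono) auto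
      also have "\<dots> = x powr p" by (simp only: powr_add[symmetric]) simp
      finally show ?thesis by (simp add: add_increasing2)
    next
      case False
      have "x = (x powr (p - 1)) powr (1 / (p - 1))" using xy p by (simp add: powr_powr)
      also have "\<dots> \<le> y powr (1 / (p - 1))" using False p xy by (intro powr_mono2) auto
      finally have "x * y \<le> y powr (1 / (p - 1)) * y powr 1" using xy by (intro mult_mono) auto
      also have "\<dots> = y powr q"
      proof -
        have "1 / (p - 1) + 1 = q" using p by (simp add: q_def field_simps)
        then show ?thesis by (simp only: powr_add[symmetric])
      qed
      finally show ?thesis by (simp add: add_increasing)
    qed
  qed auto
  have "integrable lebesgue (\<lambda>t. norm (f t) * wgt t powr a)"
  proof (rule Bochner_Integration.integrable_bound)
    show "integrable lebesgue (\<lambda>t. norm (f t) powr p + wgt t powr (a * q))"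
      using f integrable_wgt_powr[OF a(3)] by (intro Bochner_Integration.integrable_add) (auto simp: memLp_def)
    show "lmeas (\<lambda>t. norm (f t) * wgt t powr a)"
      using fm wm by (intro borel_measurable_times) auto
    show "AE t in lebesgue. norm (norm (f t) * wgt t powr a) \<le> norm (norm (f t) powr p + wgt t powr (a * q))"
    proof (rule AE_I2, goal_cases)
      case (1 t)
      show ?case
        using Young[of "norm (f t)" "wgt t powr a"] by (simp add: powr_powr)
    qed
  qed
  then show thesis using that a by blast
qed

text \<open>The exceptional x are those where \<open>\<psi> n\<close> and \<open>psi n\<close>
  differ for some n, a countable union of null sets independent of f. For every other x this is
  convergence of integrals in t, where the null set from \<open>kernel_expansion\<close> may depend
  on x.\<close>

lemma PsiN_tendsto:
  assumes p: "1 < p" and f: "memLp p f"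
  shows "AE x in lebesgue. (\<lambda>N. PsiN \<psi> N f x) \<longlonglongrightarrow> Pc c f x"
proof -
  have fm: "lmeas f" using f by (simp add: memLp_def)
  obtain a where a: "0 \<le> a" "a < 1" and fa: "integrable lebesgue (\<lambda>t. norm (f t) * wgt t powr a)"
    using memLp_wgt_integrable[OF p f] by blast
  obtain C where C: "C \<ge> 0" "\<And>n x a. 0 \<le> a \<Longrightarrow> a \<le> 1 \<Longrightarrow> cmod (psi n x) \<le> C * (sig n powr (- a) * wgt x powr a)"
    using psi_interpolated_bound by blast
  have all: "AE x in lebesgue. \<forall>n. \<psi> n x = psi n x"
    unfolding AE_all_countable using psi_AE by blast
  have fi: "integrable lebesgue (\<lambda>t. f t * cnj (\<psi> n t))" for n
  proof (rule Bochner_Integration.integrable_bound)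
    show "integrable lebesgue (\<lambda>t. (C * sig n powr (- a)) * (norm (f t) * wgt t powr a))" using fa by simp
    show "lmeas (\<lambda>t. f t * cnj (\<psi> n t))"
      using fm L2_measurable[OF L2_cnj[OF L2_psi]] by (intro borel_measurable_times) auto
    show "AE t in lebesgue. norm (f t * cnj (\<psi> n t)) \<le> norm ((C * sig n powr (- a)) * (norm (f t) * wgt t powr a))"
      using all
    proof eventually_elim
      case (elim t)
      have "norm (f t * cnj (\<psi> n t)) \<le> norm (f t) * (C * (sig n powr (- a) * wgt t powr a))"
        unfolding norm_mult using C(2)[of a n t] a elim by (intro mult_left_mono) auto
      then show ?case using C(1) by (simp add: mult_ac)
    qed
  qed
  show ?thesis
    using all
  proof eventually_elim
    case (elim x)
    define T where "T = (\<Sum>n. cmod (psi n x) * sig n powr (- a))"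
    have sm: "summable (\<lambda>n. cmod (psi n x) * sig n powr (- a))" by (rule psi_sig_summable[OF a(2)])
    have eq: "PsiN \<psi> N f x = (\<integral>t. f t * (\<Sum>n\<le>N. psi n x * cnj (\<psi> n t)) \<partial>lebesgue)" for N
    proof -
      have "(\<integral>t. f t * (\<Sum>n\<le>N. psi n x * cnj (\<psi> n t)) \<partial>lebesgue) = (\<integral>t. (\<Sum>n\<le>N. psi n x * (f t * cnj (\<psi> n t))) \<partial>lebesgue)"
        by (simp add: sum_distrib_left mult_ac)
      also have "\<dots> = (\<Sum>n\<le>N. psi n x * inner_L f (\<psi> n))" using fi by (simp add: inner_L_def)
      finally show ?thesis using elim by (simp add: PsiN_def mult.commute)
    qed
    show ?case
      unfolding eq Pc_eq_ker[OF fm]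
    proof (rule integral_dominated_convergence[where w = "\<lambda>t. C * T * (norm (f t) * wgt t powr a)"])
      show "lmeas (\<lambda>t. f t * of_real (ker c (x - t)))"
        using fm ker_translate_measurable by (intro borel_measurable_times) auto
      show "lmeas (\<lambda>t. f t * (\<Sum>n\<le>N. psi n x * cnj (\<psi> n t)))" for N
        using fm L2_measurable[OF L2_cnj[OF L2_psi]] by (intro borel_measurable_times borel_measurable_sum) auto
      show "integrable lebesgue (\<lambda>t. C * T * (norm (f t) * wgt t powr a))" using fa by simp
      show "AE t in lebesgue. (\<lambda>N. f t * (\<Sum>n\<le>N. psi n x * cnj (\<psi> n t))) \<longlonglongrightarrow> f t * of_real (ker c (x - t))"
        using kernel_expansion[of x] by eventually_elim (intro tendsto_mult tendsto_const)
      show "AE t in lebesgue. norm (f t * (\<Sum>n\<le>N. psi n x * cnj (\<psi> n t))) \<le> C * T * (norm (f t) * wgt t powr a)" for N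
        using all
      proof eventually_elim
        case (elim t)
        have "norm (\<Sum>n\<le>N. psi n x * cnj (\<psi> n t)) \<le> (\<Sum>n\<le>N. norm (psi n x * cnj (\<psi> n t)))" by (rule norm_sum)
        also have "\<dots> \<le> (\<Sum>n\<le>N. (C * wgt t powr a) * (cmod (psi n x) * sig n powr (- a)))"
        proof (rule sum_mono)
          fix n
          have "norm (psi n x * cnj (\<psi> n t)) \<le> cmod (psi n x) * (C * (sig n powr (- a) * wgt t powr a))"
            unfolding norm_mult using C(2)[of a n t] a elim by (intro mult_left_mono) auto
          then show "norm (psi n x * cnj (\<psi> n t)) \<le> (C * wgt t powr a) * (cmod (psi n x) * sig n powr (- a))"
            by (simp add: mult_ac)
        qed
        also have "\<dots> = (C * wgt t powr a) * (\<Sum>n\<le>N. cmod (psi n x) * sig n powr (- a))" by (simp add: sum_distrib_left)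
        also have "\<dots> \<le> (C * wgt t powr a) * T"
          unfolding T_def using C(1) sm by (intro mult_left_mono sum_le_suminf) auto
        finally have "norm (f t) * norm (\<Sum>n\<le>N. psi n x * cnj (\<psi> n t)) \<le> norm (f t) * ((C * wgt t powr a) * T)"
          by (rule mult_left_mono) simp
        then show ?case by (simp add: norm_mult mult_ac)
      qed
    qed
  qed
qed

end

text \<open>The kernel is bounded, so \<open>Pc c f\<close> is bounded for integrable f; hence |f|
  \<le> B almost everywhere and |f|^2 \<le> B * |f|. This places the case p = 1 inside p =
  2.\<close>

lemma PW1_reproducing:
  assumes c: "c > 0" and f: "PW c 1 f"
  shows "L2 f" "AE x in lebesgue. f x = Pc c f x"
proof -
  have fm: "lmeas f" and fi: "integrable lebesgue (\<lambda>x. norm (f x))"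
    using f by (auto simp: PW_def memLp_def)
  have "integrable lebesgue (\<lambda>t. wgt t * norm (f t))"
  proof (rule Bochner_Integration.integrable_bound[OF fi])
    show "lmeas (\<lambda>t. wgt t * norm (f t))"
      using fm by (intro borel_measurable_times[OF borel_measurable_lebesgueI]) auto
  qed (auto simp: abs_mult mult_left_le_one_le)
  then have mw: "mem_wgt f" using fm by (simp add: mem_wgt_def)
  moreover have "band_lim c f" using f by (simp add: PW_def band_lim_def)
  ultimately show rep: "AE x in lebesgue. f x = Pc c f x" by (rule reproducing[OF _ _ c])
  define B where "B = (2 * c + 1) * (\<integral>x. norm (f x) \<partial>lebesgue)"
  have Pb: "cmod (Pc c f x) \<le> B" for x
  proof -
    have "cmod (Pc c f x) \<le> (\<integral>t. norm (f t * of_real (ker c (x - t))) \<partial>lebesgue)"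
      unfolding Pc_eq_ker[OF fm] by (rule integral_norm_bound)
    also have "\<dots> \<le> (\<integral>t. (2 * c + 1) * norm (f t) \<partial>lebesgue)"
    proof (rule integral_mono)
      show "integrable lebesgue (\<lambda>t. norm (f t * of_real (ker c (x - t))))"
        using c by (intro integrable_norm integrable_mult_ker mw) simp
      show "integrable lebesgue (\<lambda>t. (2 * c + 1) * norm (f t))" using fi by simp
      fix t
      have "\<bar>ker c (x - t)\<bar> \<le> (2 * c + 1) * wgt (x - t)" using c by (intro ker_le) simp
      also have "\<dots> \<le> (2 * c + 1) * 1" using c by (intro mult_left_mono) auto
      finally show "norm (f t * of_real (ker c (x - t))) \<le> (2 * c + 1) * norm (f t)"
        using mult_right_mono[of "\<bar>ker c (x - t)\<bar>" "2 * c + 1" "norm (f t)"] by (simp add: norm_mult mult.commute)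
    qed
    finally show ?thesis by (simp add: B_def)
  qed
  have bd: "AE x in lebesgue. cmod (f x) \<le> B" using rep by eventually_elim (simp add: Pb)
  have "integrable lebesgue (\<lambda>x. (cmod (f x))^2)"
  proof (rule Bochner_Integration.integrable_bound)
    show "integrable lebesgue (\<lambda>x. B * norm (f x))" using fi by simp
    show "AE x in lebesgue. norm ((cmod (f x))^2) \<le> norm (B * norm (f x))"
      using bd by eventually_elim (auto simp: power2_eq_square abs_mult intro!: mult_right_mono)
  qed (use fm in auto)
  then show "L2 f" using fm by (simp add: L2_iff)
qed

theorem theorem1:
  fixes c :: real and \<psi> :: "nat \<Rightarrow> real \<Rightarrow> complex"
  assumes "c > 0" and "is_PSWF c \<psi>"
  shows "(\<forall>p f. 1 < p \<and> memLp p f \<longrightarrow>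
            (AE x in lebesgue. (\<lambda>N. PsiN \<psi> N f x) \<longlonglongrightarrow> Pc c f x))
       \<and> (\<forall>f. PW c 1 f \<longrightarrow> (AE x in lebesgue. (\<lambda>N. PsiN \<psi> N f x) \<longlonglongrightarrow> f x))"
proof -
  interpret pswf c \<psi> by standard (fact assms)+
  show ?thesis
  proof (intro conjI allI impI)
    show "AE x in lebesgue. (\<lambda>N. PsiN \<psi> N f x) \<longlonglongrightarrow> Pc c f x" if "1 < p \<and> memLp p f" for p f
      using PsiN_tendsto that by blast
    fix f assume f: "PW c 1 f"
    have "AE x in lebesgue. (\<lambda>N. PsiN \<psi> N f x) \<longlonglongrightarrow> Pc c f x"
      by (rule PsiN_tendsto[OF _ PW1_reproducing(1)[OF assms(1) f]]) simp
    then show "AE x in lebesgue. (\<lambda>N. PsiN \<psi> N f x) \<longlonglongrightarrow> f x"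
      using PW1_reproducing(2)[OF assms(1) f] by eventually_elim simp
  qed
qed

end
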